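(* Let $\varphi:\mathbb{R}^n\to(-\infty,\infty]$ be lower semicontinuous and prox-regular at $\bar x$ for $\bar x^*\in\partial\varphi(\bar x)$ with parameter $\epsilon>0$, and let $\mathcal T^\varphi_\epsilon$ denote the $\varphi$-attentive $\epsilon$-localization of $\partial\varphi$ around $(\bar x,\bar x^* )$. Then the following statements are equivalent: (i) $\mathcal T^\varphi_\epsilon$ is strictly proto-differentiable at $\bar x$ for $\bar x^*$. (ii) $\mathcal T^\varphi_\epsilon$ is graphically strictly differentiable at $(\bar x,\bar x^* )$. (iii) $\mathrm{gph}\,D^*_\varphi(\partial\varphi)(\bar x,\bar x^* )$ is a subspace. (iv) $\mathcal T^\varphi_\epsilon$ is graphically regular at $(\bar x,\bar x^* )$, i.e. $\widehat N^\varphi_{\mathrm{gph}\,\partial\varphi}(\bar x,\bar x^* )=N^\varphi_{\mathrm{gph}\,\partial\varphi}(\bar x,\bar x^* )$. (v) $\mathcal S_\varphi(\partial\varphi)(\bar x,\bar x^* )$ is a singleton. In every case there holds $\mathcal S_\varphi(\partial\varphi)(\bar x,\bar x^* )=\mathcal S^*_\varphi(\partial\varphi)(\bar x,\bar x^* )=\{\mathrm{gph}\,D_\varphi(\partial\varphi)(\bar x,\bar x^* )\}=\{\mathrm{gph}\,D^*_\varphi(\partial\varphi)(\bar x,\bar x^* )\}$. If, in addition, $\varphi$ is subdifferentially continuous at $\bar x$ for $\bar x^*$, then $\mathcal T^\varphi_\epsilon$ can be replaced by $\partial\varphi$ in these statements.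
   Context: $\mathcal B_r(x)$ is the open ball. For $\varphi:\mathbb{R}^n\to(-\infty,\infty]$ and $\bar x$ with $\varphi(\bar x)<\infty$, the regular subdifferential is $\widehat\partial\varphi(\bar x)=\{x^*\mid\liminf_{x\to\bar x}\frac{\varphi(x)-\varphi(\bar x)-\langle x^*,x-\bar x\rangle}{\|x-\bar x\|}\ge0\}$ and the limiting subdifferential is $\partial\varphi(\bar x)=\{x^*\mid\exists x_k\to\bar x,\ \varphi(x_k)\to\varphi(\bar x),\ x_k^*\to x^*,\ x_k^*\in\widehat\partial\varphi(x_k)\ \forall k\}$ ($\partial\varphi(x)=\emptyset$ if $\varphi(x)=\infty$). An lsc $\varphi$ is prox-regular at $\bar x$ for $\bar x^*$ with parameters $r\ge0$, $\epsilon>0$ if $\varphi(\bar x)$ is finite, $\bar x^*\in\partial\varphi(\bar x)$ and $\varphi(x')\ge\varphi(x)+\langle x^*,x'-x\rangle-\frac r2\|x'-x\|^2$ whenever $x'\in\mathcal B_\epsilon(\bar x)$ and $(x,x^* )\in\mathrm{gph}\,\partial\varphi\cap(\mathcal B_\epsilon(\bar x)\times\mathcal B_\epsilon(\bar x^* ))$ with $\varphi(x)<\varphi(\bar x)+\epsilon$ ("with parameter $\epsilon$" means: for some $r\ge0$). $\varphi$ is subdifferentially continuous at $\bar x$ for $\bar x^*$ if $\varphi(x_k)\to\varphi(\bar x)$ for every sequence $(x_k,x_k^* )\in\mathrm{gph}\,\partial\varphi$ converging to $(\bar x,\bar x^* )$. The $\varphi$-attentive $\epsilon$-localization $\mathcal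 T^\varphi_\epsilon:\mathbb{R}^n\rightrightarrows\mathbb{R}^n$ is given by $\mathrm{gph}\,\mathcal T^\varphi_\epsilon=\{(x,x^* )\in\mathrm{gph}\,\partial\varphi\cap(\mathcal B_\epsilon(\bar x)\times\mathcal B_\epsilon(\bar x^* ))\mid\varphi(x)<\varphi(\bar x)+\epsilon\}$. Write $(x_k,x_k^* )\to_\varphi(x,x^* )$ if $(x_k,x_k^* )\in\mathrm{gph}\,\partial\varphi$, $(x_k,x_k^* )\to(x,x^* )$ and $\varphi(x_k)\to\varphi(x)$. For $(x,x^* )\in\mathrm{gph}\,\partial\varphi$: - $T^\varphi_{\mathrm{gph}\,\partial\varphi}(x,x^* )=\{(u,u^* )\mid\exists t_k\downarrow0,\ (x_k,x_k^* )\to_\varphi(x,x^* ):\ (u,u^* )=\lim_k\frac{(x_k,x_k^* )-(x,x^* )}{t_k}\}$; - $\widehat N^\varphi_{\mathrm{gph}\,\partial\varphi}(x,x^* )$ is the polar cone of $T^\varphi_{\mathrm{gph}\,\partial\varphi}(x,x^* )$ (polar: $A^\circ=\{v\mid\langle v,a\rangle\le0\ \forall a\in A\}$); - $N^\varphi_{\mathrm{gph}\,\partial\varphi}(x,x^* )$ is the set of all limits of sequences $v_k\in\widehat N^\varphi_{\mathrm{gph}\,\partial\varphi}(x_k,x_k^* )$ with $(x_k,x_k^* )\to_\varphi(x,x^* )$; - $\mathrm{gph}\,D_\varphi(\partial\varphi)(x,x^* )=T^\varphi_{\mathrm{gph}\,\partial\varphi}(x,x^* )$ and $\mathrm{gph}\,D^*_\varphi(\partial\varphi)(x,x^*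 )=\{(u,u^* )\mid(u^*,-u)\in N^\varphi_{\mathrm{gph}\,\partial\varphi}(x,x^* )\}$. Let $\mathcal Z_{nn}$ be the set of $n$-dimensional subspaces of $\mathbb{R}^n\times\mathbb{R}^n$ with metric $d_{\mathcal Z}(L_1,L_2)=\|P_{L_1}-P_{L_2}\|$ ($P_L$ = orthogonal projection onto $L$), and $L^*=\{(y^*,x^* )\mid(x^*,-y^* )\in L^\perp\}$. Let $\mathcal O^\varphi_{\partial\varphi}$ be the set of $(x,x^* )\in\mathrm{gph}\,\partial\varphi$ for which $T^\varphi_{\mathrm{gph}\,\partial\varphi}(x,x^* )$ is an $n$-dimensional subspace. Then $\mathcal S_\varphi(\partial\varphi)(x,x^* )=\{L\in\mathcal Z_{nn}\mid\exists(x_k,x_k^* )\in\mathcal O^\varphi_{\partial\varphi},\ (x_k,x_k^* )\to_\varphi(x,x^* ):\ d_{\mathcal Z}(L,T^\varphi_{\mathrm{gph}\,\partial\varphi}(x_k,x_k^* ))\to0\}$ and $\mathcal S^*_\varphi(\partial\varphi)(x,x^* )=\{L^*\mid L\in\mathcal S_\varphi(\partial\varphi)(x,x^* )\}$. For a set-valued mapping $F:\mathbb{R}^n\rightrightarrows\mathbb{R}^m$ and $\bar z=(\bar x,\bar y)\in\Omega:=\mathrm{gph}\,F$: with Painlevé–Kuratowski set limits, $F$ is strictly proto-differentiable at $\bar x$ for $\bar y$ if the limit of $\frac{\Omega-z}{t}$ exists as $z\to\bar z$, $z\in\Omega$, $t\downarrow0$. $F$ is graphically regular at $\bar z$ if $\widehat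 N_\Omega(\bar z)=N_\Omega(\bar z)$, where $T_\Omega(\bar z)=\limsup_{t\downarrow0}\frac{\Omega-\bar z}{t}$, $\widehat N_\Omega(\bar z)=(T_\Omega(\bar z))^\circ$, $N_\Omega(\bar z)=\limsup_{z\to\bar z,\,z\in\Omega}\widehat N_\Omega(z)$. $F$ is graphically strictly differentiable at $\bar z$ if, for some $d$, there are an open neighborhood $W$ of $\bar z$, a one-to-one mapping $\Phi$ from $W$ onto an open subset of $\mathbb{R}^{n+m}$ with $\Phi,\Phi^{-1}$ continuously differentiable, and a Lipschitz continuous $f:U\to\mathbb{R}^{n+m-d}$, $U\subset\mathbb{R}^d$ open, with $\Phi(\Omega\cap W)=\mathrm{gph}\,f$ and $f$ strictly differentiable at $\bar u$, where $(\bar u,f(\bar u))=\Phi(\bar z)$; strict differentiability means that there is a matrix $A$ with $\lim_{u,u'\to\bar u,\,u\ne u'}\frac{f(u')-f(u)-A(u'-u)}{\|u'-u\|}=0$. *)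

theory Defs
  imports "HOL-Analysis.Analysis"
begin

section \<open>Set-valued mappings, set limits, tangent and normal cones\<close>

text \<open>A set-valued mapping from $X$ to $Y$ is a function of type \<open>'a \<Rightarrow> 'b set\<close>.\<close>

definition gph :: "('a \<Rightarrow> 'b set) \<Rightarrow> ('a \<times> 'b) set" where
  "gph F = {(x, y). y \<in> F x}"

definition polar :: "'a::real_inner set \<Rightarrow> 'a set" where
  "polar A = {v. \<forall>a\<in>A. v \<bullet> a \<le> 0}"

text \<open>Sequential Painleve--Kuratowski outer and inner limits of a family of sets \<open>S p\<close>, where the
  parameter \<open>p\<close> moves along a filter.\<close>

definition outer_limit :: "('p \<Rightarrow> 'a::topological_space set) \<Rightarrow> 'p filter \<Rightarrow> 'a set" where
  "outer_limit S \<F> = {w. \<exists>p v. filterlim p \<F> sequentially \<and> (\<forall>k. v k \<in> S (p k)) \<and> v \<longlonglongrightarrow> w}"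

definition inner_limit :: "('p \<Rightarrow> 'a::topological_space set) \<Rightarrow> 'p filter \<Rightarrow> 'a set" where
  "inner_limit S \<F> = {w. \<forall>p. filterlim p \<F> sequentially \<longrightarrow>
     (\<exists>v. (\<forall>\<^sub>F k in sequentially. v k \<in> S (p k)) \<and> v \<longlonglongrightarrow> w)}"

definition set_limit_exists :: "('p \<Rightarrow> 'a::topological_space set) \<Rightarrow> 'p filter \<Rightarrow> bool" where
  "set_limit_exists S \<F> \<longleftrightarrow> inner_limit S \<F> = outer_limit S \<F>"

text \<open>The filter of $z' \to z$ with $z' \in \Omega$. Unlike \<open>at z within \<Omega>\<close> it admits $z' = z$.\<close>

definition nhds_in :: "'a::topological_space set \<Rightarrow> 'a \<Rightarrow> 'a filter" where
  "nhds_in \<Omega> z = inf (nhds z) (principal \<Omega>)"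

definition diff_quot_set :: "'a::real_vector set \<Rightarrow> 'a \<Rightarrow> real \<Rightarrow> 'a set" where
  "diff_quot_set \<Omega> z t = (\<lambda>w. (1 / t) *\<^sub>R (w - z)) ` \<Omega>"

definition tangent_cone :: "'a::euclidean_space set \<Rightarrow> 'a \<Rightarrow> 'a set" where
  "tangent_cone \<Omega> z = outer_limit (diff_quot_set \<Omega> z) (at_right 0)"

definition regular_normal_cone :: "'a::euclidean_space set \<Rightarrow> 'a \<Rightarrow> 'a set" where
  "regular_normal_cone \<Omega> z = polar (tangent_cone \<Omega> z)"

definition limiting_normal_cone :: "'a::euclidean_space set \<Rightarrow> 'a \<Rightarrow> 'a set" where
  "limiting_normal_cone \<Omega> z = outer_limit (regular_normal_cone \<Omega>) (nhds_in \<Omega> z)"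


section \<open>Regularity of set-valued mappings\<close>

definition strictly_proto_differentiable ::
    "('a::euclidean_space \<Rightarrow> 'b::euclidean_space set) \<Rightarrow> 'a \<Rightarrow> 'b \<Rightarrow> bool" where
  "strictly_proto_differentiable F x y \<longleftrightarrow>
     set_limit_exists (\<lambda>(z, t). diff_quot_set (gph F) z t) (nhds_in (gph F) (x, y) \<times>\<^sub>F at_right 0)"

definition graphically_regular ::
    "('a::euclidean_space \<Rightarrow> 'b::euclidean_space set) \<Rightarrow> 'a \<Rightarrow> 'b \<Rightarrow> bool" where
  "graphically_regular F x y \<longleftrightarrow>
     regular_normal_cone (gph F) (x, y) = limiting_normal_cone (gph F) (x, y)"

definition continuously_differentiable_on_open ::
    "'a set \<Rightarrow> ('a::euclidean_space \<Rightarrow> 'b::euclidean_space) \<Rightarrow> bool" where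
  "continuously_differentiable_on_open W f \<longleftrightarrow> open W \<and>
     (\<exists>f'. (\<forall>x\<in>W. (f has_derivative blinfun_apply (f' x)) (at x)) \<and> continuous_on W f')"

definition strictly_differentiable_in ::
    "'a set \<Rightarrow> ('a::euclidean_space \<Rightarrow> 'b::euclidean_space) \<Rightarrow> 'a \<Rightarrow> bool" where
  "strictly_differentiable_in U f u \<longleftrightarrow>
     (\<exists>A. linear A \<and>
       ((\<lambda>(v, w). (f w - f v - A (w - v)) /\<^sub>R norm (w - v)) \<longlongrightarrow> 0)
         (at (u, u) within {(v, w). v \<in> U \<and> w \<in> U \<and> v \<noteq> w}))"

text \<open>The dimension $d$ is existentially quantified, so the factors of
  ${\bf R}^{n+m} = {\bf R}^d \times {\bf R}^{n+m-d}$ cannot be types. They are rendered as a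
  $d$-dimensional linear subspace \<open>K\<close> of the ambient space and its orthogonal complement; the point
  $(u, f(u))$ then becomes \<open>u + f u\<close>, and ``open in ${\bf R}^d$'' becomes ``open relative to \<open>K\<close>''.
  Composing $\Phi$ with a linear isometry identifies this with the coordinate version.\<close>

definition graphically_strictly_differentiable ::
    "('a::euclidean_space \<Rightarrow> 'b::euclidean_space set) \<Rightarrow> 'a \<Rightarrow> 'b \<Rightarrow> bool" where
  "graphically_strictly_differentiable F x y \<longleftrightarrow>
     (\<exists>d K W \<Phi> U f u.
        subspace (K :: ('a \<times> 'b) set) \<and> dim K = d \<and>
        open W \<and> (x, y) \<in> W \<and> inj_on \<Phi> W \<and> open (\<Phi> ` W) \<and>
        continuously_differentiable_on_open W \<Phi> \<and>
        continuously_differentiable_on_open (\<Phi> ` W) (inv_into W \<Phi>) \<and>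
        openin (top_of_set K) U \<and> f ` U \<subseteq> K\<^sup>\<bottom> \<and> (\<exists>C. C-lipschitz_on U f) \<and>
        \<Phi> ` (gph F \<inter> W) = {v + f v | v. v \<in> U} \<and>
        u \<in> U \<and> u + f u = \<Phi> (x, y) \<and> strictly_differentiable_in U f u)"


section \<open>Subdifferentials\<close>

definition lsc :: "('a::topological_space \<Rightarrow> ereal) \<Rightarrow> bool" where
  "lsc \<phi> \<longleftrightarrow> (\<forall>x. \<phi> x \<le> Liminf (at x) \<phi>)"

definition regular_subdifferential :: "('a::euclidean_space \<Rightarrow> ereal) \<Rightarrow> 'a \<Rightarrow> 'a set" where
  "regular_subdifferential \<phi> x = {x'. \<phi> x < \<infinity> \<and>
     0 \<le> Liminf (at x) (\<lambda>y. (\<phi> y - \<phi> x - ereal (x' \<bullet> (y - x))) / ereal (norm (y - x)))}"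

definition limiting_subdifferential :: "('a::euclidean_space \<Rightarrow> ereal) \<Rightarrow> 'a \<Rightarrow> 'a set" where
  "limiting_subdifferential \<phi> x = {x'. \<phi> x < \<infinity> \<and>
     (\<exists>xk xk'. xk \<longlonglongrightarrow> x \<and> (\<lambda>k. \<phi> (xk k)) \<longlonglongrightarrow> \<phi> x \<and> xk' \<longlonglongrightarrow> x' \<and>
        (\<forall>k. xk' k \<in> regular_subdifferential \<phi> (xk k)))}"

definition prox_regular ::
    "('a::euclidean_space \<Rightarrow> ereal) \<Rightarrow> 'a \<Rightarrow> 'a \<Rightarrow> real \<Rightarrow> real \<Rightarrow> bool" where
  "prox_regular \<phi> xbar xbar' r \<epsilon> \<longleftrightarrow>
     r \<ge> 0 \<and> \<epsilon> > 0 \<and> \<bar>\<phi> xbar\<bar> \<noteq> \<infinity> \<and> xbar' \<in> limiting_subdifferential \<phi> xbar \<and>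
     (\<forall>y \<in> ball xbar \<epsilon>. \<forall>x x'.
        (x, x') \<in> gph (limiting_subdifferential \<phi>) \<inter> (ball xbar \<epsilon> \<times> ball xbar' \<epsilon>) \<and>
        \<phi> x < \<phi> xbar + ereal \<epsilon> \<longrightarrow>
        \<phi> y \<ge> \<phi> x + ereal (x' \<bullet> (y - x)) - ereal (r / 2 * (norm (y - x))\<^sup>2))"

definition subdifferentially_continuous ::
    "('a::euclidean_space \<Rightarrow> ereal) \<Rightarrow> 'a \<Rightarrow> 'a \<Rightarrow> bool" where
  "subdifferentially_continuous \<phi> xbar xbar' \<longleftrightarrow>
     (\<forall>xk xk'. (\<forall>k. (xk k, xk' k) \<in> gph (limiting_subdifferential \<phi>)) \<and>
        xk \<longlonglongrightarrow> xbar \<and> xk' \<longlonglongrightarrow> xbar' \<longrightarrow> (\<lambda>k. \<phi> (xk k)) \<longlonglongrightarrow> \<phi> xbar)"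

definition attentive_localization ::
    "('a::euclidean_space \<Rightarrow> ereal) \<Rightarrow> 'a \<Rightarrow> 'a \<Rightarrow> real \<Rightarrow> 'a \<Rightarrow> 'a set" where
  "attentive_localization \<phi> xbar xbar' \<epsilon> x =
     {x'. (x, x') \<in> gph (limiting_subdifferential \<phi>) \<inter> (ball xbar \<epsilon> \<times> ball xbar' \<epsilon>) \<and>
          \<phi> x < \<phi> xbar + ereal \<epsilon>}"


section \<open>\<open>\<phi>\<close>-attentive generalized derivatives of the subdifferential\<close>

definition attentive_conv ::
    "('a::euclidean_space \<Rightarrow> ereal) \<Rightarrow> (nat \<Rightarrow> 'a \<times> 'a) \<Rightarrow> 'a \<times> 'a \<Rightarrow> bool" where
  "attentive_conv \<phi> zk z \<longleftrightarrow>
     (\<forall>k. zk k \<in> gph (limiting_subdifferential \<phi>)) \<and> zk \<longlonglongrightarrow> z \<and>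
     (\<lambda>k. \<phi> (fst (zk k))) \<longlonglongrightarrow> \<phi> (fst z)"

definition attentive_tangent_cone ::
    "('a::euclidean_space \<Rightarrow> ereal) \<Rightarrow> 'a \<times> 'a \<Rightarrow> ('a \<times> 'a) set" where
  "attentive_tangent_cone \<phi> z =
     {w. \<exists>t zk. (\<forall>k. t k > 0) \<and> t \<longlonglongrightarrow> 0 \<and> attentive_conv \<phi> zk z \<and>
           (\<lambda>k. (zk k - z) /\<^sub>R t k) \<longlonglongrightarrow> w}"

definition attentive_regular_normal_cone ::
    "('a::euclidean_space \<Rightarrow> ereal) \<Rightarrow> 'a \<times> 'a \<Rightarrow> ('a \<times> 'a) set" where
  "attentive_regular_normal_cone \<phi> z = polar (attentive_tangent_cone \<phi> z)"

definition attentive_normal_cone ::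
    "('a::euclidean_space \<Rightarrow> ereal) \<Rightarrow> 'a \<times> 'a \<Rightarrow> ('a \<times> 'a) set" where
  "attentive_normal_cone \<phi> z =
     {v. \<exists>zk vk. attentive_conv \<phi> zk z \<and>
           (\<forall>k. vk k \<in> attentive_regular_normal_cone \<phi> (zk k)) \<and> vk \<longlonglongrightarrow> v}"

definition attentive_derivative ::
    "('a::euclidean_space \<Rightarrow> ereal) \<Rightarrow> 'a \<times> 'a \<Rightarrow> 'a \<Rightarrow> 'a set" where
  "attentive_derivative \<phi> z u = {u'. (u, u') \<in> attentive_tangent_cone \<phi> z}"

definition attentive_coderivative ::
    "('a::euclidean_space \<Rightarrow> ereal) \<Rightarrow> 'a \<times> 'a \<Rightarrow> 'a \<Rightarrow> 'a set" where
  "attentive_coderivative \<phi> z u = {u'. (u', - u) \<in> attentive_normal_cone \<phi> z}"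

definition orth_proj :: "'a::euclidean_space set \<Rightarrow> 'a \<Rightarrow> 'a" where
  "orth_proj L x = (THE p. p \<in> L \<and> x - p \<in> L\<^sup>\<bottom>)"

definition subspaces_nn :: "('a::euclidean_space \<times> 'a) set set" where
  "subspaces_nn = {L. subspace L \<and> dim L = DIM('a)}"

definition subspace_dist :: "'a::euclidean_space set \<Rightarrow> 'a set \<Rightarrow> real" where
  "subspace_dist L\<^sub>1 L\<^sub>2 = onorm (\<lambda>x. orth_proj L\<^sub>1 x - orth_proj L\<^sub>2 x)"

definition adjoint_subspace :: "('a::euclidean_space \<times> 'a) set \<Rightarrow> ('a \<times> 'a) set" where
  "adjoint_subspace L = {(y', x'). (x', - y') \<in> L\<^sup>\<bottom>}"

definition attentive_smooth_points :: "('a::euclidean_space \<Rightarrow> ereal) \<Rightarrow> ('a \<times> 'a) set" where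
  "attentive_smooth_points \<phi> =
     {z \<in> gph (limiting_subdifferential \<phi>). attentive_tangent_cone \<phi> z \<in> subspaces_nn}"

definition SC_derivative ::
    "('a::euclidean_space \<Rightarrow> ereal) \<Rightarrow> 'a \<times> 'a \<Rightarrow> ('a \<times> 'a) set set" where
  "SC_derivative \<phi> z =
     {L \<in> subspaces_nn. \<exists>zk. (\<forall>k. zk k \<in> attentive_smooth_points \<phi>) \<and> attentive_conv \<phi> zk z \<and>
        (\<lambda>k. subspace_dist L (attentive_tangent_cone \<phi> (zk k))) \<longlonglongrightarrow> 0}"

definition SC_adjoint_derivative ::
    "('a::euclidean_space \<Rightarrow> ereal) \<Rightarrow> 'a \<times> 'a \<Rightarrow> ('a \<times> 'a) set set" where
  "SC_adjoint_derivative \<phi> z = adjoint_subspace ` SC_derivative \<phi> z"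


section \<open>Equivalence of a list of statements\<close>

definition all_equivalent :: "bool list \<Rightarrow> bool" where
  "all_equivalent Ps \<longleftrightarrow> (\<forall>P \<in> set Ps. \<forall>Q \<in> set Ps. P \<longleftrightarrow> Q)"

end

theory Submission
  imports Defs
begin

text \<open>
Everything takes place on the graph \<open>\<Omega>\<close> of the attentive localization near the reference point \<open>(xbar, xbar')\<close>.
Prox-regularity makes the localization monotone up to a multiple of the identity, so for a small step \<open>lam\<close> the linear map
\<open>E (x, x') = x + lam *\<^sub>R x'\<close> is injective on \<open>\<Omega>\<close> with a Lipschitz inverse \<open>G\<close> (\<open>E_expansive\<close>), and minimizing
\<open>\<phi> y + (norm (y - w))\<^sup>2 / (2 * lam)\<close> locally shows that its values fill a neighbourhood of the point \<open>w0 = E (xbar, xbar')\<close>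
(\<open>prox_point_exists\<close>). So \<open>\<Omega>\<close> is, near the reference point, a Lipschitz manifold parametrized by \<open>G\<close>, whose first component
is the proximal map. On \<open>\<Omega>\<close> convergence of the points forces convergence of the function values, so the attentive cones are the
ordinary cones of \<open>\<Omega>\<close>.

For a Lipschitz manifold all the statements in question are equivalent to strict differentiability of \<open>G\<close> at \<open>w0\<close>:

\<^item> A strict derivative of \<open>G\<close> gives graphical strict differentiability, which gives strict proto-differentiability for
  any set-valued mapping, and the limit that exists then defines a strict derivative of \<open>G\<close> (\<open>strict_if_strictly_proto\<close>).

\<^item> The tangent cone at a point is a subspace of full dimension exactly where \<open>G\<close> is differentiable, so the SC derivative consists of
  the ranges of the limits of derivatives of \<open>G\<close> (\<open>SC_limits_eq\<close>). By the theorem of Rademacher such limits exist. If there is only one, then a mean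
  value inequality that ignores null sets shows that \<open>G\<close> minus this limit has a small Lipschitz constant near \<open>w0\<close>
  (\<open>strict_if_unique_cluster\<close>).

\<^item> If the limiting normal cone is closed under addition, in particular if it is a subspace or equals the
  convex cone of regular normals, then it is the orthogonal complement of every limit of tangent spaces
  (\<open>limiting_normal_eq_cluster_perp\<close>), and again there is only one. Conversely, a strict derivative makes both normal cones equal to the
  orthogonal complement of its range.

The identities say in addition that the tangent space equals its adjoint. This expresses symmetry of the derivative of the proximal map, which
is a gradient (\<open>strict_derivative_self_adjoint\<close>). Under subdifferential continuity the full graph of the
subdifferential agrees with \<open>\<Omega>\<close> near the reference point, so the same parametrization serves it.

The theorem of Rademacher is proved in two stages. In one variable, a monotone Lipschitz function is the integral of a Radon-Nikodym density,
and a Vitali covering argument shows that the density is the derivative almost everywhere. In several variables,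
partial derivatives exist almost everywhere by Fubini, and at nonporous points of the sets where they are uniformly controlled
they assemble to a derivative.
\<close>

section \<open>Differentiation of Lipschitz functions of one real variable\<close>

text \<open>This is the only place where a covering theorem is used. Take an open \<open>T \<supseteq> A\<close> that exceeds
\<open>A\<close> (inside a bounded region) by little, and use Vitali to cover \<open>S\<close> up to a null set by disjoint balls
inside \<open>T\<close>. Each ball has at least the share \<open>k\<close> of its volume outside \<open>A\<close>, so the balls together have
volume at most \<open>|T - A| / k\<close>, which is arbitrarily small. Only \<open>A\<close> has to be measurable: \<open>S\<close> will be an
exceptional set about which nothing is known beforehand.\<close>

lemma negligible_if_complement_thick:
  fixes S A :: "'a::euclidean_space set"
  assumes A: "A \<in> sets borel" and "S \<subseteq> A" and "k > 0"
    and dens: "\<And>x \<rho>. x \<in> S \<Longrightarrow> \<rho> > 0 \<Longrightarrow> \<exists>a r. 0 < r \<and> r < \<rho> \<and> x \<in> cball a r \<and>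
      ennreal k * emeasure lborel (cball a r) \<le> emeasure lborel (cball a r - A)"
  shows "negligible S"
proof -
  have bounded_part: "negligible (S \<inter> ball 0 (real n))" for n
  proof (subst negligible_outer_le, intro allI impI)
    fix e :: real assume "e > 0"
    define B :: "'a set" where "B = ball 0 (real n)"
    have AB: "A \<inter> B \<in> sets borel" using A by (auto simp: B_def)
    then have "A \<inter> B \<in> sets lebesgue" by auto
    with \<open>e > 0\<close> \<open>k > 0\<close> obtain T where T: "open T" "A \<inter> B \<subseteq> T" "(T - A \<inter> B) \<in> lmeasurable"
        "emeasure lebesgue (T - A \<inter> B) < ennreal (k * e)"
      by (metis sets_lebesgue_outer_open mult_pos_pos)
    define U where "U = T \<inter> B"
    have "open U" using T by (auto simp: U_def B_def)
    have SU: "S \<inter> B \<subseteq> U" using T \<open>S \<subseteq> A\<close> by (auto simp: U_def)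
    have UB: "U \<subseteq> B" by (auto simp: U_def)
    have "U - A \<subseteq> T - A \<inter> B" by (auto simp: U_def)
    then have "emeasure lborel (U - A) \<le> emeasure lborel (T - A \<inter> B)"
      using T AB A by (intro emeasure_mono) auto
    also have "\<dots> = emeasure lebesgue (T - A \<inter> B)"
      using T AB by simp
    finally have small: "emeasure lborel (U - A) \<le> ennreal (k * e)"
      using T by auto
    define K where "K = {(a, r). 0 < r \<and> cball a r \<subseteq> U \<and>
      ennreal k * emeasure lborel (cball a r) \<le> emeasure lborel (cball a r - A)}"
    obtain C where C: "countable C" "C \<subseteq> K"
      "pairwise (\<lambda>i j. disjnt (cball (fst i) (snd i)) (cball (fst j) (snd j))) C"
      "negligible (S \<inter> B - (\<Union>i\<in>C. cball (fst i) (snd i)))"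
    proof (rule Vitali_covering_theorem_cballs[of K snd "S \<inter> B" fst])
      show "0 < snd i" if "i \<in> K" for i using that by (auto simp: K_def)
      fix x d assume x: "x \<in> S \<inter> B" and "(0::real) < d"
      then obtain \<eta> where \<eta>: "\<eta> > 0" "ball x \<eta> \<subseteq> U"
        using SU \<open>open U\<close> open_contains_ball by blast
      obtain a r where ar: "0 < r" "r < min d (\<eta>/2)" "x \<in> cball a r"
        "ennreal k * emeasure lborel (cball a r) \<le> emeasure lborel (cball a r - A)"
        using dens[of x "min d (\<eta>/2)"] x \<eta> \<open>0 < d\<close> by auto
      have "cball a r \<subseteq> ball x \<eta>"
      proof
        fix y assume "y \<in> cball a r"
        then show "y \<in> ball x \<eta>" using ar dist_triangle[of x y a] by (auto simp: dist_commute)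
      qed
      with ar \<eta> show "\<exists>i. i \<in> K \<and> x \<in> cball (fst i) (snd i) \<and> snd i < d"
        by (intro exI[of _ "(a, r)"]) (auto simp: K_def)
    qed
    define W where "W = (\<Union>i\<in>C. cball (fst i) (snd i))"
    have disj: "disjoint_family_on (\<lambda>i. cball (fst i) (snd i)) C"
      using C(3) by (auto simp: disjoint_family_on_def pairwise_def disjnt_def)
    then have disjA: "disjoint_family_on (\<lambda>i. cball (fst i) (snd i) - A) C"
      unfolding disjoint_family_on_def by blast
    have WU: "W \<subseteq> U" using C(2) by (fastforce simp: W_def K_def)
    have Wb: "W \<in> sets borel" using C(1) by (auto simp: W_def)
    have "ennreal k * emeasure lborel W = ennreal k * (\<integral>\<^sup>+ i. emeasure lborel (cball (fst i) (snd i)) \<partial>count_space C)"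
      unfolding W_def by (subst emeasure_UN_countable[OF _ C(1) disj]) auto
    also have "\<dots> = (\<integral>\<^sup>+ i. ennreal k * emeasure lborel (cball (fst i) (snd i)) \<partial>count_space C)"
      by (subst nn_integral_cmult) auto
    also have "\<dots> \<le> (\<integral>\<^sup>+ i. emeasure lborel (cball (fst i) (snd i) - A) \<partial>count_space C)"
      using C(2) by (intro nn_integral_mono) (auto simp: K_def)
    also have "\<dots> = emeasure lborel (\<Union>i\<in>C. cball (fst i) (snd i) - A)"
      using A by (subst emeasure_UN_countable[OF _ C(1) disjA]) auto
    also have "\<dots> \<le> emeasure lborel (U - A)"
      using WU A \<open>open U\<close> by (intro emeasure_mono) (auto simp: W_def)
    also have "\<dots> \<le> ennreal (k * e)" by (rule small)
    finally have kW: "ennreal k * emeasure lborel W \<le> ennreal (k * e)" .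
    have "W \<subseteq> B" using WU UB by auto
    then have "emeasure lborel W \<le> emeasure lborel B"
      using Wb by (intro emeasure_mono) (auto simp: B_def)
    also have "\<dots> < \<infinity>" unfolding B_def by (rule emeasure_lborel_ball_finite)
    finally have Wfin: "emeasure lborel W < \<infinity>" .
    then have Wm: "W \<in> lmeasurable" using Wb by (auto simp: fmeasurable_def)
    have "emeasure lborel W = ennreal (measure lebesgue W)"
      using emeasure_eq_measure2[OF Wm] Wb by simp
    with kW have "ennreal (k * measure lebesgue W) \<le> ennreal (k * e)"
      using \<open>k > 0\<close> by (simp add: ennreal_mult)
    then have We: "measure lebesgue W \<le> e"
      using \<open>k > 0\<close> \<open>e > 0\<close> by (simp add: ennreal_le_iff)
    have neg: "negligible (S \<inter> B - W)" using C(4) by (simp add: W_def)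
    have "S \<inter> B \<subseteq> W \<union> (S \<inter> B - W)" by auto
    moreover have "W \<union> (S \<inter> B - W) \<in> lmeasurable"
      by (rule fmeasurable.Un[OF Wm negligible_imp_measurable[OF neg]])
    moreover have "measure lebesgue (W \<union> (S \<inter> B - W)) \<le> e"
    proof -
      have "S \<inter> B - W \<in> null_sets lebesgue" using neg by (simp only: negligible_iff_null_sets)
      then show ?thesis using We measure_Un_null_set[OF fmeasurableD[OF Wm]] by (simp only:)
    qed
    ultimately show "\<exists>T. S \<inter> ball 0 (real n) \<subseteq> T \<and> T \<in> lmeasurable \<and> measure lebesgue T \<le> e"
      unfolding B_def by blast
  qed
  have "S = (\<Union>n. S \<inter> ball 0 (real n))"
    using reals_Archimedean2 by (auto simp: dist_norm)
  moreover have "negligible (\<Union>n. S \<inter> ball 0 (real n))"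
    by (rule negligible_Union_nat) (rule bounded_part)
  ultimately show ?thesis by simp
qed

text \<open>The Stieltjes measures of \<open>F\<close> and of \<open>x \<mapsto> L * x - F x\<close>, which is also nondecreasing, add up to \<open>L\<close> times
Lebesgue measure. Hence the former is dominated by a multiple of Lebesgue measure, and the Radon-Nikodym theorem
represents the increments of \<open>F\<close> as integrals of a density.\<close>

lemma mono_lipschitz_density:
  fixes F :: "real \<Rightarrow> real"
  assumes mono: "\<And>x y. x \<le> y \<Longrightarrow> F x \<le> F y" and L: "L > 0"
    and lip: "\<And>x y. x \<le> y \<Longrightarrow> F y - F x \<le> L * (y - x)"
  obtains h :: "real \<Rightarrow> ennreal" where "h \<in> borel_measurable borel"
    "\<And>X. X \<in> sets borel \<Longrightarrow> (\<integral>\<^sup>+x\<in>X. h x \<partial>lborel) \<le> ennreal L * emeasure lborel X"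
    "\<And>a b. a \<le> b \<Longrightarrow> (\<integral>\<^sup>+x\<in>{a..b}. h x \<partial>lborel) = ennreal (F b - F a)"
proof -
  have "L-lipschitz_on UNIV F"
  proof (rule lipschitz_onI)
    fix x y show "dist (F x) (F y) \<le> L * dist x y"
      using lip[of x y] lip[of y x] mono[of x y] mono[of y x]
      by (cases "x \<le> y") (auto simp: dist_real_def abs_if)
  qed (use L in auto)
  then have contF: "continuous_on UNIV F" by (rule lipschitz_on_continuous_on)
  define G where "G x = L * x - F x" for x
  have monoG: "G x \<le> G y" if "x \<le> y" for x y
    using lip[OF that] by (simp add: G_def algebra_simps)
  have contG: "continuous_on UNIV G"
    unfolding G_def by (intro continuous_intros contF)
  have F_at: "continuous (at_right a) F" and G_at: "continuous (at_right a) G" for a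
    using contF contG by (auto simp: continuous_on_eq_continuous_within intro: continuous_within_subset)
  define \<nu> where "\<nu> = interval_measure F"
  define \<mu> where "\<mu> = interval_measure G"
  have sets[simp, measurable_cong]: "sets \<nu> = sets borel" "sets \<mu> = sets borel" by (auto simp: \<nu>_def \<mu>_def)
  have \<nu>_Icc: "emeasure \<nu> {a..b} = ennreal (F b - F a)" if "a \<le> b" for a b
    unfolding \<nu>_def using that mono contF by (rule emeasure_interval_measure_Icc)
  have \<mu>_Icc: "emeasure \<mu> {a..b} = ennreal (G b - G a)" if "a \<le> b" for a b
    unfolding \<mu>_def using that monoG contG by (rule emeasure_interval_measure_Icc)
  have pt: "emeasure \<nu> {a} = 0" "emeasure \<mu> {a} = 0" for a
    using \<nu>_Icc[of a a] \<mu>_Icc[of a a] by auto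
  have Ioo: "emeasure \<nu> {a<..<b} + emeasure \<mu> {a<..<b} = ennreal (L * (b - a))" if "a \<le> b" for a b
  proof (cases "a = b")
    case False
    with that have "a < b" by auto
    have "{a..b} = {a<..<b} \<union> {a, b}" using that by auto
    moreover have "{a, b} \<in> null_sets \<nu>" "{a, b} \<in> null_sets \<mu>"
      using pt by (auto simp: insert_commute intro!: null_setsI emeasure_Un_null_set[of "{a}" _ "{b}", simplified, THEN trans])
    ultimately have "emeasure \<nu> {a<..<b} = emeasure \<nu> {a..b}" "emeasure \<mu> {a<..<b} = emeasure \<mu> {a..b}"
      using emeasure_Un_null_set[of "{a<..<b}" \<nu> "{a, b}"] emeasure_Un_null_set[of "{a<..<b}" \<mu> "{a, b}"]
      by simp_all
    then show ?thesis using \<nu>_Icc[OF that] \<mu>_Icc[OF that] mono[OF that] monoG[OF that]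
      by (simp add: ennreal_plus[symmetric] G_def algebra_simps)
  qed auto
  \<comment> \<open>The sum of the two Stieltjes measures, scaled so that it assigns to intervals their lengths.\<close>
  define M where "M = measure_of UNIV (sets borel) (\<lambda>X. (emeasure \<nu> X + emeasure \<mu> X) / ennreal L)"
  have sigb: "sigma_algebra (UNIV::real set) (sets borel)"
    using sets.sigma_algebra_axioms[of "borel::real measure"] by simp
  have setsM: "sets M = sets borel"
    unfolding M_def using sigma_algebra.sets_measure_of_eq[OF sigb] by simp
  have emM: "emeasure M X = (emeasure \<nu> X + emeasure \<mu> X) / ennreal L" if "X \<in> sets borel" for X
    unfolding M_def
  proof (rule emeasure_measure_of_sigma[OF sigb _ _ that])
    show "positive (sets borel) (\<lambda>X. (emeasure \<nu> X + emeasure \<mu> X) / ennreal L)"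
      by (auto simp: positive_def)
    show "countably_additive (sets borel) (\<lambda>X. (emeasure \<nu> X + emeasure \<mu> X) / ennreal L)"
    proof (rule countably_additiveI)
      fix A :: "nat \<Rightarrow> real set"
      assume A: "range A \<subseteq> sets borel" "disjoint_family A" "\<Union> (range A) \<in> sets borel"
      have "(\<Sum>i. (emeasure \<nu> (A i) + emeasure \<mu> (A i)) / ennreal L)
        = ((\<Sum>i. emeasure \<nu> (A i)) + (\<Sum>i. emeasure \<mu> (A i))) / ennreal L"
        by (simp add: ennreal_suminf_divide suminf_add[symmetric])
      also have "\<dots> = (emeasure \<nu> (\<Union> (range A)) + emeasure \<mu> (\<Union> (range A))) / ennreal L"
        using A by (simp add: suminf_emeasure)
      finally show "(\<Sum>i. (emeasure \<nu> (A i) + emeasure \<mu> (A i)) / ennreal L) =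
        (emeasure \<nu> (\<Union> (range A)) + emeasure \<mu> (\<Union> (range A))) / ennreal L" .
    qed
  qed
  have "lborel = M"
  proof (rule lborel_eqI)
    fix l u :: real assume "\<And>b. b \<in> Basis \<Longrightarrow> l \<bullet> b \<le> u \<bullet> b"
    then have lu: "l \<le> u" by auto
    show "emeasure M (box l u) = (\<Prod>b\<in>Basis. (u - l) \<bullet> b)"
      using lu L by (simp add: emM Ioo[OF lu] divide_ennreal)
  qed (rule setsM)
  have dom: "emeasure \<nu> X \<le> ennreal L * emeasure lborel X" if "X \<in> sets borel" for X
  proof -
    have "ennreal L * emeasure lborel X = ((emeasure \<nu> X + emeasure \<mu> X) * ennreal L) / ennreal L"
      unfolding \<open>lborel = M\<close> emM[OF that] by (simp only: ennreal_times_divide mult.commute)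
    also have "\<dots> = emeasure \<nu> X + emeasure \<mu> X"
      using L by (intro mult_divide_eq_ennreal) auto
    finally have "ennreal L * emeasure lborel X = emeasure \<nu> X + emeasure \<mu> X" .
    then show ?thesis by simp
  qed
  have "absolutely_continuous lborel \<nu>"
    unfolding absolutely_continuous_def
  proof
    fix X assume "X \<in> null_sets (lborel::real measure)"
    then have "X \<in> sets borel" "emeasure lborel X = 0" by (auto simp: null_sets_def)
    with dom[of X] have "emeasure \<nu> X = 0" by simp
    then show "X \<in> null_sets \<nu>" using \<open>X \<in> sets borel\<close> by (simp add: null_sets_def)
  qed
  then obtain h where h: "h \<in> borel_measurable lborel" "density lborel h = \<nu>"
    using sigma_finite_measure.Radon_Nikodym[OF sigma_finite_lborel, of \<nu>] by auto
  have eq: "(\<integral>\<^sup>+x\<in>X. h x \<partial>lborel) = emeasure \<nu> X" if "X \<in> sets borel" for X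
    using that h by (simp add: h(2)[symmetric] emeasure_density)
  show ?thesis
  proof (rule that[of h])
    show "h \<in> borel_measurable borel" using h(1) by simp
  qed (simp_all add: eq dom \<nu>_Icc)
qed

lemma AE_not_in_negligible:
  assumes "negligible N"
  shows "AE x in lborel. x \<notin> N"
proof -
  obtain N' where "N' \<in> null_sets lborel" "N \<subseteq> N'"
    using assms by (auto simp: negligible_iff_null_sets null_sets_completion_iff2)
  then show ?thesis using AE_not_in[of N' lborel] by (auto elim: eventually_mono)
qed

text \<open>If \<open>F\<close> grows on an interval at a rate of at least \<open>\<beta>\<close>, then the points with density at most \<open>\<gamma> < \<beta>\<close> cannot account
for it. Since the Stieltjes measure is dominated by \<open>L\<close> times Lebesgue measure, a share \<open>(\<beta> - \<gamma>) / L\<close> of the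
interval lies outside the set of these points.\<close>

lemma negligible_slope_exceeds_density:
  fixes F :: "real \<Rightarrow> real" and h :: "real \<Rightarrow> ennreal"
  assumes L: "L > 0" and h[measurable]: "h \<in> borel_measurable borel"
    and dom: "\<And>X. X \<in> sets borel \<Longrightarrow> (\<integral>\<^sup>+x\<in>X. h x \<partial>lborel) \<le> ennreal L * emeasure lborel X"
    and int: "\<And>a b. a \<le> b \<Longrightarrow> (\<integral>\<^sup>+x\<in>{a..b}. h x \<partial>lborel) = ennreal (F b - F a)"
    and "0 \<le> \<gamma>" "\<gamma> < \<beta>"
  shows "negligible {x. h x \<le> ennreal \<gamma> \<and> (\<forall>\<rho>>0. \<exists>a b. a < b \<and> b - a < \<rho> \<and> x \<in> {a..b} \<and> \<beta> * (b - a) \<le> F b - F a)}"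
proof (rule negligible_if_complement_thick[where A="{x. h x \<le> ennreal \<gamma>}" and k="(\<beta> - \<gamma>) / L"])
  show A: "{x. h x \<le> ennreal \<gamma>} \<in> sets borel" by measurable
  show "0 < (\<beta> - \<gamma>) / L" using assms by auto
  fix x \<rho> :: real
  let ?A = "{x. h x \<le> ennreal \<gamma>}"
  assume "x \<in> {x. h x \<le> ennreal \<gamma> \<and> (\<forall>\<rho>>0. \<exists>a b. a < b \<and> b - a < \<rho> \<and> x \<in> {a..b} \<and> \<beta> * (b - a) \<le> F b - F a)}" "\<rho> > 0"
  then obtain a b where ab: "a < b" "b - a < \<rho>" "x \<in> {a..b}" "\<beta> * (b - a) \<le> F b - F a" by blast
  define I where "I = {a..b}"
  have ball: "I = cball ((a + b) / 2) ((b - a) / 2)"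
    by (auto simp: cball_eq_atLeastAtMost I_def field_simps)
  have I[measurable]: "I \<in> sets borel" "?A \<in> sets borel" using A by (auto simp: I_def)
  have mI: "emeasure lborel I = ennreal (b - a)" using ab by (simp add: I_def)
  have "ennreal (\<beta> * (b - a)) \<le> ennreal (F b - F a)" using ab by (intro ennreal_leI) auto
  also have "\<dots> = (\<integral>\<^sup>+x\<in>I. h x \<partial>lborel)" using int[of a b] ab by (simp add: I_def)
  also have "\<dots> = (\<integral>\<^sup>+x. (h x * indicator (I \<inter> ?A) x + h x * indicator (I - ?A) x) \<partial>lborel)"
    by (intro nn_integral_cong) (auto simp: indicator_def)
  also have "\<dots> = (\<integral>\<^sup>+x\<in>(I \<inter> ?A). h x \<partial>lborel) + (\<integral>\<^sup>+x\<in>(I - ?A). h x \<partial>lborel)"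
    by (intro nn_integral_add) measurable
  also have "\<dots> \<le> ennreal \<gamma> * ennreal (b - a) + ennreal L * emeasure lborel (I - ?A)"
  proof (intro add_mono)
    have "(\<integral>\<^sup>+x\<in>(I \<inter> ?A). h x \<partial>lborel) \<le> (\<integral>\<^sup>+x. ennreal \<gamma> * indicator I x \<partial>lborel)"
      by (intro nn_integral_mono) (auto simp: indicator_def)
    also have "\<dots> = ennreal \<gamma> * ennreal (b - a)"
      by (subst nn_integral_cmult_indicator) (auto simp: mI)
    finally show "(\<integral>\<^sup>+x\<in>(I \<inter> ?A). h x \<partial>lborel) \<le> ennreal \<gamma> * ennreal (b - a)" .
    show "(\<integral>\<^sup>+x\<in>(I - ?A). h x \<partial>lborel) \<le> ennreal L * emeasure lborel (I - ?A)"
      using A by (intro dom) auto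
  qed
  finally have *: "ennreal (\<beta> * (b - a)) \<le> ennreal (\<gamma> * (b - a)) + ennreal L * emeasure lborel (I - ?A)"
    using assms ab by (simp add: ennreal_mult)
  have "emeasure lborel (I - ?A) \<le> emeasure lborel I" by (intro emeasure_mono) auto
  then have fin: "emeasure lborel (I - ?A) < top" using mI by (simp add: order_le_less_trans)
  define m where "m = measure lborel (I - ?A)"
  have m: "emeasure lborel (I - ?A) = ennreal m" "m \<ge> 0"
    using fin by (auto simp: m_def emeasure_eq_ennreal_measure)
  have "\<beta> * (b - a) \<le> \<gamma> * (b - a) + L * m"
    using * assms ab m unfolding m(1) by (simp add: ennreal_mult[symmetric] ennreal_plus[symmetric] ennreal_le_iff del: ennreal_plus)
  then have "(\<beta> - \<gamma>) / L * (b - a) \<le> m" using L by (simp add: field_simps)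
  then have "ennreal ((\<beta> - \<gamma>) / L) * emeasure lborel I \<le> emeasure lborel (I - ?A)"
    using assms ab by (simp add: m mI ennreal_mult[symmetric] ennreal_leI)
  then show "\<exists>a r. 0 < r \<and> r < \<rho> \<and> x \<in> cball a r \<and> ennreal ((\<beta> - \<gamma>) / L) * emeasure lborel (cball a r) \<le> emeasure lborel (cball a r - ?A)"
    unfolding ball using ab
    by - (rule exI[of _ "(a+b)/2"], rule exI[of _ "(b-a)/2"], auto simp: dist_real_def abs_le_iff field_simps)
qed auto

text \<open>The mirror image: an average growth of at most \<open>\<beta>\<close> on an interval leaves room for a density of at least
\<open>\<gamma> > \<beta>\<close> only on a share \<open>\<beta> / \<gamma>\<close> of the interval.\<close>

lemma negligible_slope_below_density:
  fixes F :: "real \<Rightarrow> real" and h :: "real \<Rightarrow> ennreal"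
  assumes h[measurable]: "h \<in> borel_measurable borel"
    and int: "\<And>a b. a \<le> b \<Longrightarrow> (\<integral>\<^sup>+x\<in>{a..b}. h x \<partial>lborel) = ennreal (F b - F a)"
    and "0 \<le> \<beta>" "\<beta> < \<gamma>"
  shows "negligible {x. h x \<ge> ennreal \<gamma> \<and> (\<forall>\<rho>>0. \<exists>a b. a < b \<and> b - a < \<rho> \<and> x \<in> {a..b} \<and> F b - F a \<le> \<beta> * (b - a))}"
proof (rule negligible_if_complement_thick[where A="{x. h x \<ge> ennreal \<gamma>}" and k="(\<gamma> - \<beta>) / \<gamma>"])
  let ?A = "{x. h x \<ge> ennreal \<gamma>}"
  show A: "?A \<in> sets borel" by measurable
  show "0 < (\<gamma> - \<beta>) / \<gamma>" using assms by auto
  fix x \<rho> :: real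
  assume "x \<in> {x. h x \<ge> ennreal \<gamma> \<and> (\<forall>\<rho>>0. \<exists>a b. a < b \<and> b - a < \<rho> \<and> x \<in> {a..b} \<and> F b - F a \<le> \<beta> * (b - a))}" "\<rho> > 0"
  then obtain a b where ab: "a < b" "b - a < \<rho>" "x \<in> {a..b}" "F b - F a \<le> \<beta> * (b - a)" by blast
  define I where "I = {a..b}"
  have ball: "I = cball ((a + b) / 2) ((b - a) / 2)"
    by (auto simp: cball_eq_atLeastAtMost I_def field_simps)
  have I[measurable]: "I \<in> sets borel" "?A \<in> sets borel" using A by (auto simp: I_def)
  have mI: "emeasure lborel I = ennreal (b - a)" using ab by (simp add: I_def)
  have "emeasure lborel (I - ?A) \<le> emeasure lborel I" "emeasure lborel (I \<inter> ?A) \<le> emeasure lborel I"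
    by (intro emeasure_mono; auto)+
  then have fin: "emeasure lborel (I - ?A) < top" "emeasure lborel (I \<inter> ?A) < top" using mI by (simp_all add: order_le_less_trans)
  define m n where "m = measure lborel (I - ?A)" and "n = measure lborel (I \<inter> ?A)"
  have m: "emeasure lborel (I - ?A) = ennreal m" "m \<ge> 0"
    using fin by (auto simp: m_def emeasure_eq_ennreal_measure)
  have n: "emeasure lborel (I \<inter> ?A) = ennreal n" "n \<ge> 0"
    using fin by (auto simp: n_def emeasure_eq_ennreal_measure)
  have "emeasure lborel I = emeasure lborel (I \<inter> ?A) + emeasure lborel (I - ?A)"
    by (subst plus_emeasure) (auto intro!: arg_cong[where f="emeasure lborel"])
  then have mn: "b - a = n + m"
    using m n mI ab by (simp add: ennreal_plus[symmetric] del: ennreal_plus)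
  have "ennreal \<gamma> * ennreal n = (\<integral>\<^sup>+x. ennreal \<gamma> * indicator (I \<inter> ?A) x \<partial>lborel)"
    by (subst nn_integral_cmult_indicator) (auto simp: n)
  also have "\<dots> \<le> (\<integral>\<^sup>+x\<in>I. h x \<partial>lborel)"
    by (intro nn_integral_mono) (auto simp: indicator_def)
  also have "\<dots> = ennreal (F b - F a)" using int[of a b] ab by (simp add: I_def)
  also have "\<dots> \<le> ennreal (\<beta> * (b - a))" using ab by (intro ennreal_leI) auto
  finally have "\<gamma> * n \<le> \<beta> * (b - a)"
    using assms ab n by (simp add: ennreal_mult[symmetric] ennreal_le_iff)
  then have "(\<gamma> - \<beta>) / \<gamma> * (b - a) \<le> m" using assms unfolding mn by (simp add: field_simps)
  then have "ennreal ((\<gamma> - \<beta>) / \<gamma>) * emeasure lborel I \<le> emeasure lborel (I - ?A)"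
    using assms ab by (simp add: m mI ennreal_mult[symmetric] ennreal_leI)
  then show "\<exists>a r. 0 < r \<and> r < \<rho> \<and> x \<in> cball a r \<and> ennreal ((\<gamma> - \<beta>) / \<gamma>) * emeasure lborel (cball a r) \<le> emeasure lborel (cball a r - ?A)"
    unfolding ball using ab
    by - (rule exI[of _ "(a+b)/2"], rule exI[of _ "(b-a)/2"], auto simp: dist_real_def abs_le_iff field_simps)
qed auto

lemma has_real_derivative_if_slopes:
  fixes f :: "real \<Rightarrow> real"
  assumes "\<And>e. e > 0 \<Longrightarrow> \<exists>\<rho>>0. \<forall>a b. a < b \<and> b - a < \<rho> \<and> x \<in> {a..b} \<longrightarrow> \<bar>f b - f a - c * (b - a)\<bar> \<le> e * (b - a)"
  shows "(f has_real_derivative c) (at x)"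
  unfolding has_field_derivative_def has_derivative_at_alt
proof (intro conjI allI impI)
  show "bounded_linear ((*) c)" by (rule bounded_linear_mult_right)
  fix e :: real assume "e > 0"
  then obtain \<rho> where \<rho>: "\<rho> > 0" "\<forall>a b. a < b \<and> b - a < \<rho> \<and> x \<in> {a..b} \<longrightarrow> \<bar>f b - f a - c * (b - a)\<bar> \<le> e * (b - a)"
    using assms by blast
  show "\<exists>d>0. \<forall>y. norm (y - x) < d \<longrightarrow> norm (f y - f x - c * (y - x)) \<le> e * norm (y - x)"
  proof (intro exI[of _ \<rho>] conjI allI impI)
    fix y assume y: "norm (y - x) < \<rho>"
    show "norm (f y - f x - c * (y - x)) \<le> e * norm (y - x)"
    proof (cases "x = y")
      case False
      then consider "x < y" | "y < x" by linarith
      then show ?thesis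
      proof cases
        case 1 then show ?thesis using \<rho>(2)[rule_format, of x y] y by auto
      next
        case 2
        have "\<bar>f x - f y - c * (x - y)\<bar> = \<bar>f y - f x - c * (y - x)\<bar>" by (simp add: algebra_simps)
        then show ?thesis using \<rho>(2)[rule_format, of y x] y 2 by auto
      qed
    qed auto
  qed (use \<rho> in auto)
qed

text \<open>Off the countably many exceptional sets that belong to rational pairs of slopes, the density is the derivative.
The last conclusion is a mean value inequality in which a null set of points may be ignored; it is read
off from the integral representation and would be false for a function that is merely differentiable almost
everywhere.\<close>

lemma monotone_lipschitz_derivative:
  fixes F :: "real \<Rightarrow> real"
  assumes mono: "\<And>x y. x \<le> y \<Longrightarrow> F x \<le> F y" and L: "L > 0"
    and lip: "\<And>x y. x \<le> y \<Longrightarrow> F y - F x \<le> L * (y - x)"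
  obtains N h where "negligible N" "\<And>x. x \<notin> N \<Longrightarrow> (F has_real_derivative h x) (at x)"
    "\<And>a b c. a \<le> b \<Longrightarrow> 0 \<le> c \<Longrightarrow> (AE x in lborel. x \<in> {a..b} \<longrightarrow> h x \<le> c) \<Longrightarrow> F b - F a \<le> c * (b - a)"
proof -
  obtain h :: "real \<Rightarrow> ennreal" where h[measurable]: "h \<in> borel_measurable borel"
    and dom: "\<And>X. X \<in> sets borel \<Longrightarrow> (\<integral>\<^sup>+x\<in>X. h x \<partial>lborel) \<le> ennreal L * emeasure lborel X"
    and int: "\<And>a b. a \<le> b \<Longrightarrow> (\<integral>\<^sup>+x\<in>{a..b}. h x \<partial>lborel) = ennreal (F b - F a)"
    using mono_lipschitz_density[of F L, OF mono L lip] by blast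
  define Up where "Up \<gamma> \<beta> = {x. h x \<le> ennreal \<gamma> \<and> (\<forall>\<rho>>0. \<exists>a b. a < b \<and> b - a < \<rho> \<and> x \<in> {a..b} \<and> \<beta> * (b - a) \<le> F b - F a)}" for \<gamma> \<beta>
  define Lo where "Lo \<gamma> \<beta> = {x. h x \<ge> ennreal \<gamma> \<and> (\<forall>\<rho>>0. \<exists>a b. a < b \<and> b - a < \<rho> \<and> x \<in> {a..b} \<and> F b - F a \<le> \<beta> * (b - a))}" for \<gamma> \<beta>
  define Q where "Q = {(p, q). p \<in> \<rat> \<and> q \<in> \<rat> \<and> 0 \<le> p \<and> p < (q::real)}"
  define N where "N = (\<Union>(p, q)\<in>Q. Up p q \<union> Lo q p)"
  have "Q \<subseteq> \<rat> \<times> \<rat>" by (auto simp: Q_def)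
  then have "countable Q" by (rule countable_subset) (simp add: countable_rat)
  have "negligible N"
    unfolding N_def
  proof (rule negligible_countable_Union)
    show "countable ((\<lambda>(p, q). Up p q \<union> Lo q p) ` Q)" using \<open>countable Q\<close> by simp
    fix S assume "S \<in> (\<lambda>(p, q). Up p q \<union> Lo q p) ` Q"
    then obtain p q where "S = Up p q \<union> Lo q p" "0 \<le> p" "p < q" by (auto simp: Q_def)
    then show "negligible S"
      using negligible_slope_exceeds_density[of L h F p q, OF L h dom int]
        negligible_slope_below_density[of h F p q, OF h int] by (simp add: Up_def Lo_def negligible_Un)
  qed
  have fin: "h x \<noteq> top" if x: "x \<notin> N" for x
  proof
    assume top: "h x = top"
    obtain p where p: "p \<in> \<rat>" "L < p" "p < L + 1" using Rats_dense_in_real[of L "L + 1"] by auto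
    obtain q where q: "q \<in> \<rat>" "p < q" using Rats_dense_in_real[of p "p + 1"] by auto
    have "x \<notin> Lo q p" using x p q L by (auto simp: N_def Q_def)
    then obtain \<rho> where "\<rho> > 0" and \<rho>: "\<forall>a b. a < b \<and> b - a < \<rho> \<and> x \<in> {a..b} \<longrightarrow> p * (b - a) < F b - F a"
      using top unfolding Lo_def mem_Collect_eq by (metis not_le top_greatest)
    have "p * (\<rho>/2) < F (x + \<rho>/2) - F x" using \<rho>[rule_format, of x "x + \<rho>/2"] \<open>\<rho> > 0\<close> by simp
    moreover have "F (x + \<rho>/2) - F x \<le> L * (\<rho>/2)" using lip[of x "x + \<rho>/2"] \<open>\<rho> > 0\<close> by simp
    moreover have "L * (\<rho>/2) < p * (\<rho>/2)" using p \<open>\<rho> > 0\<close> by simp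
    ultimately show False by linarith
  qed
  have deriv: "(F has_real_derivative enn2real (h x)) (at x)" if x: "x \<notin> N" for x
  proof -
    have up: "\<exists>\<rho>>0. \<forall>a b. a < b \<and> b - a < \<rho> \<and> x \<in> {a..b} \<longrightarrow> F b - F a < q * (b - a)"
      if "p \<in> \<rat>" "q \<in> \<rat>" "0 \<le> p" "p < q" "h x \<le> ennreal p" for p q
    proof -
      have "x \<notin> Up p q" using x that by (auto simp: N_def Q_def)
      then show ?thesis using that unfolding Up_def mem_Collect_eq by (meson not_le)
    qed
    have lo: "\<exists>\<rho>>0. \<forall>a b. a < b \<and> b - a < \<rho> \<and> x \<in> {a..b} \<longrightarrow> p * (b - a) < F b - F a"
      if "p \<in> \<rat>" "q \<in> \<rat>" "0 \<le> p" "p < q" "h x \<ge> ennreal q" for p q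
    proof -
      have "x \<notin> Lo q p" using x that by (auto simp: N_def Q_def)
      then show ?thesis using that unfolding Lo_def mem_Collect_eq by (meson not_le)
    qed
    define c where "c = enn2real (h x)"
    have c: "h x = ennreal c" "c \<ge> 0" using fin[OF x] by (auto simp: c_def less_top)
    show ?thesis
      unfolding c_def[symmetric]
    proof (rule has_real_derivative_if_slopes)
      fix e :: real assume "e > 0"
      obtain p where p: "p \<in> \<rat>" "c < p" "p < c + e" using Rats_dense_in_real[of c "c + e"] \<open>e > 0\<close> by auto
      obtain q where q: "q \<in> \<rat>" "p < q" "q < c + e" using Rats_dense_in_real[of p "c + e"] p by auto
      obtain \<rho>1 where \<rho>1: "\<rho>1 > 0" "\<forall>a b. a < b \<and> b - a < \<rho>1 \<and> x \<in> {a..b} \<longrightarrow> F b - F a < q * (b - a)"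
        using up[of p q] p q c ennreal_leI[of c p] by force
      have "\<exists>\<rho>2>0. \<forall>a b. a < b \<and> b - a < \<rho>2 \<and> x \<in> {a..b} \<longrightarrow> (c - e) * (b - a) \<le> F b - F a"
      proof (cases "c = 0")
        case True
        have "(c - e) * (b - a) \<le> F b - F a" if "a < b" for a b
        proof -
          have "(c - e) * (b - a) \<le> 0" using True \<open>e > 0\<close> that by (simp add: mult_nonpos_nonneg)
          also have "0 \<le> F b - F a" using mono[of a b] that by simp
          finally show ?thesis .
        qed
        then show ?thesis by (intro exI[of _ 1]) auto
      next
        case False
        with c have "max 0 (c - e) < c" using \<open>e > 0\<close> by auto
        then obtain p where p: "p \<in> \<rat>" "max 0 (c - e) < p" "p < c" using Rats_dense_in_real by blast
        obtain q where q: "q \<in> \<rat>" "p < q" "q < c" using Rats_dense_in_real[of p c] p by auto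
        obtain \<rho>2 where \<rho>2: "\<rho>2 > 0" "\<forall>a b. a < b \<and> b - a < \<rho>2 \<and> x \<in> {a..b} \<longrightarrow> p * (b - a) < F b - F a"
          using lo[of p q] p q c by (auto intro: ennreal_leI)
        have "(c - e) * (b - a) \<le> F b - F a" if "a < b \<and> b - a < \<rho>2 \<and> x \<in> {a..b}" for a b
        proof -
          have "(c - e) * (b - a) \<le> p * (b - a)" using p that by (intro mult_right_mono) auto
          then show ?thesis using \<rho>2(2)[rule_format, OF that] by linarith
        qed
        with \<rho>2 show ?thesis by blast
      qed
      then obtain \<rho>2 where \<rho>2: "\<rho>2 > 0" "\<And>a b. a < b \<and> b - a < \<rho>2 \<and> x \<in> {a..b} \<Longrightarrow> (c - e) * (b - a) \<le> F b - F a" by blast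
      show "\<exists>\<rho>>0. \<forall>a b. a < b \<and> b - a < \<rho> \<and> x \<in> {a..b} \<longrightarrow> \<bar>F b - F a - c * (b - a)\<bar> \<le> e * (b - a)"
      proof (intro exI[of _ "min \<rho>1 \<rho>2"] conjI allI impI)
        fix a b assume ab: "a < b \<and> b - a < min \<rho>1 \<rho>2 \<and> x \<in> {a..b}"
        have "F b - F a < q * (b - a)" using \<rho>1(2)[rule_format, of a b] ab by auto
        also have "\<dots> \<le> (c + e) * (b - a)" using q ab by (intro mult_right_mono) auto
        finally have "F b - F a \<le> c * (b - a) + e * (b - a)" by (simp add: algebra_simps)
        moreover have "c * (b - a) - e * (b - a) \<le> F b - F a" using \<rho>2(2)[of a b] ab by (simp add: algebra_simps)
        ultimately show "\<bar>F b - F a - c * (b - a)\<bar> \<le> e * (b - a)" by linarith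
      qed (use \<rho>1 \<rho>2 in auto)
    qed
  qed
  have ae_fin: "AE x in lborel. h x \<noteq> top"
    by (rule eventually_mono[OF AE_not_in_negligible[OF \<open>negligible N\<close>] fin])
  show ?thesis
  proof (rule that[OF \<open>negligible N\<close> deriv])
    fix a b c :: real
    assume "a \<le> b" "0 \<le> c" and ae: "AE x in lborel. x \<in> {a..b} \<longrightarrow> enn2real (h x) \<le> c"
    have "ennreal (F b - F a) = (\<integral>\<^sup>+x\<in>{a..b}. h x \<partial>lborel)" using int[OF \<open>a \<le> b\<close>] by simp
    also have "\<dots> \<le> (\<integral>\<^sup>+x. ennreal c * indicator {a..b} x \<partial>lborel)"
    proof (rule nn_integral_mono_AE, use ae ae_fin in eventually_elim)
      case (elim x)
      then show ?case
        by (cases "h x") (auto simp: indicator_def intro!: ennreal_leI)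
    qed
    also have "\<dots> = ennreal (c * (b - a))"
      using \<open>a \<le> b\<close> \<open>0 \<le> c\<close> by (subst nn_integral_cmult_indicator) (auto simp: ennreal_mult)
    finally show "F b - F a \<le> c * (b - a)" using \<open>a \<le> b\<close> \<open>0 \<le> c\<close> by (simp add: ennreal_le_iff)
  qed
qed

lemma lipschitz_real_derivative:
  fixes f :: "real \<Rightarrow> real"
  assumes "L-lipschitz_on UNIV f"
  obtains N h where "negligible N" "\<And>x. x \<notin> N \<Longrightarrow> (f has_real_derivative h x) (at x)"
    "\<And>a b c. a \<le> b \<Longrightarrow> (AE x in lborel. x \<in> {a..b} \<longrightarrow> h x \<le> c) \<Longrightarrow> f b - f a \<le> c * (b - a)"
proof -
  define M where "M = L + 1"
  have "L \<ge> 0" using assms by (rule lipschitz_on_nonneg)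
  have f: "\<bar>f y - f x\<bar> \<le> M * (y - x)" if "x \<le> y" for x y
  proof -
    have "\<bar>f y - f x\<bar> \<le> L * (y - x)"
      using lipschitz_onD[OF assms, of y x] that by (simp add: dist_real_def)
    also have "\<dots> \<le> M * (y - x)" using that by (intro mult_right_mono) (auto simp: M_def)
    finally show ?thesis .
  qed
  define F where "F x = f x + M * x" for x
  obtain N h where N: "negligible N" and D: "\<And>x. x \<notin> N \<Longrightarrow> (F has_real_derivative h x) (at x)"
    and I: "\<And>a b c. a \<le> b \<Longrightarrow> 0 \<le> c \<Longrightarrow> (AE x in lborel. x \<in> {a..b} \<longrightarrow> h x \<le> c) \<Longrightarrow> F b - F a \<le> c * (b - a)"
  proof (rule monotone_lipschitz_derivative[of F "2 * M"])
    show "F x \<le> F y" "F y - F x \<le> 2 * M * (y - x)" if "x \<le> y" for x y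
      using f[OF that] by (auto simp: F_def algebra_simps abs_le_iff)
    show "0 < 2 * M" using \<open>L \<ge> 0\<close> by (simp add: M_def)
  qed blast
  have aeN: "AE x in lborel. x \<notin> N"
    using N by (rule AE_not_in_negligible)
  show ?thesis
  proof (rule that[OF N, of "\<lambda>x. h x - M"])
    fix x assume "x \<notin> N"
    have "((\<lambda>x. F x - M * x) has_real_derivative h x - M) (at x)"
      by (auto intro!: derivative_eq_intros D[OF \<open>x \<notin> N\<close>])
    then show "(f has_real_derivative h x - M) (at x)" by (simp add: F_def)
  next
    fix a b c :: real assume ab: "a \<le> b" and ae: "AE x in lborel. x \<in> {a..b} \<longrightarrow> h x - M \<le> c"
    \<comment> \<open>\<open>F\<close> is nondecreasing, so its derivative \<open>h x\<close> is nonnegative; hence \<open>c + M\<close> is, unless the interval is trivial.\<close>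
    have hM: "h x \<ge> 0" if xN: "x \<notin> N" for x
    proof (rule ccontr)
      assume "\<not> h x \<ge> 0"
      then obtain d where "d > 0" "\<And>y. 0 < y \<Longrightarrow> y < d \<Longrightarrow> F (x + y) < F x"
        using DERIV_neg_dec_right[OF D[OF xN]] by auto
      from this(2)[of "d/2"] \<open>d > 0\<close> have "f (x + d/2) + M * (d/2) < f x"
        by (simp add: F_def algebra_simps)
      moreover have "\<bar>f (x + d/2) - f x\<bar> \<le> M * (d/2)"
        using f[of x "x + d/2"] \<open>d > 0\<close> by simp
      ultimately show False by linarith
    qed
    show "f b - f a \<le> c * (b - a)"
    proof (cases "a = b")
      case False
      with ab have "a < b" by simp
      have "c + M \<ge> 0"
      proof (rule ccontr)
        assume "\<not> c + M \<ge> 0"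
        have "AE x in lborel. x \<notin> {a..b}"
          using ae aeN by eventually_elim (use hM \<open>\<not> c + M \<ge> 0\<close> in force)
        then have "emeasure lborel {a..b} = 0"
          by (subst (asm) AE_iff_measurable[of "{a..b}"]) auto
        then show False using \<open>a < b\<close> by simp
      qed
      have "F b - F a \<le> (c + M) * (b - a)"
        by (rule I[OF ab \<open>c + M \<ge> 0\<close>]) (use ae in \<open>auto elim!: eventually_mono\<close>)
      then show ?thesis by (simp add: F_def algebra_simps)
    qed auto
  qed
qed

section \<open>The theorem of Rademacher\<close>

lemma translated_line_measurable:
  fixes S :: "'a::euclidean_space set"
  assumes "S \<in> sets borel"
  shows "{p \<in> space (lborel \<Otimes>\<^sub>M lborel). snd p + fst p *\<^sub>R v \<notin> S} \<in> sets (lborel \<Otimes>\<^sub>M lborel)"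
proof -
  have "(\<lambda>p. snd p + fst p *\<^sub>R v) \<in> borel_measurable (lborel \<Otimes>\<^sub>M (lborel::'a measure))"
    by measurable
  from measurable_sets[OF this, of "- S"] assms show ?thesis
    by (simp add: vimage_def Collect_conj_eq Int_commute)
qed

lemma AE_lborel_translation:
  fixes S :: "'a::euclidean_space set"
  assumes "AE x in lborel. x + c \<notin> S" "S \<in> sets borel"
  shows "AE x in lborel. x \<notin> S"
proof -
  have "{x. x + c \<in> S} \<in> sets borel"
    using measurable_sets[of "\<lambda>x. x + c" borel borel S] assms(2) by (simp add: vimage_def)
  then have "{x. x + c \<in> S} \<in> null_sets lborel"
    using AE_iff_null_sets[of "{x. x + c \<in> S}" lborel] assms(1) by simp
  from null_sets_translation[OF this, of c] show ?thesis
    by (auto intro!: AE_not_in[of S])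
qed

text \<open>Fubini without a change of coordinates: consider the set of all \<open>(t, x)\<close> with \<open>x + t *\<^sub>R v \<in> S\<close>. Its sections at fixed
\<open>x\<close> are null by hypothesis, so almost all of its sections at fixed \<open>t\<close> are null, and these are translates of \<open>S\<close>.\<close>

lemma null_set_if_null_on_lines:
  fixes S :: "'a::euclidean_space set"
  assumes S: "S \<in> sets borel" and null: "\<And>x. AE t in lborel. x + t *\<^sub>R v \<notin> S"
  shows "AE x in lborel. x \<notin> S"
proof -
  have "AE t in lborel. AE x in lborel. x + t *\<^sub>R v \<notin> S"
    by (subst lborel_pair.AE_commute[OF translated_line_measurable[OF S]]) (simp add: null)
  moreover have "ae_filter (lborel::real measure) \<noteq> bot"
    by (simp add: ae_filter_eq_bot_iff)
  ultimately obtain t where "AE x in lborel. x + t *\<^sub>R v \<notin> S"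
    using eventually_happens by blast
  then show ?thesis using S by (rule AE_lborel_translation)
qed

text \<open>The same product set, read in the opposite direction.\<close>

lemma null_on_lines_if_null_set:
  fixes S :: "'a::euclidean_space set"
  assumes S: "negligible S"
  shows "AE x in lborel. AE t in lborel. x + t *\<^sub>R v \<notin> S"
proof -
  obtain T where T: "T \<in> null_sets lborel" "S \<subseteq> T"
    using S by (auto simp: negligible_iff_null_sets null_sets_completion_iff2)
  have Tb: "T \<in> sets borel" using T(1) by auto
  have "AE x in lborel. x + t *\<^sub>R v \<notin> T" for t
    using AE_not_in[OF null_sets_translation[OF T(1), of "- (t *\<^sub>R v)"]] by simp
  then have "AE t in lborel. AE x in lborel. x + t *\<^sub>R v \<notin> T" by simp
  then have "AE x in lborel. AE t in lborel. x + t *\<^sub>R v \<notin> T"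
    by (subst (asm) lborel_pair.AE_commute[OF translated_line_measurable[OF Tb]])
  then show ?thesis using T(2) by (auto elim!: eventually_mono)
qed

text \<open>The points at which the difference quotient of \<open>g\<close> along \<open>v\<close> stays within \<open>\<eta>\<close> of \<open>a\<close> up to the scale \<open>1 / (m + 1)\<close>.
For continuous \<open>g\<close>, fixing the scale makes these sets closed, so the points of directional differentiability are
controlled by countably many closed sets and no measurability question arises.\<close>

definition slope_set :: "('a::euclidean_space \<Rightarrow> real) \<Rightarrow> 'a \<Rightarrow> real \<Rightarrow> nat \<Rightarrow> real \<Rightarrow> 'a set" where
  "slope_set g v \<eta> m a = {x. \<forall>t. \<bar>t\<bar> < 1 / real (Suc m) \<longrightarrow> \<bar>g (x + t *\<^sub>R v) - g x - t * a\<bar> \<le> \<eta> * \<bar>t\<bar>}"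

lemma closed_slope_set:
  assumes "continuous_on UNIV g"
  shows "closed (slope_set g v \<eta> m a)"
  unfolding slope_set_def
  by (intro closed_Collect_all closed_Collect_imp closed_Collect_le open_Collect_const continuous_intros
      continuous_on_compose2[OF assms]) auto

text \<open>On every line in direction \<open>v\<close> the function is Lipschitz in one real variable, hence differentiable almost everywhere.\<close>

lemma slope_set_covers:
  fixes g :: "'a::euclidean_space \<Rightarrow> real"
  assumes g: "L-lipschitz_on UNIV g" and "\<eta> > 0"
  shows "negligible (- (\<Union>m. \<Union>a\<in>\<rat>. slope_set g v \<eta> m a))"
proof -
  define S where "S = - (\<Union>m. \<Union>a\<in>\<rat>. slope_set g v \<eta> m a)"
  have cont: "continuous_on UNIV g" using g by (rule lipschitz_on_continuous_on)
  have Sb: "S \<in> sets borel"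
    unfolding S_def by (rule borel_comp, rule sets.countable_UN''[OF countableI_type], rule sets.countable_UN''[OF countable_rat])
      (rule borel_closed[OF closed_slope_set[OF cont]])
  have lines: "AE t in lborel. x + t *\<^sub>R v \<notin> S" for x
  proof -
    have "(L * norm v)-lipschitz_on UNIV (\<lambda>t. g (x + t *\<^sub>R v))"
    proof (rule lipschitz_onI)
      show "0 \<le> L * norm v" using lipschitz_on_nonneg[OF g] by simp
      fix s t :: real
      have "dist (g (x + s *\<^sub>R v)) (g (x + t *\<^sub>R v)) \<le> L * dist (x + s *\<^sub>R v) (x + t *\<^sub>R v)"
        by (rule lipschitz_onD[OF g]) auto
      also have "dist (x + s *\<^sub>R v) (x + t *\<^sub>R v) = norm v * dist s t"
        by (simp add: dist_norm scaleR_diff_left[symmetric] mult.commute)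
      finally show "dist (g (x + s *\<^sub>R v)) (g (x + t *\<^sub>R v)) \<le> L * norm v * dist s t" by (simp add: mult.assoc)
    qed
    then obtain N h where N: "negligible N"
      and D: "\<And>t. t \<notin> N \<Longrightarrow> ((\<lambda>t. g (x + t *\<^sub>R v)) has_real_derivative h t) (at t)"
      by (rule lipschitz_real_derivative) (rule that)
    have off: "x + t *\<^sub>R v \<notin> S" if "t \<notin> N" for t
    proof -
      have "\<eta>/2 > 0" using \<open>\<eta> > 0\<close> by simp
      with D[OF that] obtain \<delta> where \<delta>: "\<delta> > 0" "\<And>s. \<bar>s - t\<bar> < \<delta> \<Longrightarrow>
          \<bar>g (x + s *\<^sub>R v) - g (x + t *\<^sub>R v) - h t * (s - t)\<bar> \<le> \<eta>/2 * \<bar>s - t\<bar>"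
        unfolding has_field_derivative_def has_derivative_at_alt real_norm_def by blast
      obtain m where m: "inverse (real (Suc m)) < \<delta>" using \<delta>(1) reals_Archimedean by blast
      obtain a where a: "a \<in> \<rat>" "h t < a" "a < h t + \<eta>/2"
        using Rats_dense_in_real[of "h t" "h t + \<eta>/2"] \<open>\<eta> > 0\<close> by auto
      have "x + t *\<^sub>R v \<in> slope_set g v \<eta> m a"
        unfolding slope_set_def
      proof (intro CollectI allI impI)
        fix s :: real assume s: "\<bar>s\<bar> < 1 / real (Suc m)"
        have e: "x + t *\<^sub>R v + s *\<^sub>R v = x + (t + s) *\<^sub>R v" by (simp add: algebra_simps)
        have 1: "\<bar>g (x + (t + s) *\<^sub>R v) - g (x + t *\<^sub>R v) - h t * s\<bar> \<le> \<eta>/2 * \<bar>s\<bar>"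
          using \<delta>(2)[of "t + s"] s m by (simp add: inverse_eq_divide)
        have "\<bar>h t * s - s * a\<bar> = \<bar>h t - a\<bar> * \<bar>s\<bar>" by (simp add: abs_mult[symmetric] algebra_simps)
        also have "\<dots> \<le> \<eta>/2 * \<bar>s\<bar>" using a by (intro mult_right_mono) auto
        finally show "\<bar>g (x + t *\<^sub>R v + s *\<^sub>R v) - g (x + t *\<^sub>R v) - s * a\<bar> \<le> \<eta> * \<bar>s\<bar>"
          using 1 unfolding e by linarith
      qed
      then show ?thesis using a(1) unfolding S_def by blast
    qed
    show ?thesis by (rule eventually_mono[OF AE_not_in_negligible[OF N] off])
  qed
  have "S \<in> null_sets lborel"
    using null_set_if_null_on_lines[OF Sb lines] Sb by (simp add: AE_iff_null_sets)
  then show ?thesis unfolding S_def[symmetric] by (simp add: negligible_iff_null_sets null_sets_completionI)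
qed

text \<open>A point \<open>x\<close> of a closed set \<open>A\<close> is porous if \<open>A\<close> misses balls that are arbitrarily close to \<open>x\<close> and have a radius
proportional to their distance from \<open>x\<close>. Such holes occupy a fixed share of the surrounding balls.\<close>

lemma negligible_porous_points:
  fixes A :: "'a::euclidean_space set"
  assumes "closed A" "0 < \<eta>" "\<eta> \<le> 1"
  shows "negligible {x \<in> A. \<forall>\<rho>>0. \<exists>p. 0 < dist p x \<and> dist p x < \<rho> \<and> ball p (\<eta> * dist p x) \<inter> A = {}}"
proof (rule negligible_if_complement_thick[where A=A and k="(\<eta>/2) ^ DIM('a)"])
  show "A \<in> sets borel" using assms by auto
  show "0 < (\<eta>/2) ^ DIM('a)" using assms by auto
  fix x \<rho> assume "x \<in> {x \<in> A. \<forall>\<rho>>0. \<exists>p. 0 < dist p x \<and> dist p x < \<rho> \<and> ball p (\<eta> * dist p x) \<inter> A = {}}" "(0::real) < \<rho>"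
  moreover have "\<rho>/2 > 0" using \<open>0 < \<rho>\<close> by simp
  ultimately obtain p where p: "0 < dist p x" "dist p x < \<rho>/2" "ball p (\<eta> * dist p x) \<inter> A = {}" by blast
  define d where "d = dist p x"
  have d: "0 < d" "2 * d < \<rho>" "ball p (\<eta> * d) \<inter> A = {}" using p by (auto simp: d_def)
  have sub: "ball p (\<eta> * d) \<subseteq> cball x (2 * d) - A"
  proof
    fix y assume y: "y \<in> ball p (\<eta> * d)"
    have "dist p y < \<eta> * d" using y by simp
    also have "\<dots> \<le> d" using d assms by (simp add: mult_left_le_one_le)
    finally have "dist x y \<le> 2 * d" using dist_triangle[of x y p] by (simp add: d_def dist_commute)
    then show "y \<in> cball x (2 * d) - A" using d y by auto
  qed
  have "ennreal ((\<eta>/2) ^ DIM('a)) * emeasure lborel (cball x (2 * d)) = emeasure lborel (ball p (\<eta> * d))"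
    using d assms by (simp add: emeasure_cball emeasure_ball ennreal_mult[symmetric] power_mult_distrib power_divide)
  also have "\<dots> \<le> emeasure lborel (cball x (2 * d) - A)"
    using sub assms by (intro emeasure_mono) auto
  finally show "\<exists>a r. 0 < r \<and> r < \<rho> \<and> x \<in> cball a r \<and>
      ennreal ((\<eta>/2) ^ DIM('a)) * emeasure lborel (cball a r) \<le> emeasure lborel (cball a r - A)"
    using d by (intro exI[of _ x] exI[of _ "2 * d"]) auto
qed auto

text \<open>The gradients \<open>d\<close> that work for the tolerances \<open>1 / (j + 1)\<close> differ by at most the sum of their tolerances, so they
converge, and their limit is the gradient.\<close>

lemma differentiable_if_approximable:
  fixes g :: "'a::euclidean_space \<Rightarrow> real"
  assumes approx: "\<And>e. e > 0 \<Longrightarrow> \<exists>d \<rho>. \<rho> > 0 \<and> (\<forall>h. norm h < \<rho> \<longrightarrow> \<bar>g (x + h) - g x - d \<bullet> h\<bar> \<le> e * norm h)"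
  shows "g differentiable (at x)"
proof -
  have "\<forall>j. \<exists>d \<rho>. \<rho> > 0 \<and> (\<forall>h. norm h < \<rho> \<longrightarrow> \<bar>g (x + h) - g x - d \<bullet> h\<bar> \<le> inverse (real (Suc j)) * norm h)"
    using approx by simp
  then obtain d \<rho> where \<rho>: "\<And>j. \<rho> j > (0::real)"
    and d: "\<And>j h. norm h < \<rho> j \<Longrightarrow> \<bar>g (x + h) - g x - d j \<bullet> h\<bar> \<le> inverse (real (Suc j)) * norm h"
    by metis
  have close: "norm (d i - d j) \<le> inverse (real (Suc i)) + inverse (real (Suc j))" for i j
  proof (cases "d i = d j")
    case False
    define s where "s = min (\<rho> i) (\<rho> j) / (2 * norm (d i - d j))"
    define h where "h = s *\<^sub>R (d i - d j)"
    have n: "norm (d i - d j) > 0" using False by simp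
    have "s > 0" using \<rho> n by (simp add: s_def)
    have "norm h = min (\<rho> i) (\<rho> j) / 2"
      using n \<rho>[of i] \<rho>[of j] by (simp add: h_def s_def abs_of_pos)
    then have "norm h < \<rho> i" "norm h < \<rho> j" using \<rho>[of i] \<rho>[of j] by auto
    have "(d i - d j) \<bullet> h = s * norm (d i - d j) ^ 2" by (simp add: h_def dot_square_norm)
    also have "\<dots> = norm (d i - d j) * norm h" using \<open>s > 0\<close> by (simp add: h_def power2_eq_square)
    finally have "norm (d i - d j) * norm h = d i \<bullet> h - d j \<bullet> h" by (simp add: inner_diff_left)
    also have "\<dots> \<le> inverse (real (Suc i)) * norm h + inverse (real (Suc j)) * norm h"
      using d[OF \<open>norm h < \<rho> i\<close>] d[OF \<open>norm h < \<rho> j\<close>] by linarith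
    finally have "norm (d i - d j) * norm h \<le> (inverse (real (Suc i)) + inverse (real (Suc j))) * norm h"
      by (simp add: algebra_simps)
    moreover have "norm h > 0" using n \<open>s > 0\<close> by (simp add: h_def)
    ultimately show ?thesis by (rule mult_right_le_imp_le)
  qed simp
  have "Cauchy d"
    unfolding Cauchy_altdef2
  proof (intro allI impI)
    fix e :: real assume "e > 0"
    then obtain j where j: "inverse (real (Suc j)) < e/2" using reals_Archimedean half_gt_zero by blast
    show "\<exists>N. \<forall>n\<ge>N. dist (d n) (d N) < e"
    proof (intro exI[of _ j] allI impI)
      fix n assume "n \<ge> j"
      then have "inverse (real (Suc n)) \<le> inverse (real (Suc j))" by (simp add: le_imp_inverse_le)
      then show "dist (d n) (d j) < e" using close[of n j] j unfolding dist_norm by linarith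
    qed
  qed
  then obtain a where a: "d \<longlonglongrightarrow> a" using Cauchy_convergent convergent_def by blast
  have ad: "norm (a - d j) \<le> 2 * inverse (real (Suc j))" for j
  proof (rule Lim_norm_ubound[OF sequentially_bot])
    show "(\<lambda>i. d i - d j) \<longlonglongrightarrow> a - d j" by (intro tendsto_intros a)
    show "\<forall>\<^sub>F i in sequentially. norm (d i - d j) \<le> 2 * inverse (real (Suc j))"
      using eventually_ge_at_top[of j]
    proof eventually_elim
      case (elim i)
      then have "inverse (real (Suc i)) \<le> inverse (real (Suc j))" by (simp add: le_imp_inverse_le)
      then show ?case using close[of i j] by linarith
    qed
  qed
  have "(g has_derivative (\<lambda>h. a \<bullet> h)) (at x)"
    unfolding has_derivative_at_alt
  proof (intro conjI allI impI)
    show "bounded_linear ((\<bullet>) a)" by (rule bounded_linear_inner_right)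
    fix e :: real assume "e > 0"
    then obtain j where j: "inverse (real (Suc j)) < e/3" using reals_Archimedean[of "e/3"] by auto
    show "\<exists>\<delta>>0. \<forall>y. norm (y - x) < \<delta> \<longrightarrow> norm (g y - g x - a \<bullet> (y - x)) \<le> e * norm (y - x)"
    proof (intro exI[of _ "\<rho> j"] conjI allI impI \<rho>)
      fix y assume y: "norm (y - x) < \<rho> j"
      have "\<bar>d j \<bullet> (y - x) - a \<bullet> (y - x)\<bar> \<le> norm (a - d j) * norm (y - x)"
        using Cauchy_Schwarz_ineq2[of "a - d j" "y - x"] by (simp add: inner_diff_left abs_minus_commute)
      also have "\<dots> \<le> 2 * inverse (real (Suc j)) * norm (y - x)" by (intro mult_right_mono ad) auto
      finally have "norm (g y - g x - a \<bullet> (y - x)) \<le> 3 * inverse (real (Suc j)) * norm (y - x)"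
        using d[OF y] by (simp add: algebra_simps del: of_nat_Suc)
      also have "\<dots> \<le> e * norm (y - x)" using j by (intro mult_right_mono) auto
      finally show "norm (g y - g x - a \<bullet> (y - x)) \<le> e * norm (y - x)" .
    qed
  qed
  then show ?thesis by (auto simp: differentiable_def)
qed

text \<open>Linearity of the derivative comes from porosity. Let \<open>x\<close> be a nonporous point of a set \<open>A\<close> on which all partial
difference quotients are controlled on one common scale. Move from \<open>x\<close> to \<open>x + h\<close> one coordinate at a time. The
corners of this path need not belong to \<open>A\<close>, but \<open>A\<close> has points at distance \<open>o(norm h)\<close> from them, and replacing the corners
by these points costs only a small error because \<open>g\<close> is Lipschitz.\<close>

lemma negligible_nondifferentiable_real:
  fixes g :: "'a::euclidean_space \<Rightarrow> real"
  assumes g: "L-lipschitz_on UNIV g"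
  shows "negligible {x. \<not> g differentiable (at x)}"
proof -
  have cont: "continuous_on UNIV g" using g by (rule lipschitz_on_continuous_on)
  have L: "L \<ge> 0" using g by (rule lipschitz_on_nonneg)
  have Lg: "\<bar>g y - g z\<bar> \<le> L * dist y z" for y z
    using lipschitz_onD[OF g, of y z] by (simp add: dist_real_def)
  obtain D :: "'a set" where D: "countable D" "\<And>X. open X \<Longrightarrow> X \<noteq> {} \<Longrightarrow> \<exists>d\<in>D. d \<in> X"
    using countable_dense_exists by blast
  define \<eta> where "\<eta> k = inverse (real (Suc k))" for k
  have \<eta>: "0 < \<eta> k" "\<eta> k \<le> 1" for k by (auto simp: \<eta>_def inverse_le_1_iff)
  define N1 where "N1 = (\<Union>k. \<Union>b\<in>Basis. - (\<Union>m. \<Union>a\<in>\<rat>. slope_set g b (\<eta> k) m a))"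
  define A where "A k m d = (\<Inter>b\<in>Basis. slope_set g b (2 * \<eta> k) m (d \<bullet> b))" for k m and d :: 'a
  define P where "P k m d = {x \<in> A k m d. \<forall>\<rho>>0. \<exists>p. 0 < dist p x \<and> dist p x < \<rho> \<and> ball p (\<eta> k * dist p x) \<inter> A k m d = {}}" for k m d
  define N2 where "N2 = (\<Union>k. \<Union>m. \<Union>d\<in>D. P k m d)"
  have "negligible N1"
    unfolding N1_def
  proof (intro negligible_Union_nat negligible_Union)
    fix k S assume "S \<in> (\<lambda>b. - (\<Union>m. \<Union>a\<in>\<rat>. slope_set g b (\<eta> k) m a)) ` Basis"
    then obtain b where S: "S = - (\<Union>m. \<Union>a\<in>\<rat>. slope_set g b (\<eta> k) m a)" by blast
    show "negligible S" unfolding S by (rule slope_set_covers[OF g \<eta>(1)])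
  qed auto
  moreover have "negligible N2"
    unfolding N2_def
  proof (intro negligible_Union_nat negligible_countable_Union)
    fix k m S assume "S \<in> P k m ` D"
    then obtain d where "S = P k m d" by auto
    moreover have "closed (A k m d)" unfolding A_def by (intro closed_INT ballI closed_slope_set cont)
    ultimately show "negligible S" using negligible_porous_points[of "A k m d" "\<eta> k"] \<eta> by (simp add: P_def)
  qed (use D in auto)
  moreover have "{x. \<not> g differentiable (at x)} \<subseteq> N1 \<union> N2"
  proof (rule subsetI, rule ccontr)
    fix x assume "x \<in> {x. \<not> g differentiable (at x)}" and notin: "x \<notin> N1 \<union> N2"
    define n where "n = real DIM('a)"
    have n: "n \<ge> 1" by (simp add: n_def Suc_leI)
    have "g differentiable (at x)"
    proof (rule differentiable_if_approximable)
      fix e :: real assume "e > 0"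
      then have "e / (n * (2 + 2 * L * n)) > 0" using n L by (auto intro!: divide_pos_pos mult_pos_pos add_pos_nonneg)
      then obtain k where k: "\<eta> k < e / (n * (2 + 2 * L * n))" unfolding \<eta>_def using reals_Archimedean by blast
      have "\<forall>b\<in>Basis. \<exists>m. \<exists>a. x \<in> slope_set g b (\<eta> k) m a"
        using notin unfolding N1_def by blast
      then obtain mb ab where mb: "\<And>b. b \<in> Basis \<Longrightarrow> x \<in> slope_set g b (\<eta> k) (mb b) (ab b)" by metis
      define m where "m = Max (mb ` Basis)"
      have m: "mb b \<le> m" if "b \<in> Basis" for b using that by (auto simp: m_def)
      define a where "a = (\<Sum>b\<in>Basis. ab b *\<^sub>R b)"
      \<comment> \<open>Countably many sets must suffice, so the vector \<open>a\<close> of slopes is replaced by a member of \<open>D\<close>; this doubles the tolerance.\<close>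
      obtain d where d: "d \<in> D" "dist a d < \<eta> k" using D(2)[of "ball a (\<eta> k)"] \<eta>[of k] by auto
      have "x \<in> slope_set g b (2 * \<eta> k) m (d \<bullet> b)" if b: "b \<in> Basis" for b
        unfolding slope_set_def
      proof (intro CollectI allI impI)
        fix t :: real assume t: "\<bar>t\<bar> < 1 / real (Suc m)"
        also have "\<dots> \<le> 1 / real (Suc (mb b))" using m[OF b] by (simp add: field_simps)
        finally have 1: "\<bar>g (x + t *\<^sub>R b) - g x - t * ab b\<bar> \<le> \<eta> k * \<bar>t\<bar>"
          using mb[OF b] by (simp add: slope_set_def)
        have "ab b = a \<bullet> b" using b by (simp add: a_def)
        then have "\<bar>ab b - d \<bullet> b\<bar> \<le> norm (a - d)"
          using Basis_le_norm[OF b, of "a - d"] by (simp add: inner_diff_left)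
        also have "\<dots> \<le> \<eta> k" using d by (simp add: dist_norm)
        finally have "\<bar>t\<bar> * \<bar>ab b - d \<bullet> b\<bar> \<le> \<bar>t\<bar> * \<eta> k" by (intro mult_left_mono) auto
        then have "\<bar>t * ab b - t * (d \<bullet> b)\<bar> \<le> \<eta> k * \<bar>t\<bar>" by (simp add: abs_mult[symmetric] algebra_simps)
        with 1 show "\<bar>g (x + t *\<^sub>R b) - g x - t * (d \<bullet> b)\<bar> \<le> 2 * \<eta> k * \<bar>t\<bar>" by linarith
      qed
      then have xA: "x \<in> A k m d" by (auto simp: A_def)
      have "x \<notin> P k m d" using notin d by (auto simp: N2_def)
      then obtain \<rho> where \<rho>: "\<rho> > 0" "\<And>p. 0 < dist p x \<Longrightarrow> dist p x < \<rho> \<Longrightarrow> ball p (\<eta> k * dist p x) \<inter> A k m d \<noteq> {}"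
        using xA unfolding P_def by blast
      have near: "\<exists>y\<in>A k m d. dist p y \<le> \<eta> k * dist p x" if "dist p x < \<rho>" for p
      proof (cases "p = x")
        case False
        then obtain y where "y \<in> ball p (\<eta> k * dist p x)" "y \<in> A k m d" using \<rho>(2)[of p] \<open>dist p x < \<rho>\<close> by auto
        then show ?thesis by (intro bexI[of _ y]) auto
      qed (use xA in auto)
      define \<rho>' where "\<rho>' = min (\<rho> / n) (1 / real (Suc m))"
      have "\<bar>g (x + h) - g x - d \<bullet> h\<bar> \<le> e * norm h" if h: "norm h < \<rho>'" for h
      proof -
        have part: "\<bar>g (x + (\<Sum>b\<in>S. (h \<bullet> b) *\<^sub>R b)) - g x - (\<Sum>b\<in>S. (h \<bullet> b) * (d \<bullet> b))\<bar>
            \<le> real (card S) * ((2 + 2 * L * n) * \<eta> k * norm h)" if "S \<subseteq> Basis" for S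
          using finite_subset[OF that finite_Basis] that
        proof (induction S rule: finite_induct)
          case (insert b S)
          then have b: "b \<in> Basis" by auto
          define q where "q = x + (\<Sum>b\<in>S. (h \<bullet> b) *\<^sub>R b)"
          define t where "t = h \<bullet> b"
          have t: "\<bar>t\<bar> \<le> norm h" using Basis_le_norm[OF b] by (simp add: t_def)
          have "norm (\<Sum>b\<in>S. (h \<bullet> b) *\<^sub>R b) \<le> (\<Sum>b\<in>S. norm h)"
            using insert by (intro sum_norm_le) (auto intro!: Basis_le_norm)
          also have "\<dots> \<le> n * norm h"
            using insert by (auto simp: n_def intro!: mult_right_mono card_mono)
          finally have qx: "dist q x \<le> n * norm h" by (simp add: q_def dist_norm)
          also have "n * norm h < \<rho>" using h n by (simp add: \<rho>'_def field_simps)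
          finally obtain y where y: "y \<in> A k m d" "dist q y \<le> \<eta> k * dist q x" using near by blast
          have qy: "L * dist q y \<le> L * (\<eta> k * (n * norm h))"
            using y(2) qx \<eta>[of k] L by (meson less_imp_le mult_left_mono order_trans)
          have "y \<in> slope_set g b (2 * \<eta> k) m (d \<bullet> b)" using y(1) b by (auto simp: A_def)
          then have 1: "\<bar>g (y + t *\<^sub>R b) - g y - t * (d \<bullet> b)\<bar> \<le> 2 * \<eta> k * \<bar>t\<bar>"
            using t h by (simp add: slope_set_def \<rho>'_def)
          have 2: "2 * \<eta> k * \<bar>t\<bar> \<le> 2 * \<eta> k * norm h" using t \<eta>[of k] by (intro mult_left_mono) auto
          have 3: "\<bar>g (q + t *\<^sub>R b) - g (y + t *\<^sub>R b)\<bar> \<le> L * dist q y" "\<bar>g q - g y\<bar> \<le> L * dist q y"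
            using Lg[of "q + t *\<^sub>R b" "y + t *\<^sub>R b"] Lg[of q y] by simp_all
          have 4: "\<bar>g (q + t *\<^sub>R b) - g q - t * (d \<bullet> b)\<bar> \<le> (2 + 2 * L * n) * \<eta> k * norm h"
            using 1 2 3 qy by (simp add: algebra_simps)
          have eq: "x + (\<Sum>b\<in>insert b S. (h \<bullet> b) *\<^sub>R b) = q + t *\<^sub>R b"
            "(\<Sum>b\<in>insert b S. (h \<bullet> b) * (d \<bullet> b)) = (\<Sum>b\<in>S. (h \<bullet> b) * (d \<bullet> b)) + t * (d \<bullet> b)"
            using insert by (simp_all add: q_def t_def)
          have IH: "\<bar>g q - g x - (\<Sum>b\<in>S. (h \<bullet> b) * (d \<bullet> b))\<bar> \<le> real (card S) * ((2 + 2 * L * n) * \<eta> k * norm h)"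
            using insert by (simp add: q_def)
          have card: "real (card (insert b S)) * c = real (card S) * c + c" for c
            using insert by (simp add: algebra_simps)
          show ?case unfolding eq card using 4 IH by linarith
        qed simp
        have "\<bar>g (x + h) - g x - d \<bullet> h\<bar> \<le> n * ((2 + 2 * L * n) * \<eta> k * norm h)"
          using part[of Basis] by (simp add: euclidean_representation euclidean_inner[of d h] n_def mult.commute)
        also have "\<dots> = (n * (2 + 2 * L * n) * \<eta> k) * norm h" by (simp add: algebra_simps)
        also have "\<dots> \<le> e * norm h"
          using k n L by (intro mult_right_mono) (auto simp: pos_less_divide_eq mult.commute add_pos_nonneg intro!: less_imp_le)
        finally show ?thesis .
      qed
      moreover have "\<rho>' > 0" using \<rho> n by (simp add: \<rho>'_def)
      ultimately show "\<exists>d \<rho>. \<rho> > 0 \<and> (\<forall>h. norm h < \<rho> \<longrightarrow> \<bar>g (x + h) - g x - d \<bullet> h\<bar> \<le> e * norm h)" by blast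
    qed
    then show False using \<open>x \<in> {x. \<not> g differentiable (at x)}\<close> by simp
  qed
  ultimately show ?thesis by (meson negligible_Un negligible_subset)
qed

theorem Rademacher:
  fixes g :: "'a::euclidean_space \<Rightarrow> 'b::euclidean_space"
  assumes g: "L-lipschitz_on UNIV g"
  shows "negligible {x. \<not> g differentiable (at x)}"
proof -
  have "{x. \<not> g differentiable (at x)} = (\<Union>b\<in>Basis. {x. \<not> (\<lambda>y. g y \<bullet> b) differentiable (at x)})"
    using differentiable_componentwise_within[of g _ UNIV] by auto
  moreover have "negligible {x. \<not> (\<lambda>y. g y \<bullet> b) differentiable (at x)}" if b: "b \<in> Basis" for b
  proof (rule negligible_nondifferentiable_real[of L], rule lipschitz_onI)
    show "0 \<le> L" using g by (rule lipschitz_on_nonneg)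
    fix x y
    have "dist (g x \<bullet> b) (g y \<bullet> b) \<le> dist (g x) (g y)"
      using Basis_le_norm[OF b, of "g x - g y"] by (simp add: dist_norm inner_diff_left)
    also have "\<dots> \<le> L * dist x y" by (rule lipschitz_onD[OF g]) auto
    finally show "dist (g x \<bullet> b) (g y \<bullet> b) \<le> L * dist x y" .
  qed
  ultimately show ?thesis by (auto intro!: negligible_Union)
qed

text \<open>The segment from \<open>x\<close> to \<open>y\<close> may consist of points of nondifferentiability, but almost every parallel segment meets
that set in a null set only. There the mean value inequality in one variable applies to the component of \<open>g\<close> in the direction
\<open>p = g y - g x\<close>, and the estimate passes to the limit.\<close>

lemma lipschitz_if_derivative_bounded_ae:
  fixes g :: "'a::euclidean_space \<Rightarrow> 'b::euclidean_space"
  assumes g: "L-lipschitz_on UNIV g" and B: "open B" "convex B"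
    and bound: "\<And>x D h. x \<in> B \<Longrightarrow> (g has_derivative D) (at x) \<Longrightarrow> norm (D h) \<le> e * norm h"
    and "x \<in> B" "y \<in> B"
  shows "norm (g y - g x) \<le> e * norm (y - x)"
proof -
  define v where "v = y - x"
  define p where "p = g y - g x"
  define S where "S = {z. \<not> g differentiable (at z)}"
  have cont: "continuous_on UNIV g" using g by (rule lipschitz_on_continuous_on)
  have ae: "AE z in lborel. AE t in lborel. z + t *\<^sub>R v \<notin> S"
    unfolding S_def by (rule null_on_lines_if_null_set) (rule Rademacher[OF g])
  have main: "p \<bullet> (g (z + v) - g z) \<le> e * norm p * norm v"
    if z: "z \<in> B" "z + v \<in> B" and aez: "AE t in lborel. z + t *\<^sub>R v \<notin> S" for z
  proof -
    define f where "f t = p \<bullet> g (z + t *\<^sub>R v)" for t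
    have "(norm p * (L * norm v))-lipschitz_on UNIV f"
    proof (rule lipschitz_onI)
      show "0 \<le> norm p * (L * norm v)" using lipschitz_on_nonneg[OF g] by simp
      fix s t :: real
      have "dist (f s) (f t) = \<bar>p \<bullet> (g (z + s *\<^sub>R v) - g (z + t *\<^sub>R v))\<bar>"
        by (simp add: f_def dist_real_def inner_diff_right)
      also have "\<dots> \<le> norm p * dist (g (z + s *\<^sub>R v)) (g (z + t *\<^sub>R v))"
        unfolding dist_norm by (rule Cauchy_Schwarz_ineq2)
      also have "\<dots> \<le> norm p * (L * dist (z + s *\<^sub>R v) (z + t *\<^sub>R v))"
        by (intro mult_left_mono lipschitz_onD[OF g]) auto
      also have "dist (z + s *\<^sub>R v) (z + t *\<^sub>R v) = norm v * dist s t"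
        by (simp add: dist_norm scaleR_diff_left[symmetric] mult.commute)
      finally show "dist (f s) (f t) \<le> norm p * (L * norm v) * dist s t" by (simp add: mult.assoc)
    qed
    from lipschitz_real_derivative[OF this]
    obtain N h where N: "negligible N" and h: "\<And>t. t \<notin> N \<Longrightarrow> (f has_real_derivative h t) (at t)"
      and I: "\<And>a b c. a \<le> b \<Longrightarrow> (AE x in lborel. x \<in> {a..b} \<longrightarrow> h x \<le> c) \<Longrightarrow> f b - f a \<le> c * (b - a)"
      by blast
    have "AE t in lborel. t \<in> {0..1} \<longrightarrow> h t \<le> e * norm p * norm v"
      using AE_not_in_negligible[OF N] aez
    proof eventually_elim
      case (elim t)
      show ?case
      proof
        assume t: "t \<in> {0..1}"
        have "(1 - t) *\<^sub>R z + t *\<^sub>R (z + v) \<in> B"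
          using B(2) z t by (auto simp: convex_alt)
        then have tB: "z + t *\<^sub>R v \<in> B" by (simp add: algebra_simps)
        obtain D where D: "(g has_derivative D) (at (z + t *\<^sub>R v))"
          using elim by (auto simp: S_def differentiable_def)
        have "((\<lambda>t. p \<bullet> g (z + t *\<^sub>R v)) has_derivative (\<lambda>s. p \<bullet> D (s *\<^sub>R v))) (at t)"
          by (rule has_derivative_inner_right,
              rule has_derivative_compose[of "\<lambda>t. z + t *\<^sub>R v" "\<lambda>s. s *\<^sub>R v" t UNIV g D])
            (auto intro!: derivative_eq_intros D)
        then have "(f has_derivative (\<lambda>s. p \<bullet> D (s *\<^sub>R v))) (at t)" by (simp add: f_def[abs_def])
        moreover have "(f has_derivative (*) (h t)) (at t)"
          using h elim by (auto simp: has_field_derivative_def)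
        ultimately have "(\<lambda>s. p \<bullet> D (s *\<^sub>R v)) = (*) (h t)" by (rule has_derivative_unique)
        from fun_cong[OF this, of 1] have "h t = p \<bullet> D v" by simp
        also have "\<dots> \<le> norm p * norm (D v)" by (rule norm_cauchy_schwarz)
        also have "\<dots> \<le> norm p * (e * norm v)" by (intro mult_left_mono bound[OF tB D]) auto
        finally show "h t \<le> e * norm p * norm v" by (simp add: mult_ac)
      qed
    qed
    from I[OF _ this] have "f 1 - f 0 \<le> e * norm p * norm v" by simp
    then show ?thesis by (simp add: f_def inner_diff_right)
  qed
  have "\<exists>z. dist z x < inverse (real (Suc k)) \<and> (AE t in lborel. z + t *\<^sub>R v \<notin> S)" for k
  proof (rule ccontr)
    assume "\<not> ?thesis"
    then have "AE z in lborel. z \<notin> ball x (inverse (real (Suc k)))"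
      using ae by (auto elim!: eventually_mono simp: dist_commute)
    then have "ball x (inverse (real (Suc k))) \<in> null_sets lborel"
      using AE_iff_null_sets[of "ball x (inverse (real (Suc k)))" lborel] by simp
    then have "negligible (ball x (inverse (real (Suc k))))"
      by (simp add: negligible_iff_null_sets null_sets_completionI)
    then show False using open_not_negligible[of "ball x (inverse (real (Suc k)))"] by auto
  qed
  then obtain z where z: "\<And>k. dist (z k) x < inverse (real (Suc k))" "\<And>k. AE t in lborel. z k + t *\<^sub>R v \<notin> S"
    by metis
  have lim: "z \<longlonglongrightarrow> x"
    by (rule metric_tendsto_imp_tendsto[OF LIMSEQ_inverse_real_of_nat])
      (use z(1) in \<open>auto simp: dist_real_def intro!: always_eventually less_imp_le\<close>)
  have lim': "(\<lambda>k. z k + v) \<longlonglongrightarrow> y" using tendsto_add[OF lim tendsto_const[of v]] by (simp add: v_def)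
  have cg: "isCont g u" for u using cont by (simp add: continuous_on_eq_continuous_at)
  have "(\<lambda>k. p \<bullet> (g (z k + v) - g (z k))) \<longlonglongrightarrow> p \<bullet> (g y - g x)"
    by (intro tendsto_intros isCont_tendsto_compose[OF cg] lim lim')
  moreover have "\<forall>\<^sub>F k in sequentially. p \<bullet> (g (z k + v) - g (z k)) \<le> e * norm p * norm v"
    using topological_tendstoD[OF lim B(1) \<open>x \<in> B\<close>] topological_tendstoD[OF lim' B(1) \<open>y \<in> B\<close>]
    by eventually_elim (intro main z(2))
  ultimately have "p \<bullet> (g y - g x) \<le> e * norm p * norm v"
    by (intro tendsto_upperbound) auto
  then have "norm p * norm p \<le> (e * norm v) * norm p" by (simp add: p_def dot_square_norm power2_eq_square mult_ac)
  moreover have "e * norm v \<ge> 0"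
  proof -
    have "\<not> B \<subseteq> S"
      using Rademacher[OF g] open_not_negligible[OF B(1)] \<open>x \<in> B\<close> negligible_subset unfolding S_def by blast
    then obtain u D where "u \<in> B" "(g has_derivative D) (at u)" by (auto simp: S_def differentiable_def)
    from bound[OF this, of v] norm_ge_zero[of "D v"] show ?thesis by linarith
  qed
  ultimately have "norm p \<le> e * norm v"
    using mult_right_le_imp_le[of "norm p" "norm p" "e * norm v"] by (cases "norm p = 0") auto
  then show ?thesis by (simp add: p_def v_def)
qed

section \<open>Projections, strict derivatives and set limits\<close>

lemma orthogonal_comp_iff: "x \<in> L\<^sup>\<bottom> \<longleftrightarrow> (\<forall>y\<in>L. x \<bullet> y = 0)"
  by (auto simp: orthogonal_comp_def orthogonal_def inner_commute)

lemma orth_proj_unique: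
  assumes L: "subspace L" and "p \<in> L" "x - p \<in> L\<^sup>\<bottom>"
  shows "orth_proj L x = p"
  unfolding orth_proj_def
proof (rule the_equality)
  show "p \<in> L \<and> x - p \<in> L\<^sup>\<bottom>" using assms by simp
  fix q assume q: "q \<in> L \<and> x - q \<in> L\<^sup>\<bottom>"
  then have "p - q \<in> L" using assms by (simp add: subspace_diff)
  then have "(x - q) \<bullet> (p - q) = 0" "(x - p) \<bullet> (p - q) = 0"
    using q assms by (auto simp: orthogonal_comp_iff)
  then have "(p - q) \<bullet> (p - q) = 0" by (simp add: inner_diff_left)
  then show "q = p" by simp
qed

lemma orth_proj_in:
  assumes L: "subspace L"
  shows "orth_proj L x \<in> L" "x - orth_proj L x \<in> L\<^sup>\<bottom>"
proof -
  obtain y z where yz: "y \<in> span L" "\<And>w. w \<in> span L \<Longrightarrow> orthogonal z w" "x = y + z"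
    using orthogonal_subspace_decomp_exists[of L x] by metis
  then have "y \<in> L" "x - y \<in> L\<^sup>\<bottom>"
    using L by (auto simp: orthogonal_comp_iff orthogonal_def span_eq_iff[THEN iffD2])
  with orth_proj_unique[OF L this]
  show "orth_proj L x \<in> L" "x - orth_proj L x \<in> L\<^sup>\<bottom>" by auto
qed

lemma linear_orth_proj:
  assumes L: "subspace L"
  shows "linear (orth_proj L)"
proof (rule linearI)
  fix x y and c :: real
  note P = orth_proj_in[OF L]
  have "(x - orth_proj L x) + (y - orth_proj L y) \<in> L\<^sup>\<bottom>"
    by (intro subspace_add subspace_orthogonal_comp P)
  then show "orth_proj L (x + y) = orth_proj L x + orth_proj L y"
    by (intro orth_proj_unique[OF L]) (auto simp: L P subspace_add algebra_simps)
  have "c *\<^sub>R (x - orth_proj L x) \<in> L\<^sup>\<bottom>"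
    by (intro subspace_scale subspace_orthogonal_comp P)
  then show "orth_proj L (c *\<^sub>R x) = c *\<^sub>R orth_proj L x"
    by (intro orth_proj_unique[OF L]) (auto simp: L P subspace_scale algebra_simps)
qed

lemma norm_orth_proj_le:
  assumes L: "subspace L"
  shows "norm (orth_proj L x) \<le> norm x"
proof -
  note P = orth_proj_in[OF L, of x]
  have "(x - orth_proj L x) \<bullet> orth_proj L x = 0" using P by (auto simp: orthogonal_comp_iff)
  then have "(norm (orth_proj L x))\<^sup>2 = x \<bullet> orth_proj L x"
    by (simp add: inner_diff_left dot_square_norm)
  also have "\<dots> \<le> norm x * norm (orth_proj L x)" by (rule norm_cauchy_schwarz)
  finally show ?thesis
    by (cases "orth_proj L x = 0") (auto simp: power2_eq_square)
qed

lemma orth_proj_id: "subspace L \<Longrightarrow> x \<in> L \<Longrightarrow> orth_proj L x = x"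
  by (rule orth_proj_unique) (auto simp: subspace_0 subspace_orthogonal_comp)

lemma subspace_eq_if_orth_proj_eq:
  assumes "subspace L" "subspace M" "\<And>x. orth_proj L x = orth_proj M x"
  shows "L = M"
  using assms orth_proj_in(1) orth_proj_id by (metis subsetI subset_antisym)

text \<open>In finite dimensions the operator norm is controlled by the values on a basis, so the metric on the
subspaces describes pointwise convergence of the projections.\<close>

lemma subspace_dist_tendsto_iff:
  fixes L :: "'a::euclidean_space set" and M :: "nat \<Rightarrow> 'a set"
  assumes L: "subspace L" and M: "\<And>k. subspace (M k)"
  shows "(\<lambda>k. subspace_dist L (M k)) \<longlonglongrightarrow> 0 \<longleftrightarrow> (\<forall>x. (\<lambda>k. orth_proj (M k) x) \<longlonglongrightarrow> orth_proj L x)"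
proof -
  have bl: "bounded_linear (\<lambda>x. orth_proj L x - orth_proj (M k) x)" for k
    by (intro bounded_linear_sub linear_orth_proj L M linear_linear[THEN iffD2]) 
  show ?thesis
  proof
    assume lim: "(\<lambda>k. subspace_dist L (M k)) \<longlonglongrightarrow> 0"
    show "\<forall>x. (\<lambda>k. orth_proj (M k) x) \<longlonglongrightarrow> orth_proj L x"
    proof
      fix x :: 'a
      have "(\<lambda>k. subspace_dist L (M k) * norm x) \<longlonglongrightarrow> 0" using lim by (rule tendsto_mult_left_zero)
      then have "(\<lambda>k. orth_proj L x - orth_proj (M k) x) \<longlonglongrightarrow> 0"
        by (rule Lim_null_comparison[rotated])
          (auto simp: subspace_dist_def intro!: always_eventually onorm[OF bl])
      from tendsto_diff[OF tendsto_const[of "orth_proj L x"] this]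
      show "(\<lambda>k. orth_proj (M k) x) \<longlonglongrightarrow> orth_proj L x" by simp
    qed
  next
    assume lim: "\<forall>x. (\<lambda>k. orth_proj (M k) x) \<longlonglongrightarrow> orth_proj L x"
    have "(\<lambda>k. \<Sum>b\<in>Basis. norm (orth_proj L b - orth_proj (M k) b)) \<longlonglongrightarrow> (\<Sum>b\<in>Basis. norm (orth_proj L b - orth_proj L b))"
      using lim by (intro tendsto_intros) auto
    then have lim0: "(\<lambda>k. \<Sum>b\<in>Basis. norm (orth_proj L b - orth_proj (M k) b)) \<longlonglongrightarrow> 0" by simp
    show "(\<lambda>k. subspace_dist L (M k)) \<longlonglongrightarrow> 0"
      by (rule tendsto_sandwich[OF _ _ tendsto_const lim0])
        (auto simp: subspace_dist_def intro!: always_eventually onorm_pos_le[OF bl] onorm_componentwise[OF bl])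
  qed
qed

text \<open>The projection onto \<open>M k\<close> of the fixed point \<open>p0 + q0\<close> differs from \<open>p k\<close> by the projection of a vector that
tends to zero.\<close>

lemma orth_proj_tendsto:
  fixes M :: "nat \<Rightarrow> 'a::euclidean_space set"
  assumes M: "\<And>k. subspace (M k)"
    and inL: "\<And>k. p k \<in> M k" "p \<longlonglongrightarrow> p0" and perp: "\<And>k. q k \<in> (M k)\<^sup>\<bottom>" "q \<longlonglongrightarrow> q0"
  shows "(\<lambda>k. orth_proj (M k) (p0 + q0)) \<longlonglongrightarrow> p0"
proof -
  have eq: "orth_proj (M k) (p0 + q0) = orth_proj (M k) ((p0 - p k) + (q0 - q k)) + p k" for k
  proof -
    have "orth_proj (M k) (p k + q k) = p k"
      using M inL perp by (intro orth_proj_unique) auto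
    moreover have "p0 + q0 = ((p0 - p k) + (q0 - q k)) + (p k + q k)" by simp
    ultimately show ?thesis
      using linear_add[OF linear_orth_proj[OF M[of k]], of "(p0 - p k) + (q0 - q k)" "p k + q k"] by simp
  qed
  have "(\<lambda>k. (p0 - p k) + (q0 - q k)) \<longlonglongrightarrow> (p0 - p0) + (q0 - q0)" by (intro tendsto_intros inL perp)
  then have "(\<lambda>k. (p0 - p k) + (q0 - q k)) \<longlonglongrightarrow> 0" by simp
  from tendsto_norm_zero[OF this] have "(\<lambda>k. orth_proj (M k) ((p0 - p k) + (q0 - q k))) \<longlonglongrightarrow> 0"
    by (rule Lim_null_comparison[rotated]) (simp add: norm_orth_proj_le M)
  from tendsto_add[OF this inL(2)] show ?thesis unfolding eq by simp
qed

text \<open>Strict differentiability relative to \<open>U\<close> with a named derivative, in a form that does not exclude \<open>u = v\<close>.\<close>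

definition strict_derivative :: "'a::real_normed_vector set \<Rightarrow> ('a \<Rightarrow> 'b::real_normed_vector) \<Rightarrow> ('a \<Rightarrow> 'b) \<Rightarrow> 'a \<Rightarrow> bool" where
  "strict_derivative U g H w \<longleftrightarrow> linear H \<and>
    (\<forall>e>0. \<exists>d>0. \<forall>u\<in>U \<inter> ball w d. \<forall>v\<in>U \<inter> ball w d. norm (g v - g u - H (v - u)) \<le> e * norm (v - u))"

lemma norm_quotient_less:
  assumes "v \<noteq> (w::'a::real_normed_vector)"
  shows "norm (X /\<^sub>R norm (w - v)) < e \<longleftrightarrow> norm (X::'b::real_normed_vector) < e * norm (w - v)"
proof -
  have "norm (X /\<^sub>R norm (w - v)) = norm X / norm (w - v)" by (simp add: divide_inverse_commute)
  then show ?thesis using assms by (simp add: pos_divide_less_eq)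
qed

lemma strictly_differentiable_in_iff:
  "strictly_differentiable_in U f u \<longleftrightarrow> (\<exists>A. strict_derivative U f A u)"
proof -
  have "((\<lambda>(v, w). (f w - f v - A (w - v)) /\<^sub>R norm (w - v)) \<longlongrightarrow> 0) (at (u, u) within {(v, w). v \<in> U \<and> w \<in> U \<and> v \<noteq> w})
    \<longleftrightarrow> (\<forall>e>0. \<exists>d>0. \<forall>v\<in>U \<inter> ball u d. \<forall>w\<in>U \<inter> ball u d. norm (f w - f v - A (w - v)) \<le> e * norm (w - v))"
    (is "?lim \<longleftrightarrow> ?eps") if A: "linear A" for A
  proof
    assume ?lim
    show ?eps
    proof (intro allI impI)
      fix e :: real assume "e > 0"
      then obtain d where d: "d > 0" "\<And>v w. v \<in> U \<Longrightarrow> w \<in> U \<Longrightarrow> v \<noteq> w \<Longrightarrow> dist (v, w) (u, u) < d \<Longrightarrow>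
          norm ((f w - f v - A (w - v)) /\<^sub>R norm (w - v)) < e"
        using \<open>?lim\<close> unfolding Lim_within
        by (force simp: dist_norm)
      show "\<exists>d>0. \<forall>v\<in>U \<inter> ball u d. \<forall>w\<in>U \<inter> ball u d. norm (f w - f v - A (w - v)) \<le> e * norm (w - v)"
      proof (intro exI[of _ "d/2"] conjI ballI)
        fix v w assume v: "v \<in> U \<inter> ball u (d/2)" and w: "w \<in> U \<inter> ball u (d/2)"
        show "norm (f w - f v - A (w - v)) \<le> e * norm (w - v)"
        proof (cases "v = w")
          case False
          have "dist (v, w) (u, u) \<le> dist v u + dist w u"
            unfolding dist_Pair_Pair by (rule sqrt_sum_squares_le_sum) auto
          also have "\<dots> < d" using v w by (auto simp: dist_commute)
          finally have "norm ((f w - f v - A (w - v)) /\<^sub>R norm (w - v)) < e" using d v w False by auto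
          then show ?thesis unfolding norm_quotient_less[OF False] by simp
        qed (use linear_0[OF A] in simp)
      qed (use d in auto)
    qed
  next
    assume eps: ?eps
    show ?lim
      unfolding Lim_within
    proof (intro allI impI)
      fix e :: real assume "e > 0"
      then obtain d where d: "d > 0" "\<And>v w. v \<in> U \<inter> ball u d \<Longrightarrow> w \<in> U \<inter> ball u d \<Longrightarrow> norm (f w - f v - A (w - v)) \<le> e/2 * norm (w - v)"
        using eps[rule_format, of "e/2"] by auto
      show "\<exists>d>0. \<forall>x\<in>{(v, w). v \<in> U \<and> w \<in> U \<and> v \<noteq> w}. 0 < dist x (u, u) \<and> dist x (u, u) < d \<longrightarrow>
          dist (case x of (v, w) \<Rightarrow> (f w - f v - A (w - v)) /\<^sub>R norm (w - v)) 0 < e"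
      proof (intro exI[of _ d] conjI ballI impI)
        fix x assume x: "x \<in> {(v, w). v \<in> U \<and> w \<in> U \<and> v \<noteq> w}" "0 < dist x (u, u) \<and> dist x (u, u) < d"
        obtain v w where vw: "x = (v, w)" by (cases x)
        have "dist v u < d" "dist w u < d"
          using x dist_fst_le[of x "(u, u)"] dist_snd_le[of x "(u, u)"] by (auto simp: vw)
        then have "norm (f w - f v - A (w - v)) \<le> e/2 * norm (w - v)"
          using d x by (auto simp: vw dist_commute)
        also have "\<dots> < e * norm (w - v)" using x \<open>e > 0\<close> by (auto simp: vw)
        finally have "norm ((f w - f v - A (w - v)) /\<^sub>R norm (w - v)) < e"
          using x by (subst norm_quotient_less) (auto simp: vw)
        then show "dist (case x of (v, w) \<Rightarrow> (f w - f v - A (w - v)) /\<^sub>R norm (w - v)) 0 < e"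
          by (simp add: vw)
      qed (use d in auto)
    qed
  qed
  then show ?thesis unfolding strictly_differentiable_in_def strict_derivative_def by blast
qed

text \<open>Common core of the next lemma and of its analogue for ordinary derivatives: a linearization
error of order \<open>o(norm (v k - u k))\<close> is invisible in the limit of the difference quotients.\<close>

lemma linearization_quotient:
  fixes g :: "'a::real_normed_vector \<Rightarrow> 'b::real_normed_vector"
  assumes bl: "bounded_linear H" and t: "\<forall>\<^sub>F k in sequentially. 0 < (t k::real)" and q: "(\<lambda>k. (v k - u k) /\<^sub>R t k) \<longlonglongrightarrow> a"
    and small: "\<And>e. e > 0 \<Longrightarrow> \<forall>\<^sub>F k in sequentially. norm (g (v k) - g (u k) - H (v k - u k)) \<le> e * norm (v k - u k)"
  shows "(\<lambda>k. (g (v k) - g (u k)) /\<^sub>R t k) \<longlonglongrightarrow> H a"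
proof -
  obtain B where B: "\<And>k. norm ((v k - u k) /\<^sub>R t k) \<le> B"
    using convergent_imp_bounded[OF q] by (auto simp: bounded_iff)
  have "B \<ge> 0" using B[of 0] norm_ge_zero order_trans by blast
  have "(\<lambda>k. (g (v k) - g (u k) - H (v k - u k)) /\<^sub>R t k) \<longlonglongrightarrow> 0"
  proof (rule tendstoI)
    fix e :: real assume "e > 0"
    then have eB: "e / (B + 1) > 0" using \<open>B \<ge> 0\<close> by simp
    show "\<forall>\<^sub>F k in sequentially. dist ((g (v k) - g (u k) - H (v k - u k)) /\<^sub>R t k) 0 < e"
      using small[OF eB] t
    proof eventually_elim
      case (elim k)
      then have "norm (g (v k) - g (u k) - H (v k - u k)) / t k \<le> e / (B + 1) * (norm (v k - u k) / t k)"
        using divide_right_mono[of _ _ "t k"] by fastforce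
      also have "\<dots> \<le> e / (B + 1) * B"
        using B[of k] elim eB by (intro mult_left_mono) (auto simp: divide_inverse_commute)
      also have "\<dots> < e" using \<open>B \<ge> 0\<close> \<open>e > 0\<close> by (simp add: field_simps)
      finally show ?case using elim by (simp add: divide_inverse_commute)
    qed
  qed
  from tendsto_add[OF this bounded_linear.tendsto[OF bl q]]
  have "(\<lambda>k. (g (v k) - g (u k) - H (v k - u k)) /\<^sub>R t k + H ((v k - u k) /\<^sub>R t k)) \<longlonglongrightarrow> 0 + H a" .
  moreover have "(g (v k) - g (u k) - H (v k - u k)) /\<^sub>R t k + H ((v k - u k) /\<^sub>R t k) = (g (v k) - g (u k)) /\<^sub>R t k" for k
    by (subst linear_scale[OF bounded_linear.linear[OF bl]]) (simp add: scaleR_diff_right)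
  ultimately show ?thesis by simp
qed

text \<open>Strict differentiability is used in this form throughout: both end points of the
difference quotient may move.\<close>

lemma strict_derivative_quotient:
  fixes g :: "'a::euclidean_space \<Rightarrow> 'b::euclidean_space"
  assumes sd: "strict_derivative U g H w"
    and u: "\<forall>\<^sub>F k in sequentially. u k \<in> U" "u \<longlonglongrightarrow> w" and v: "\<forall>\<^sub>F k in sequentially. v k \<in> U" "v \<longlonglongrightarrow> w"
    and t: "\<forall>\<^sub>F k in sequentially. 0 < (t k::real)" and q: "(\<lambda>k. (v k - u k) /\<^sub>R t k) \<longlonglongrightarrow> a"
  shows "(\<lambda>k. (g (v k) - g (u k)) /\<^sub>R t k) \<longlonglongrightarrow> H a"
proof (rule linearization_quotient[OF _ t q])
  show "bounded_linear H" using sd by (simp add: strict_derivative_def linear_linear)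
  fix e :: real assume "e > 0"
  then obtain d where d: "d > 0" "\<And>u v. u \<in> U \<inter> ball w d \<Longrightarrow> v \<in> U \<inter> ball w d \<Longrightarrow> norm (g v - g u - H (v - u)) \<le> e * norm (v - u)"
    using sd unfolding strict_derivative_def by blast
  have "\<forall>\<^sub>F k in sequentially. u k \<in> ball w d" "\<forall>\<^sub>F k in sequentially. v k \<in> ball w d"
    using topological_tendstoD[OF u(2) open_ball] topological_tendstoD[OF v(2) open_ball] d(1) by auto
  then show "\<forall>\<^sub>F k in sequentially. norm (g (v k) - g (u k) - H (v k - u k)) \<le> e * norm (v k - u k)"
    using u(1) v(1) by eventually_elim (rule d(2); blast)
qed

lemma strict_derivative_imp_has_derivative:
  fixes g :: "'a::euclidean_space \<Rightarrow> 'b::euclidean_space"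
  assumes sd: "strict_derivative U g H w" and U: "open U" "w \<in> U"
  shows "(g has_derivative H) (at w)"
  unfolding has_derivative_at_alt
proof (intro conjI allI impI)
  show "bounded_linear H" using sd by (simp add: strict_derivative_def linear_linear)
  fix e :: real assume "e > 0"
  then obtain d where d: "d > 0" "\<forall>u\<in>U \<inter> ball w d. \<forall>v\<in>U \<inter> ball w d. norm (g v - g u - H (v - u)) \<le> e * norm (v - u)"
    using sd unfolding strict_derivative_def by blast
  obtain d' where d': "d' > 0" "ball w d' \<subseteq> U" using U open_contains_ball by blast
  show "\<exists>d>0. \<forall>y. norm (y - w) < d \<longrightarrow> norm (g y - g w - H (y - w)) \<le> e * norm (y - w)"
  proof (intro exI[of _ "min d d'"] conjI allI impI)
    fix y assume "norm (y - w) < min d d'"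
    then have "y \<in> U \<inter> ball w d" "w \<in> U \<inter> ball w d"
      using d' d U by (auto simp: subset_iff dist_norm norm_minus_commute)
    then show "norm (g y - g w - H (y - w)) \<le> e * norm (y - w)" using d(2) by blast
  qed (use d d' in auto)
qed

lemma strict_derivative_if_C1:
  fixes f :: "'a::euclidean_space \<Rightarrow> 'b::euclidean_space"
  assumes "continuously_differentiable_on_open W f" "x \<in> W"
  obtains A where "strict_derivative W f A x" "(f has_derivative A) (at x)"
proof -
  obtain f' where W: "open W" and f': "\<And>x. x \<in> W \<Longrightarrow> (f has_derivative blinfun_apply (f' x)) (at x)"
    and cont: "continuous_on W f'"
    using assms(1) by (auto simp: continuously_differentiable_on_open_def)
  have "strict_derivative W f (blinfun_apply (f' x)) x"
    unfolding strict_derivative_def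
  proof (intro conjI allI impI)
    show "linear (blinfun_apply (f' x))" by (simp add: linear_conv_bounded_linear blinfun.bounded_linear_right)
    fix e :: real assume "e > 0"
    have "isCont f' x" using cont W assms(2) by (simp add: continuous_on_eq_continuous_at)
    then obtain d1 where d1: "d1 > 0" "\<And>y. dist y x < d1 \<Longrightarrow> dist (f' y) (f' x) < e"
      using \<open>e > 0\<close> unfolding continuous_at_eps_delta by blast
    obtain d2 where d2: "d2 > 0" "ball x d2 \<subseteq> W" using W assms(2) open_contains_ball by blast
    define d where "d = min d1 d2"
    show "\<exists>d>0. \<forall>u\<in>W \<inter> ball x d. \<forall>v\<in>W \<inter> ball x d. norm (f v - f u - blinfun_apply (f' x) (v - u)) \<le> e * norm (v - u)"
    proof (intro exI[of _ d] conjI ballI)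
      show "d > 0" using d1 d2 by (simp add: d_def)
      fix u v assume u: "u \<in> W \<inter> ball x d" and v: "v \<in> W \<inter> ball x d"
      have "norm (f v - f u - blinfun_apply (f' x) (v - u)) \<le> norm (v - u) * e"
      proof (rule differentiable_bound_linearization[where S="ball x d" and f'="\<lambda>x. blinfun_apply (f' x)"])
        fix t :: real assume t: "t \<in> {0..1}"
        have "(1 - t) *\<^sub>R u + t *\<^sub>R v \<in> ball x d"
          using convex_ball[of x d] u v t by (auto simp: convex_alt)
        then show "u + t *\<^sub>R (v - u) \<in> ball x d" by (simp add: algebra_simps)
      next
        fix y assume y: "y \<in> ball x d"
        then have "y \<in> W" using d2 by (auto simp: d_def)
        then show "(f has_derivative blinfun_apply (f' y)) (at y within ball x d)"
          by (rule has_derivative_at_withinI[OF f'])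
        have "dist y x < d1" using y by (simp add: d_def dist_commute)
        from d1(2)[OF this] have "norm (f' y - f' x) < e" by (simp only: dist_norm)
        moreover have "onorm (blinfun_apply (f' y) - blinfun_apply (f' x)) = norm (f' y - f' x)"
          by (simp add: norm_blinfun.rep_eq minus_blinfun.rep_eq fun_diff_def)
        ultimately show "onorm (blinfun_apply (f' y) - blinfun_apply (f' x)) \<le> e" by simp
      qed (use \<open>d > 0\<close> in auto)
      then show "norm (f v - f u - blinfun_apply (f' x) (v - u)) \<le> e * norm (v - u)" by (simp add: mult.commute)
    qed
  qed
  with f' assms(2) show ?thesis using that by blast
qed

lemma filterlim_nhds_in:
  "filterlim z (nhds_in \<Omega> z0) F \<longleftrightarrow> (z \<longlongrightarrow> z0) F \<and> (\<forall>\<^sub>F k in F. z k \<in> \<Omega>)"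
  by (simp add: nhds_in_def filterlim_inf filterlim_principal)

lemma filterlim_at_right_0_iff:
  "filterlim t (at_right (0::real)) F \<longleftrightarrow> (t \<longlongrightarrow> 0) F \<and> (\<forall>\<^sub>F k in F. t k > 0)"
  unfolding filterlim_at by (auto elim: eventually_mono)

lemma filterlim_prod_iff:
  "filterlim p (F1 \<times>\<^sub>F F2) F \<longleftrightarrow> filterlim (\<lambda>k. fst (p k)) F1 F \<and> filterlim (\<lambda>k. snd (p k)) F2 F"
proof
  assume "filterlim p (F1 \<times>\<^sub>F F2) F"
  then show "filterlim (\<lambda>k. fst (p k)) F1 F \<and> filterlim (\<lambda>k. snd (p k)) F2 F"
    using filterlim_compose[OF filterlim_fst] filterlim_compose[OF filterlim_snd] by blast
next
  assume "filterlim (\<lambda>k. fst (p k)) F1 F \<and> filterlim (\<lambda>k. snd (p k)) F2 F"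
  then have "filterlim (\<lambda>k. (fst (p k), snd (p k))) (F1 \<times>\<^sub>F F2) F" by (intro filterlim_Pair) auto
  then show "filterlim p (F1 \<times>\<^sub>F F2) F" by simp
qed

lemma outer_limitI:
  assumes "filterlim p \<F> sequentially" "\<forall>\<^sub>F k in sequentially. v k \<in> S (p k)" "v \<longlonglongrightarrow> w"
  shows "w \<in> outer_limit S \<F>"
proof -
  obtain N where "\<And>k. k \<ge> N \<Longrightarrow> v k \<in> S (p k)" using assms(2) by (auto simp: eventually_sequentially)
  moreover have "filterlim (\<lambda>k. p (k + N)) \<F> sequentially"
    by (rule filterlim_compose[OF assms(1)]) (rule filterlim_add_const_nat_at_top)
  moreover have "(\<lambda>k. v (k + N)) \<longlonglongrightarrow> w" by (rule LIMSEQ_ignore_initial_segment[OF assms(3)])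
  ultimately show ?thesis
    unfolding outer_limit_def by (intro CollectI exI[of _ "\<lambda>k. p (k + N)"] exI[of _ "\<lambda>k. v (k + N)"]) auto
qed

lemma inner_limit_subset_outer_limit:
  assumes "filterlim p \<F> sequentially"
  shows "inner_limit S \<F> \<subseteq> outer_limit S \<F>"
  using outer_limitI[OF assms] assms unfolding inner_limit_def by blast

abbreviation "inv_nat \<equiv> (\<lambda>k. inverse (real (Suc k)))"

lemma inv_nat_at_right: "filterlim inv_nat (at_right 0) sequentially"
  unfolding filterlim_at_right_0_iff using LIMSEQ_inverse_real_of_nat by auto

lemma diff_quot_set_iff: "t \<noteq> 0 \<Longrightarrow> v \<in> diff_quot_set \<Omega> z t \<longleftrightarrow> z + t *\<^sub>R v \<in> \<Omega>"
proof
  assume "t \<noteq> 0" "v \<in> diff_quot_set \<Omega> z t"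
  then show "z + t *\<^sub>R v \<in> \<Omega>" by (auto simp: diff_quot_set_def)
next
  assume "t \<noteq> 0" "z + t *\<^sub>R v \<in> \<Omega>"
  then show "v \<in> diff_quot_set \<Omega> z t"
    unfolding diff_quot_set_def by (intro image_eqI[of _ _ "z + t *\<^sub>R v"]) auto
qed

text \<open>In the coordinates \<open>\<Phi>\<close> the set is the graph of \<open>f\<close>, and strict differentiability of \<open>f\<close> identifies every limit of
difference quotients with a vector \<open>g + A g\<close>. Conversely, for arbitrary base points \<open>b k\<close> and step sizes \<open>s k\<close> the vector
\<open>g + A g\<close> is the limit of the quotients between \<open>b k\<close> and \<open>b k + s k *\<^sub>R g\<close>.\<close>

lemma graphically_strictly_differentiable_imp_strictly_proto_differentiable:
  fixes F :: "'a::euclidean_space \<Rightarrow> 'b::euclidean_space set"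
  assumes gsd: "graphically_strictly_differentiable F x y"
  shows "strictly_proto_differentiable F x y"
proof -
  define \<Omega> where "\<Omega> = gph F"
  define z0 where "z0 = (x, y)"
  obtain K :: "('a \<times> 'b) set" and W \<Phi> U f u where K: "subspace K" and W: "open W" "z0 \<in> W" and inj: "inj_on \<Phi> W"
    and oim: "open (\<Phi> ` W)" and C1: "continuously_differentiable_on_open W \<Phi>"
    and C1i: "continuously_differentiable_on_open (\<Phi> ` W) (inv_into W \<Phi>)"
    and U: "openin (top_of_set K) U" and fK: "f ` U \<subseteq> K\<^sup>\<bottom>"
    and im: "\<Phi> ` (\<Omega> \<inter> W) = {v + f v | v. v \<in> U}"
    and u: "u \<in> U" "u + f u = \<Phi> z0" and sd: "strictly_differentiable_in U f u"
    using gsd unfolding graphically_strictly_differentiable_def \<Omega>_def[symmetric] z0_def[symmetric] by blast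
  define \<Psi> where "\<Psi> = inv_into W \<Phi>"
  have \<Psi>\<Phi>: "\<Psi> (\<Phi> z) = z" if "z \<in> W" for z using inj that by (simp add: \<Psi>_def)
  obtain A where A: "strict_derivative U f A u" using sd by (auto simp: strictly_differentiable_in_iff)
  obtain P where P: "strict_derivative W \<Phi> P z0" "(\<Phi> has_derivative P) (at z0)"
    using strict_derivative_if_C1[OF C1 W(2)] .
  obtain Q where Q: "strict_derivative (\<Phi> ` W) \<Psi> Q (\<Phi> z0)" "(\<Psi> has_derivative Q) (at (\<Phi> z0))"
    using strict_derivative_if_C1[OF C1i, of "\<Phi> z0"] W(2) unfolding \<Psi>_def by blast
  have QP: "Q (P h) = h" for h
  proof -
    have "((\<lambda>z. \<Psi> (\<Phi> z)) has_derivative (\<lambda>h. Q (P h))) (at z0)"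
      by (rule has_derivative_compose[OF P(2) Q(2)])
    moreover have "((\<lambda>z. \<Psi> (\<Phi> z)) has_derivative (\<lambda>h. h)) (at z0)"
      by (rule has_derivative_transform_within_open[OF has_derivative_ident W]) (simp add: \<Psi>\<Phi>)
    ultimately have "(\<lambda>h. Q (P h)) = (\<lambda>h. h)" by (rule has_derivative_unique)
    then show ?thesis by (rule fun_cong)
  qed
  define \<pi> where "\<pi> = orth_proj K"
  have \<pi>: "bounded_linear \<pi>" unfolding \<pi>_def by (simp add: linear_conv_bounded_linear[symmetric] linear_orth_proj K)
  have UK: "U \<subseteq> K" using U openin_imp_subset by blast
  have \<pi>v: "\<pi> (v + f v) = v" if "v \<in> U" for v
    unfolding \<pi>_def using that UK fK by (intro orth_proj_unique[OF K]) auto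
  have chart: "\<pi> (\<Phi> z) \<in> U \<and> \<Phi> z = \<pi> (\<Phi> z) + f (\<pi> (\<Phi> z))" if "z \<in> \<Omega>" "z \<in> W" for z
  proof -
    have "\<Phi> z \<in> {v + f v | v. v \<in> U}" using im that by blast
    then obtain v where "v \<in> U" "\<Phi> z = v + f v" by blast
    then show ?thesis using \<pi>v by simp
  qed
  have chart': "\<Psi> (v + f v) \<in> \<Omega> \<and> \<Psi> (v + f v) \<in> W \<and> v + f v \<in> \<Phi> ` W" if v: "v \<in> U" for v
  proof -
    have "v + f v \<in> \<Phi> ` (\<Omega> \<inter> W)" using im v by blast
    then obtain z where "z \<in> \<Omega>" "z \<in> W" "v + f v = \<Phi> z" by blast
    then show ?thesis using \<Psi>\<Phi> by auto
  qed
  have z0\<Omega>: "z0 \<in> \<Omega>"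
    using chart'[OF u(1)] \<Psi>\<Phi>[OF W(2)] unfolding u(2) by simp
  have cont\<Phi>: "isCont \<Phi> z0" using P(2) has_derivative_continuous by blast
  have \<pi>u: "\<pi> (\<Phi> z0) = u" using \<pi>v[OF u(1)] u(2) by simp
  have proj_lim: "(\<lambda>k. \<pi> (\<Phi> (z k))) \<longlonglongrightarrow> u" if "z \<longlonglongrightarrow> z0" for z
    using bounded_linear.tendsto[OF \<pi> isCont_tendsto_compose[OF cont\<Phi> that]] \<pi>u by simp
  let ?S = "\<lambda>(z, t). diff_quot_set \<Omega> z t" and ?F = "nhds_in \<Omega> z0 \<times>\<^sub>F at_right (0::real)"
  have "outer_limit ?S ?F \<subseteq> inner_limit ?S ?F"
  proof
    fix h assume "h \<in> outer_limit ?S ?F"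
    then obtain p v where p: "filterlim p ?F sequentially" and v: "\<And>k. v k \<in> ?S (p k)" "v \<longlonglongrightarrow> h"
      by (auto simp: outer_limit_def)
    define z t where "z k = fst (p k)" and "t k = snd (p k)" for k
    have z: "z \<longlonglongrightarrow> z0" "\<forall>\<^sub>F k in sequentially. z k \<in> \<Omega>" and t: "t \<longlonglongrightarrow> 0" "\<forall>\<^sub>F k in sequentially. t k > 0"
      using p by (auto simp: filterlim_prod_iff filterlim_nhds_in filterlim_at_right_0_iff z_def[abs_def] t_def[abs_def])
    define z' where "z' k = z k + t k *\<^sub>R v k" for k
    have z': "\<forall>\<^sub>F k in sequentially. z' k \<in> \<Omega>"
      using t(2)
    proof eventually_elim
      case (elim k)
      have "v k \<in> diff_quot_set \<Omega> (z k) (t k)" using v(1)[of k] by (simp add: z_def t_def split_beta)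
      then show ?case using elim by (simp add: z'_def diff_quot_set_iff)
    qed
    have z'lim: "z' \<longlonglongrightarrow> z0" unfolding z'_def using tendsto_add[OF z(1) tendsto_scaleR[OF t(1) v(2)]] by simp
    have zW: "\<forall>\<^sub>F k in sequentially. z k \<in> W" and z'W: "\<forall>\<^sub>F k in sequentially. z' k \<in> W"
      using topological_tendstoD[OF z(1) W] topological_tendstoD[OF z'lim W] .
    have "(\<lambda>k. (z' k - z k) /\<^sub>R t k) \<longlonglongrightarrow> h"
      by (rule Lim_transform_eventually[OF v(2)]) (use t(2) in eventually_elim, simp add: z'_def)
    from strict_derivative_quotient[OF P(1) zW z(1) z'W z'lim t(2) this]
    have \<Phi>q: "(\<lambda>k. (\<Phi> (z' k) - \<Phi> (z k)) /\<^sub>R t k) \<longlonglongrightarrow> P h" .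
    define g where "g = \<pi> (P h)"
    have q: "(\<lambda>k. (\<pi> (\<Phi> (z' k)) - \<pi> (\<Phi> (z k))) /\<^sub>R t k) \<longlonglongrightarrow> g"
      using bounded_linear.tendsto[OF \<pi> \<Phi>q] unfolding g_def
      by (simp only: linear_scale[OF bounded_linear.linear[OF \<pi>]] linear_diff[OF bounded_linear.linear[OF \<pi>]])
    have inU: "\<forall>\<^sub>F k in sequentially. \<pi> (\<Phi> (z k)) \<in> U"
      using z(2) zW by eventually_elim (use chart in blast)
    have inU': "\<forall>\<^sub>F k in sequentially. \<pi> (\<Phi> (z' k)) \<in> U"
      using z' z'W by eventually_elim (use chart in blast)
    have "(\<lambda>k. (f (\<pi> (\<Phi> (z' k))) - f (\<pi> (\<Phi> (z k)))) /\<^sub>R t k) \<longlonglongrightarrow> A g"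
      by (rule strict_derivative_quotient[OF A inU proj_lim[OF z(1)] inU' proj_lim[OF z'lim] t(2) q])
    from tendsto_add[OF q this]
    have "(\<lambda>k. (\<Phi> (z' k) - \<Phi> (z k)) /\<^sub>R t k) \<longlonglongrightarrow> g + A g"
    proof (rule Lim_transform_eventually)
      show "\<forall>\<^sub>F k in sequentially. (\<pi> (\<Phi> (z' k)) - \<pi> (\<Phi> (z k))) /\<^sub>R t k + (f (\<pi> (\<Phi> (z' k))) - f (\<pi> (\<Phi> (z k)))) /\<^sub>R t k
          = (\<Phi> (z' k) - \<Phi> (z k)) /\<^sub>R t k"
        using z(2) zW z' z'W
      proof eventually_elim
        case (elim k)
        have "\<Phi> (z' k) - \<Phi> (z k) = (\<pi> (\<Phi> (z' k)) + f (\<pi> (\<Phi> (z' k)))) - (\<pi> (\<Phi> (z k)) + f (\<pi> (\<Phi> (z k))))"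
          using chart[OF elim(1,2)] chart[OF elim(3,4)] by metis
        then show ?case by (simp add: scaleR_add_right[symmetric] scaleR_diff_right[symmetric] del: scaleR_add_right scaleR_diff_right)
      qed
    qed
    then have Ph: "P h = g + A g" using \<Phi>q LIMSEQ_unique by blast
    have gK: "g \<in> K" unfolding g_def \<pi>_def by (rule orth_proj_in[OF K])
    show "h \<in> inner_limit ?S ?F"
      unfolding inner_limit_def
    proof (intro CollectI allI impI)
      fix p assume p: "filterlim p ?F sequentially"
      define z s where "z k = fst (p k)" and "s k = snd (p k)" for k
      have z: "z \<longlonglongrightarrow> z0" "\<forall>\<^sub>F k in sequentially. z k \<in> \<Omega>" and s: "s \<longlonglongrightarrow> 0" "\<forall>\<^sub>F k in sequentially. s k > 0"
        using p by (auto simp: filterlim_prod_iff filterlim_nhds_in filterlim_at_right_0_iff z_def[abs_def] s_def[abs_def])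
      have zW: "\<forall>\<^sub>F k in sequentially. z k \<in> W" using topological_tendstoD[OF z(1) W] .
      define b where "b k = \<pi> (\<Phi> (z k))" for k
      define b' where "b' k = b k + s k *\<^sub>R g" for k
      have blim: "b \<longlonglongrightarrow> u" unfolding b_def by (rule proj_lim[OF z(1)])
      have b'lim: "b' \<longlonglongrightarrow> u"
        unfolding b'_def using tendsto_add[OF blim tendsto_scaleR[OF s(1) tendsto_const[of g]]] by simp
      have bU: "\<forall>\<^sub>F k in sequentially. b k \<in> U"
        using z(2) zW unfolding b_def by eventually_elim (use chart in blast)
      obtain T where T: "open T" "U = K \<inter> T" using U by (auto simp: openin_open)
      have b'U: "\<forall>\<^sub>F k in sequentially. b' k \<in> U"
      proof -
        have "\<forall>\<^sub>F k in sequentially. b' k \<in> T" using topological_tendstoD[OF b'lim T(1)] u(1) T(2) by blast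
        with bU show ?thesis
          by eventually_elim (simp add: T(2), simp add: b'_def subspace_add subspace_scale K gK)
      qed
      have bq: "(\<lambda>k. (b' k - b k) /\<^sub>R s k) \<longlonglongrightarrow> g"
        by (rule Lim_transform_eventually[OF tendsto_const]) (use s(2) in eventually_elim, simp add: b'_def)
      have fq: "(\<lambda>k. (f (b' k) - f (b k)) /\<^sub>R s k) \<longlonglongrightarrow> A g"
        by (rule strict_derivative_quotient[OF A bU blim b'U b'lim s(2) bq])
      define w where "w k = b k + f (b k)" for k
      define w' where "w' k = b' k + f (b' k)" for k
      have wq: "(\<lambda>k. (w' k - w k) /\<^sub>R s k) \<longlonglongrightarrow> P h"
        using tendsto_add[OF bq fq] unfolding Ph w_def w'_def
        by (simp add: scaleR_add_right[symmetric] add_diff_add del: scaleR_add_right)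
      have weq: "\<forall>\<^sub>F k in sequentially. w k = \<Phi> (z k)"
        using z(2) zW unfolding w_def b_def by eventually_elim (metis chart)
      have wlim: "w \<longlonglongrightarrow> \<Phi> z0"
        by (rule Lim_transform_eventually[OF isCont_tendsto_compose[OF cont\<Phi> z(1)]]) (use weq in eventually_elim, simp)
      have "(\<lambda>k. w k + s k *\<^sub>R ((w' k - w k) /\<^sub>R s k)) \<longlonglongrightarrow> \<Phi> z0 + 0 *\<^sub>R P h"
        by (intro tendsto_intros wlim s wq)
      then have w_step: "(\<lambda>k. w k + s k *\<^sub>R ((w' k - w k) /\<^sub>R s k)) \<longlonglongrightarrow> \<Phi> z0"
        by (simp only: scaleR_zero_left add_0_right)
      have w'lim: "w' \<longlonglongrightarrow> \<Phi> z0"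
        by (rule Lim_transform_eventually[OF w_step]) (use s(2) in eventually_elim, simp)
      have wW: "\<forall>\<^sub>F k in sequentially. w k \<in> \<Phi> ` W" "\<forall>\<^sub>F k in sequentially. w' k \<in> \<Phi> ` W"
        unfolding w_def w'_def
        by (rule eventually_mono[OF bU], use chart' in blast, rule eventually_mono[OF b'U], use chart' in blast)
      have \<Psi>q: "(\<lambda>k. (\<Psi> (w' k) - \<Psi> (w k)) /\<^sub>R s k) \<longlonglongrightarrow> h"
        using strict_derivative_quotient[OF Q(1) wW(1) wlim wW(2) w'lim s(2) wq] by (simp add: QP)
      show "\<exists>v. (\<forall>\<^sub>F k in sequentially. v k \<in> ?S (p k)) \<and> v \<longlonglongrightarrow> h"
      proof (intro exI conjI)
        show "(\<lambda>k. (\<Psi> (w' k) - \<Psi> (w k)) /\<^sub>R s k) \<longlonglongrightarrow> h" by (rule \<Psi>q)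
        show "\<forall>\<^sub>F k in sequentially. (\<Psi> (w' k) - \<Psi> (w k)) /\<^sub>R s k \<in> ?S (p k)"
          using s(2) b'U weq zW
        proof eventually_elim
          case (elim k)
          have "z k + s k *\<^sub>R ((\<Psi> (w' k) - \<Psi> (w k)) /\<^sub>R s k) = \<Psi> (w' k)"
            using elim by (simp add: \<Psi>\<Phi>)
          moreover have "\<Psi> (w' k) \<in> \<Omega>" using chart'[OF elim(2)] by (simp add: w'_def)
          ultimately have "(\<Psi> (w' k) - \<Psi> (w k)) /\<^sub>R s k \<in> diff_quot_set \<Omega> (z k) (s k)"
            using elim by (simp add: diff_quot_set_iff)
          then show ?case by (simp add: z_def s_def split_beta)
        qed
      qed
    qed
  qed
  moreover have "inner_limit ?S ?F \<subseteq> outer_limit ?S ?F"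
    by (rule inner_limit_subset_outer_limit[of "\<lambda>k. (z0, inv_nat k)"])
      (use inv_nat_at_right z0\<Omega> in \<open>simp add: filterlim_prod_iff filterlim_nhds_in\<close>)
  ultimately show ?thesis
    by (simp add: strictly_proto_differentiable_def set_limit_exists_def \<Omega>_def z0_def)
qed

section \<open>Tangent cones of Lipschitz manifolds\<close>

lemma norm_scaled_le_iff:
  assumes "0 < t" shows "norm (x /\<^sub>R t) \<le> c \<longleftrightarrow> norm (x::'a::real_normed_vector) \<le> c * t"
  using assms by (simp add: divide_inverse_commute[symmetric] pos_divide_le_eq)

lemma norm_scaled_ge_iff:
  assumes "0 < t" shows "c \<le> norm (x /\<^sub>R t) \<longleftrightarrow> c * t \<le> norm (x::'a::real_normed_vector)"
  using assms by (simp add: divide_inverse_commute[symmetric] pos_le_divide_eq)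

text \<open>Near \<open>G w0\<close> the set \<open>\<Omega>\<close> is a Lipschitz manifold: the image of a Lipschitz map \<open>G\<close> with a linear left inverse \<open>E\<close>.
Such a map is a graph over its parameter domain up to a linear change of coordinates, and everything that the theorem
speaks of can be expressed by \<open>G\<close> and its derivatives.\<close>

locale lipschitz_chart =
  fixes \<Omega> W :: "'b::euclidean_space set" and V :: "'a::euclidean_space set" and G :: "'a \<Rightarrow> 'b" and E :: "'b \<Rightarrow> 'a"
    and w0 :: 'a and C :: real
  assumes open_W: "open W" and open_V: "open V" and w0: "w0 \<in> V" and linear_E: "linear E"
    and EG: "\<And>w. w \<in> V \<Longrightarrow> E (G w) = w" and lip: "C-lipschitz_on V G" and chart: "\<Omega> \<inter> W = G ` V"
begin

lemma bl_E: "bounded_linear E" using linear_E by (simp add: linear_conv_bounded_linear)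

lemma C_nonneg: "C \<ge> 0" using lip by (rule lipschitz_on_nonneg)

lemma lipG: "u \<in> V \<Longrightarrow> v \<in> V \<Longrightarrow> norm (G u - G v) \<le> C * norm (u - v)"
  using lipschitz_onD[OF lip, of u v] by (simp add: dist_norm)

lemma G_in: "w \<in> V \<Longrightarrow> G w \<in> \<Omega>" "w \<in> V \<Longrightarrow> G w \<in> W"
  using chart by blast+

lemma isCont_G: "w \<in> V \<Longrightarrow> isCont G w"
  using lipschitz_on_continuous_on[OF lip] open_V by (simp add: continuous_on_eq_continuous_at)

lemma chart_point: "z \<in> \<Omega> \<Longrightarrow> z \<in> W \<Longrightarrow> E z \<in> V \<and> G (E z) = z"
  using chart EG by (metis IntI imageE)

lemma eventually_chart:
  assumes "z \<longlonglongrightarrow> G w" "w \<in> V" "\<forall>\<^sub>F k in sequentially. z k \<in> \<Omega>"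
  shows "\<forall>\<^sub>F k in sequentially. E (z k) \<in> V \<and> G (E (z k)) = z k" "(\<lambda>k. E (z k)) \<longlonglongrightarrow> w"
proof -
  have "\<forall>\<^sub>F k in sequentially. z k \<in> W"
    using topological_tendstoD[OF assms(1) open_W] G_in(2)[OF assms(2)] .
  with assms(3) show "\<forall>\<^sub>F k in sequentially. E (z k) \<in> V \<and> G (E (z k)) = z k"
    by eventually_elim (rule chart_point)
  show "(\<lambda>k. E (z k)) \<longlonglongrightarrow> w"
    using bounded_linear.tendsto[OF bl_E assms(1)] EG[OF assms(2)] by simp
qed

lemma tangentI:
  assumes w: "w \<in> V" and t: "\<forall>\<^sub>F k in sequentially. 0 < t k" "t \<longlonglongrightarrow> 0"
    and u: "\<forall>\<^sub>F k in sequentially. u k \<in> V" and lim: "(\<lambda>k. (G (u k) - G w) /\<^sub>R t k) \<longlonglongrightarrow> h"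
  shows "h \<in> tangent_cone \<Omega> (G w)"
  unfolding tangent_cone_def
proof (rule outer_limitI[OF _ _ lim])
  show "filterlim t (at_right 0) sequentially" using t by (simp add: filterlim_at_right_0_iff)
  show "\<forall>\<^sub>F k in sequentially. (G (u k) - G w) /\<^sub>R t k \<in> diff_quot_set \<Omega> (G w) (t k)"
    using t(1) u by eventually_elim (simp add: diff_quot_set_iff G_in)
qed

lemma tangentE:
  assumes w: "w \<in> V" and h: "h \<in> tangent_cone \<Omega> (G w)"
  obtains t u where "\<forall>\<^sub>F k in sequentially. 0 < t k" "t \<longlonglongrightarrow> 0" "\<forall>\<^sub>F k in sequentially. u k \<in> V" "u \<longlonglongrightarrow> w"
    "(\<lambda>k. (G (u k) - G w) /\<^sub>R t k) \<longlonglongrightarrow> h" "(\<lambda>k. (u k - w) /\<^sub>R t k) \<longlonglongrightarrow> E h"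
proof -
  obtain t v where t: "t \<longlonglongrightarrow> 0" "\<forall>\<^sub>F k in sequentially. t k > 0"
    and v: "\<And>k. v k \<in> diff_quot_set \<Omega> (G w) (t k)" "v \<longlonglongrightarrow> h"
    using h by (auto simp: tangent_cone_def outer_limit_def filterlim_at_right_0_iff)
  define z where "z k = G w + t k *\<^sub>R v k" for k
  have z: "z \<longlonglongrightarrow> G w" unfolding z_def using tendsto_add[OF tendsto_const tendsto_scaleR[OF t(1) v(2)]] by simp
  have z\<Omega>: "\<forall>\<^sub>F k in sequentially. z k \<in> \<Omega>"
    using t(2)
  proof eventually_elim
    case (elim k)
    then show ?case using v(1)[of k] by (simp add: z_def diff_quot_set_iff)
  qed
  note ev = eventually_chart[OF z w z\<Omega>]
  show ?thesis
  proof (rule that[OF t(2,1) _ ev(2)])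
    show "\<forall>\<^sub>F k in sequentially. E (z k) \<in> V" using ev(1) by eventually_elim simp
    show "(\<lambda>k. (G (E (z k)) - G w) /\<^sub>R t k) \<longlonglongrightarrow> h"
      by (rule Lim_transform_eventually[OF v(2)]) (use ev(1) t(2) in eventually_elim, simp add: z_def)
    show "(\<lambda>k. (E (z k) - w) /\<^sub>R t k) \<longlonglongrightarrow> E h"
      by (rule Lim_transform_eventually[OF bounded_linear.tendsto[OF bl_E v(2)]])
        (use t(2) in eventually_elim, simp add: z_def linear_add[OF linear_E] linear_scale[OF linear_E] EG[OF w])
  qed
qed

text \<open>Compactness: difference quotients of \<open>G\<close> are bounded whenever those of the parameters are.\<close>

lemma convergent_quotient:
  fixes t :: "nat \<Rightarrow> real"
  assumes u: "\<And>k. u k \<in> V" and v: "\<And>k. v k \<in> V" and t: "\<And>k. 0 < t k" and b: "\<And>k. norm (v k - u k) \<le> B * t k"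
  obtains h r where "strict_mono (r::nat \<Rightarrow> nat)" "(\<lambda>k. (G (v (r k)) - G (u (r k))) /\<^sub>R t (r k)) \<longlonglongrightarrow> h"
    "(\<lambda>k. (v (r k) - u (r k)) /\<^sub>R t (r k)) \<longlonglongrightarrow> E h"
proof -
  have "norm ((G (v k) - G (u k)) /\<^sub>R t k) \<le> C * B" for k
  proof -
    have "norm (G (v k) - G (u k)) \<le> C * norm (v k - u k)" by (rule lipG[OF v u])
    also have "\<dots> \<le> C * (B * t k)" by (intro mult_left_mono b C_nonneg)
    finally show ?thesis unfolding norm_scaled_le_iff[OF t] by (simp only: mult.assoc)
  qed
  then have "bounded (range (\<lambda>k. (G (v k) - G (u k)) /\<^sub>R t k))" by (auto simp: bounded_iff)
  from bounded_imp_convergent_subsequence[OF this]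
  obtain h r where r: "strict_mono r" "((\<lambda>k. (G (v k) - G (u k)) /\<^sub>R t k) \<circ> r) \<longlonglongrightarrow> h" by blast
  then have lim: "(\<lambda>k. (G (v (r k)) - G (u (r k))) /\<^sub>R t (r k)) \<longlonglongrightarrow> h" by (simp add: o_def)
  have "E ((G (v k) - G (u k)) /\<^sub>R t k) = (v k - u k) /\<^sub>R t k" for k
    by (simp only: linear_scale[OF linear_E] linear_diff[OF linear_E] EG u v)
  with bounded_linear.tendsto[OF bl_E lim] show ?thesis using that[OF r(1) lim] by simp
qed

text \<open>Every direction in the parameter space is the image under \<open>E\<close> of a tangent vector whose norm is controlled by the
Lipschitz constant. The explicit difference quotients are kept because strict derivatives are compared with
them later.\<close>

lemma tangent_direction:
  assumes w: "w \<in> V"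
  obtains h t where "h \<in> tangent_cone \<Omega> (G w)" "E h = a" "norm h \<le> C * norm a"
    "(\<lambda>k. (G (w + t k *\<^sub>R a) - G w) /\<^sub>R t k) \<longlonglongrightarrow> h" "\<forall>k. 0 < t k" "t \<longlonglongrightarrow> (0::real)"
proof -
  obtain d where d: "d > 0" "ball w d \<subseteq> V" using w open_V open_contains_ball by blast
  define c where "c = d / (norm a + 1)"
  have c: "c > 0" using d(1) by (simp add: c_def add_nonneg_pos)
  define t where "t k = c * inv_nat k" for k
  have t: "t k > 0" for k using c by (simp add: t_def)
  have tlim: "t \<longlonglongrightarrow> 0" unfolding t_def using tendsto_mult_right_zero[OF LIMSEQ_inverse_real_of_nat] .
  have inV: "w + t k *\<^sub>R a \<in> V" for k
  proof -
    have "t k \<le> c" using c mult_left_mono[of "inv_nat k" 1 c] by (simp add: t_def inverse_le_1_iff)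
    then have "t k * norm a \<le> c * norm a" by (intro mult_right_mono) auto
    also have "\<dots> < c * (norm a + 1)" using c by simp
    also have "\<dots> = d" by (simp add: c_def add_nonneg_eq_0_iff)
    finally have "w + t k *\<^sub>R a \<in> ball w d" using t[of k] by (simp add: dist_norm)
    then show ?thesis using d by blast
  qed
  obtain h r where r: "strict_mono r" and lim: "(\<lambda>k. (G (w + t (r k) *\<^sub>R a) - G w) /\<^sub>R t (r k)) \<longlonglongrightarrow> h"
    "(\<lambda>k. (w + t (r k) *\<^sub>R a - w) /\<^sub>R t (r k)) \<longlonglongrightarrow> E h"
    by (rule convergent_quotient[of "\<lambda>_. w" "\<lambda>k. w + t k *\<^sub>R a" t "norm a"]) (use w inV t in \<open>auto simp: less_imp_le\<close>)
  have tr: "(\<lambda>k. t (r k)) \<longlonglongrightarrow> 0" using LIMSEQ_subseq_LIMSEQ[OF tlim r] by (simp add: o_def)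
  have "(\<lambda>k. (w + t (r k) *\<^sub>R a - w) /\<^sub>R t (r k)) = (\<lambda>k. a)" using t by (auto simp: less_imp_neq[symmetric])
  with lim(2) have Eh: "E h = a" by (simp add: LIMSEQ_const_iff)
  have "norm ((G (w + t (r k) *\<^sub>R a) - G w) /\<^sub>R t (r k)) \<le> C * norm a" for k
    unfolding norm_scaled_le_iff[OF t] using lipG[OF inV[of "r k"] w] t[of "r k"] by (simp add: mult_ac)
  then have "norm h \<le> C * norm a"
    by (intro Lim_norm_ubound[OF sequentially_bot lim(1)] always_eventually) auto
  moreover have "h \<in> tangent_cone \<Omega> (G w)"
    by (rule tangentI[OF w _ tr _ lim(1)]) (use t inV in auto)
  ultimately show ?thesis using that[OF _ Eh _ lim(1) _ tr] t by simp
qed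

lemma derivative_right_inverse:
  assumes w: "w \<in> V" and D: "(G has_derivative D) (at w)"
  shows "E (D a) = a"
proof -
  have "((\<lambda>w. E (G w)) has_derivative (\<lambda>a. E (D a))) (at w)"
    by (rule bounded_linear.has_derivative[OF bl_E D])
  moreover have "((\<lambda>w. E (G w)) has_derivative (\<lambda>a. a)) (at w)"
    by (rule has_derivative_transform_within_open[OF has_derivative_ident open_V w]) (simp add: EG)
  ultimately have "(\<lambda>a. E (D a)) = (\<lambda>a. a)" by (rule has_derivative_unique)
  then show ?thesis by (rule fun_cong)
qed

lemma derivative_quotient:
  assumes D: "(G has_derivative D) (at w)" and t: "\<forall>\<^sub>F k in sequentially. 0 < (t k::real)"
    and u: "u \<longlonglongrightarrow> w" "(\<lambda>k. (u k - w) /\<^sub>R t k) \<longlonglongrightarrow> a"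
  shows "(\<lambda>k. (G (u k) - G w) /\<^sub>R t k) \<longlonglongrightarrow> D a"
proof (rule linearization_quotient[OF has_derivative_bounded_linear[OF D] t u(2)])
  fix e :: real assume "e > 0"
  then obtain d where d: "d > 0" "\<And>y. norm (y - w) < d \<Longrightarrow> norm (G y - G w - D (y - w)) \<le> e * norm (y - w)"
    using D unfolding has_derivative_at_alt by blast
  have "\<forall>\<^sub>F k in sequentially. dist (u k) w < d" using tendstoD[OF u(1) d(1)] .
  then show "\<forall>\<^sub>F k in sequentially. norm (G (u k) - G w - D (u k - w)) \<le> e * norm (u k - w)"
    by eventually_elim (rule d(2), simp add: dist_norm)
qed

lemma tangent_cone_derivative:
  assumes w: "w \<in> V" and D: "(G has_derivative D) (at w)"
  shows "tangent_cone \<Omega> (G w) = range D"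
proof
  show "tangent_cone \<Omega> (G w) \<subseteq> range D"
  proof
    fix h assume "h \<in> tangent_cone \<Omega> (G w)"
    with w obtain t u where t: "\<forall>\<^sub>F k in sequentially. 0 < t k" and u: "u \<longlonglongrightarrow> w"
      "(\<lambda>k. (G (u k) - G w) /\<^sub>R t k) \<longlonglongrightarrow> h" "(\<lambda>k. (u k - w) /\<^sub>R t k) \<longlonglongrightarrow> E h"
      by (rule tangentE)
    have "h = D (E h)" using derivative_quotient[OF D t u(1,3)] u(2) LIMSEQ_unique by blast
    then show "h \<in> range D" by blast
  qed
  show "range D \<subseteq> tangent_cone \<Omega> (G w)"
  proof safe
    fix a
    obtain h t where "h \<in> tangent_cone \<Omega> (G w)" "E h = a" "norm h \<le> C * norm a"
      "(\<lambda>k. (G (w + t k *\<^sub>R a) - G w) /\<^sub>R t k) \<longlonglongrightarrow> h" "\<forall>k. 0 < t k" "t \<longlonglongrightarrow> (0::real)"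
      using tangent_direction[OF w, of a] .
    note h = this(1,4-6)
    have "(\<lambda>k. w + t k *\<^sub>R a) \<longlonglongrightarrow> w" using tendsto_add[OF tendsto_const tendsto_scaleR[OF h(4) tendsto_const]] by simp
    moreover have "(\<lambda>k. (w + t k *\<^sub>R a - w) /\<^sub>R t k) \<longlonglongrightarrow> a"
      using h(3) by (simp add: less_imp_neq[symmetric])
    ultimately have "(\<lambda>k. (G (w + t k *\<^sub>R a) - G w) /\<^sub>R t k) \<longlonglongrightarrow> D a"
      using h(3) by (intro derivative_quotient[OF D]) auto
    with h(2) have "h = D a" by (rule LIMSEQ_unique)
    then show "D a \<in> tangent_cone \<Omega> (G w)" using h(1) by simp
  qed
qed

text \<open>Since \<open>E\<close> maps the tangent cone onto the parameter space, a tangent cone that is a subspace of the same dimension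
is the graph of a linear map \<open>D\<close> over it. If \<open>D\<close> were not the derivative, a sequence of
difference quotients that stays away from \<open>D\<close> would have a cluster point, that is, a tangent vector off the graph.\<close>

lemma derivative_if_tangent_subspace:
  assumes w: "w \<in> V" and T: "subspace (tangent_cone \<Omega> (G w))" "dim (tangent_cone \<Omega> (G w)) = DIM('a)"
  shows "\<exists>D. (G has_derivative D) (at w)"
proof -
  define T where "T = tangent_cone \<Omega> (G w)"
  have sT: "subspace T" and dT: "dim T = DIM('a)" using assms by (auto simp: T_def)
  have surj: "E ` T = UNIV"
  proof (rule UNIV_eq_I[symmetric])
    fix a
    obtain h t where "h \<in> tangent_cone \<Omega> (G w)" "E h = a" "norm h \<le> C * norm a"
      "(\<lambda>k. (G (w + t k *\<^sub>R a) - G w) /\<^sub>R t k) \<longlonglongrightarrow> h" "\<forall>k. 0 < t k" "t \<longlonglongrightarrow> (0::real)"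
      using tangent_direction[OF w, of a] .
    then have "h \<in> T" "E h = a" by (simp_all add: T_def)
    then show "a \<in> E ` T" by blast
  qed
  obtain D where D: "linear D" "range D \<subseteq> T" "\<And>x. E (D x) = x"
    using linear_exists_right_inverse_on[OF linear_E sT] unfolding surj by blast
  have "inj D" using D(3) by (rule inj_on_inverseI)
  then have "dim (range D) = DIM('a)" by (simp add: dim_image_eq[OF D(1)])
  then have "range D = T"
    using subspace_dim_equal[OF linear_subspace_image[OF D(1) subspace_UNIV] sT D(2)] dT by simp
  then have TD: "h = D (E h)" if "h \<in> T" for h
    using that D(3) by auto
  have blD: "bounded_linear D" using D(1) by (simp add: linear_conv_bounded_linear)
  have "(G has_derivative D) (at w)"
    unfolding has_derivative_at_alt
  proof (intro conjI allI impI blD, rule ccontr)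
    fix e :: real assume e: "e > 0" and neg: "\<not> (\<exists>d>0. \<forall>y. norm (y - w) < d \<longrightarrow> norm (G y - G w - D (y - w)) \<le> e * norm (y - w))"
    obtain d where d: "d > 0" "ball w d \<subseteq> V" using w open_V open_contains_ball by blast
    have "\<exists>y. norm (y - w) < min d (inv_nat k) \<and> norm (G y - G w - D (y - w)) > e * norm (y - w)" for k
    proof -
      have "min d (inv_nat k) > 0" using d(1) by simp
      then show ?thesis using neg by (metis not_le)
    qed
    then obtain u where u: "\<And>k. norm (u k - w) < min d (inv_nat k)" "\<And>k. norm (G (u k) - G w - D (u k - w)) > e * norm (u k - w)"
      by metis
    define t where "t k = norm (u k - w)" for k
    have t: "t k > 0" for k using u(2)[of k] linear_0[OF D(1)] by (auto simp: t_def)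
    have "t \<longlonglongrightarrow> 0"
      by (rule tendsto_sandwich[OF _ _ tendsto_const LIMSEQ_inverse_real_of_nat])
        (use u(1) in \<open>auto simp: t_def intro!: always_eventually less_imp_le\<close>)
    have uV: "u k \<in> V" for k using u(1)[of k] d(2) by (auto simp: dist_norm norm_minus_commute)
    obtain h r where r: "strict_mono r" "(\<lambda>k. (G (u (r k)) - G w) /\<^sub>R t (r k)) \<longlonglongrightarrow> h" "(\<lambda>k. (u (r k) - w) /\<^sub>R t (r k)) \<longlonglongrightarrow> E h"
      by (rule convergent_quotient[of "\<lambda>_. w" u t 1]) (use w uV t in \<open>auto simp: t_def\<close>)
    have "(\<lambda>k. t (r k)) \<longlonglongrightarrow> 0" using LIMSEQ_subseq_LIMSEQ[OF \<open>t \<longlonglongrightarrow> 0\<close> r(1)] by (simp add: o_def)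
    then have "h \<in> T" unfolding T_def
      by (intro tangentI[OF w _ _ _ r(2)]) (use t uV in auto)
    have "(\<lambda>k. (G (u (r k)) - G w) /\<^sub>R t (r k) - D ((u (r k) - w) /\<^sub>R t (r k))) \<longlonglongrightarrow> h - D (E h)"
      by (intro tendsto_diff r(2) bounded_linear.tendsto[OF blD r(3)])
    then have "(\<lambda>k. norm ((G (u (r k)) - G w) /\<^sub>R t (r k) - D ((u (r k) - w) /\<^sub>R t (r k)))) \<longlonglongrightarrow> 0"
      using TD[OF \<open>h \<in> T\<close>] by (simp add: tendsto_norm_zero)
    moreover have "norm ((G (u k) - G w) /\<^sub>R t k - D ((u k - w) /\<^sub>R t k)) \<ge> e" for k
    proof -
      have "(G (u k) - G w) /\<^sub>R t k - D ((u k - w) /\<^sub>R t k) = (G (u k) - G w - D (u k - w)) /\<^sub>R t k"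
        by (subst linear_scale[OF D(1)]) (simp add: scaleR_diff_right)
      then show ?thesis using u(2)[of k] t[of k] by (simp only: norm_scaled_ge_iff) (simp add: t_def)
    qed
    ultimately have "e \<le> 0" by (intro tendsto_lowerbound[of _ 0 sequentially]) auto
    with e show False by simp
  qed
  then show ?thesis by blast
qed

lemma strict_derivative_at_base:
  "strict_derivative V G H w0 \<Longrightarrow> (G has_derivative H) (at w0)"
  by (rule strict_derivative_imp_has_derivative[OF _ open_V w0])

end

context lipschitz_chart
begin

section \<open>Strict differentiability of the parametrization\<close>

text \<open>Existence of the limit in strict proto-differentiability says that a tangent vector over \<open>a\<close>, found at one sequence of base points
and step sizes, is the limit of the quotients in direction \<open>a\<close> for all such sequences (fact \<open>star\<close>). So the
limits define a map \<open>H\<close>. Additivity of \<open>H\<close> follows by letting the base point itself move in direction \<open>a\<close>, and the uniformity in the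
direction that strict differentiability demands follows from compactness.\<close>

lemma strict_if_strictly_proto:
  assumes "set_limit_exists (\<lambda>(z, t). diff_quot_set \<Omega> z t) (nhds_in \<Omega> (G w0) \<times>\<^sub>F at_right (0::real))"
  shows "\<exists>H. strict_derivative V G H w0"
proof -
  let ?S = "\<lambda>(z, t). diff_quot_set \<Omega> z t" and ?F = "nhds_in \<Omega> (G w0) \<times>\<^sub>F at_right (0::real)"
  define O' where "O' = outer_limit ?S ?F"
  have inner: "O' = inner_limit ?S ?F" using assms by (simp add: set_limit_exists_def O'_def)
  have star: "(\<lambda>k. (G (u k + t k *\<^sub>R E h) - G (u k)) /\<^sub>R t k) \<longlonglongrightarrow> h"
    if h: "h \<in> O'" and u: "\<forall>\<^sub>F k in sequentially. u k \<in> V" "u \<longlonglongrightarrow> w0"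
      and t: "\<forall>\<^sub>F k in sequentially. 0 < t k" "t \<longlonglongrightarrow> 0" for h u t
  proof -
    have Gu: "(\<lambda>k. G (u k)) \<longlonglongrightarrow> G w0" by (rule isCont_tendsto_compose[OF isCont_G[OF w0] u(2)])
    have "filterlim (\<lambda>k. (G (u k), t k)) ?F sequentially"
      using Gu u(1) t by (auto simp: filterlim_prod_iff filterlim_nhds_in filterlim_at_right_0_iff elim!: eventually_mono intro: G_in)
    then obtain v where v: "\<forall>\<^sub>F k in sequentially. v k \<in> ?S (G (u k), t k)" "v \<longlonglongrightarrow> h"
      using h unfolding inner inner_limit_def by blast
    define z where "z k = G (u k) + t k *\<^sub>R v k" for k
    have z: "z \<longlonglongrightarrow> G w0" unfolding z_def using tendsto_add[OF Gu tendsto_scaleR[OF t(2) v(2)]] by simp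
    have z\<Omega>: "\<forall>\<^sub>F k in sequentially. z k \<in> \<Omega>"
      using v(1) t(1) by eventually_elim (simp add: z_def diff_quot_set_iff)
    note ev = eventually_chart[OF z w0 z\<Omega>]
    define y where "y k = u k + t k *\<^sub>R E h" for k
    have y: "y \<longlonglongrightarrow> w0" unfolding y_def using tendsto_add[OF u(2) tendsto_scaleR[OF t(2) tendsto_const]] by simp
    have yV: "\<forall>\<^sub>F k in sequentially. y k \<in> V" using topological_tendstoD[OF y open_V w0] .
    have "(\<lambda>k. C * norm (E h - E (v k))) \<longlonglongrightarrow> C * norm (E h - E h)"
      by (intro tendsto_intros bounded_linear.tendsto[OF bl_E v(2)])
    then have lim0: "(\<lambda>k. C * norm (E h - E (v k))) \<longlonglongrightarrow> 0" by simp
    have "(\<lambda>k. (G (y k) - z k) /\<^sub>R t k) \<longlonglongrightarrow> 0"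
    proof (rule Lim_null_comparison[OF _ lim0])
      show "\<forall>\<^sub>F k in sequentially. norm ((G (y k) - z k) /\<^sub>R t k) \<le> C * norm (E h - E (v k))"
        using ev(1) yV t(1) u(1)
      proof eventually_elim
        case (elim k)
        have "y k - E (z k) = t k *\<^sub>R (E h - E (v k))"
          using elim by (simp add: y_def z_def linear_add[OF linear_E] linear_scale[OF linear_E] EG scaleR_diff_right)
        then have "norm (G (y k) - z k) \<le> C * (t k * norm (E h - E (v k)))"
          using lipG[of "y k" "E (z k)"] elim by simp
        then show ?case unfolding norm_scaled_le_iff[OF elim(3)] by (simp only: mult_ac)
      qed
    qed
    from tendsto_add[OF v(2) this] have "(\<lambda>k. v k + (G (y k) - z k) /\<^sub>R t k) \<longlonglongrightarrow> h" by simp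
    then have "(\<lambda>k. (G (y k) - G (u k)) /\<^sub>R t k) \<longlonglongrightarrow> h"
    proof (rule Lim_transform_eventually)
      show "\<forall>\<^sub>F k in sequentially. v k + (G (y k) - z k) /\<^sub>R t k = (G (y k) - G (u k)) /\<^sub>R t k"
        using t(1) by eventually_elim (simp add: z_def scaleR_diff_right scaleR_add_right)
    qed
    then show ?thesis by (simp add: y_def)
  qed
  have "\<exists>h\<in>O'. E h = a" for a
  proof -
    obtain h t where h: "h \<in> tangent_cone \<Omega> (G w0)" "E h = a" "norm h \<le> C * norm a"
      "(\<lambda>k. (G (w0 + t k *\<^sub>R a) - G w0) /\<^sub>R t k) \<longlonglongrightarrow> h" "\<forall>k. 0 < t k" "t \<longlonglongrightarrow> (0::real)"
      using tangent_direction[OF w0, of a] .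
    have "(\<lambda>k. w0 + t k *\<^sub>R a) \<longlonglongrightarrow> w0" using tendsto_add[OF tendsto_const tendsto_scaleR[OF h(6) tendsto_const]] by simp
    then have "\<forall>\<^sub>F k in sequentially. w0 + t k *\<^sub>R a \<in> V" using open_V w0 by (rule topological_tendstoD)
    then have "h \<in> O'" unfolding O'_def
    proof (intro outer_limitI[OF _ _ h(4), where p="\<lambda>k. (G w0, t k)"])
      show "filterlim (\<lambda>k. (G w0, t k)) ?F sequentially"
        using h(5,6) G_in[OF w0] by (simp add: filterlim_prod_iff filterlim_nhds_in filterlim_at_right_0_iff)
      assume "\<forall>\<^sub>F k in sequentially. w0 + t k *\<^sub>R a \<in> V"
      then show "\<forall>\<^sub>F k in sequentially. (G (w0 + t k *\<^sub>R a) - G w0) /\<^sub>R t k \<in> (case (G w0, t k) of (z, t) \<Rightarrow> diff_quot_set \<Omega> z t)"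
      proof eventually_elim
        case (elim k)
        have "t k > 0" using h(5) by simp
        then show ?case using elim by (simp add: diff_quot_set_iff G_in)
      qed
    qed
    with h(2) show ?thesis by blast
  qed
  then obtain H where HO: "\<And>a. H a \<in> O'" and EH: "\<And>a. E (H a) = a" by metis
  have star': "(\<lambda>k. (G (u k + t k *\<^sub>R a) - G (u k)) /\<^sub>R t k) \<longlonglongrightarrow> H a"
    if "\<forall>\<^sub>F k in sequentially. u k \<in> V" "u \<longlonglongrightarrow> w0" "\<forall>\<^sub>F k in sequentially. 0 < t k" "t \<longlonglongrightarrow> 0" for a u t
    using star[OF HO that, of a] by (simp add: EH)
  have inv0: "\<forall>\<^sub>F k in sequentially. 0 < inv_nat k" by simp
  have w0k: "\<forall>\<^sub>F k in sequentially. w0 \<in> V" using w0 by simp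
  have add: "H (a + b) = H a + H b" for a b
  proof -
    have uk: "(\<lambda>k. w0 + inv_nat k *\<^sub>R a) \<longlonglongrightarrow> w0"
      using tendsto_add[OF tendsto_const tendsto_scaleR[OF LIMSEQ_inverse_real_of_nat tendsto_const]] by simp
    have ukV: "\<forall>\<^sub>F k in sequentially. w0 + inv_nat k *\<^sub>R a \<in> V" using uk open_V w0 by (rule topological_tendstoD)
    have 1: "(\<lambda>k. (G (w0 + inv_nat k *\<^sub>R a + inv_nat k *\<^sub>R b) - G (w0 + inv_nat k *\<^sub>R a)) /\<^sub>R inv_nat k) \<longlonglongrightarrow> H b"
      by (rule star'[OF ukV uk inv0 LIMSEQ_inverse_real_of_nat])
    have 2: "(\<lambda>k. (G (w0 + inv_nat k *\<^sub>R a) - G w0) /\<^sub>R inv_nat k) \<longlonglongrightarrow> H a"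
      by (rule star'[OF w0k tendsto_const inv0 LIMSEQ_inverse_real_of_nat])
    have 3: "(\<lambda>k. (G (w0 + inv_nat k *\<^sub>R (a + b)) - G w0) /\<^sub>R inv_nat k) \<longlonglongrightarrow> H (a + b)"
      by (rule star'[OF w0k tendsto_const inv0 LIMSEQ_inverse_real_of_nat])
    have "(\<lambda>k. (G (w0 + inv_nat k *\<^sub>R (a + b)) - G w0) /\<^sub>R inv_nat k) \<longlonglongrightarrow> H a + H b"
      using tendsto_add[OF 2 1] unfolding scaleR_add_right[symmetric] add.assoc by simp
    with 3 show ?thesis by (rule LIMSEQ_unique)
  qed
  have H0: "H 0 = 0" using add[of 0 0] by simp
  have pos: "H (c *\<^sub>R a) = c *\<^sub>R H a" if "c > 0" for c a
  proof -
    have "(\<lambda>k. c * inv_nat k) \<longlonglongrightarrow> 0" by (rule tendsto_mult_right_zero[OF LIMSEQ_inverse_real_of_nat])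
    then have "(\<lambda>k. (G (w0 + (c * inv_nat k) *\<^sub>R a) - G w0) /\<^sub>R (c * inv_nat k)) \<longlonglongrightarrow> H a"
      using that by (intro star' w0k) auto
    then have "(\<lambda>k. c *\<^sub>R ((G (w0 + (c * inv_nat k) *\<^sub>R a) - G w0) /\<^sub>R (c * inv_nat k))) \<longlonglongrightarrow> c *\<^sub>R H a"
      by (intro tendsto_intros)
    moreover have "c *\<^sub>R ((G (w0 + (c * inv_nat k) *\<^sub>R a) - G w0) /\<^sub>R (c * inv_nat k)) = (G (w0 + inv_nat k *\<^sub>R (c *\<^sub>R a)) - G w0) /\<^sub>R inv_nat k" for k
      using that by (simp add: mult.commute)
    moreover have "(\<lambda>k. (G (w0 + inv_nat k *\<^sub>R (c *\<^sub>R a)) - G w0) /\<^sub>R inv_nat k) \<longlonglongrightarrow> H (c *\<^sub>R a)"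
      by (rule star'[OF w0k tendsto_const inv0 LIMSEQ_inverse_real_of_nat])
    ultimately show ?thesis using LIMSEQ_unique by (simp only:) blast
  qed
  have "linear H"
  proof (rule linearI)
    fix c :: real and a
    consider "c > 0" | "c = 0" | "c < 0" by linarith
    then show "H (c *\<^sub>R a) = c *\<^sub>R H a"
    proof cases
      case 3
      then have "H ((-c) *\<^sub>R a) = (-c) *\<^sub>R H a" by (intro pos) simp
      moreover have "H (c *\<^sub>R a) + H ((-c) *\<^sub>R a) = 0" using add[of "c *\<^sub>R a" "(-c) *\<^sub>R a"] H0 by simp
      ultimately show ?thesis by (simp add: add_eq_0_iff2)
    qed (use pos H0 in auto)
  qed (rule add)
  then have blH: "bounded_linear H" by (simp add: linear_conv_bounded_linear)
  have "strict_derivative V G H w0"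
    unfolding strict_derivative_def
  proof (intro conjI \<open>linear H\<close> allI impI, rule ccontr)
    fix e :: real assume e: "e > 0"
      and neg: "\<not> (\<exists>d>0. \<forall>u\<in>V \<inter> ball w0 d. \<forall>v\<in>V \<inter> ball w0 d. norm (G v - G u - H (v - u)) \<le> e * norm (v - u))"
    have "\<exists>u v. u \<in> V \<inter> ball w0 (inv_nat k) \<and> v \<in> V \<inter> ball w0 (inv_nat k) \<and> norm (G v - G u - H (v - u)) > e * norm (v - u)" for k
    proof -
      have "inv_nat k > 0" by simp
      with neg show ?thesis by (meson not_le)
    qed
    then obtain u v where u: "\<And>k. u k \<in> V \<inter> ball w0 (inv_nat k)" and v: "\<And>k. v k \<in> V \<inter> ball w0 (inv_nat k)"
      and gt: "\<And>k. norm (G (v k) - G (u k) - H (v k - u k)) > e * norm (v k - u k)" by metis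
    have lim: "x \<longlonglongrightarrow> w0" if "\<And>k. x k \<in> V \<inter> ball w0 (inv_nat k)" for x
      by (rule metric_tendsto_imp_tendsto[OF LIMSEQ_inverse_real_of_nat])
        (use that in \<open>auto simp: dist_commute intro!: always_eventually less_imp_le\<close>)
    have uw: "u \<longlonglongrightarrow> w0" and vw: "v \<longlonglongrightarrow> w0" using lim u v by blast+
    define t where "t k = norm (v k - u k)" for k
    have t: "t k > 0" for k using gt[of k] linear_0[OF \<open>linear H\<close>] by (auto simp: t_def)
    have "t \<longlonglongrightarrow> 0" unfolding t_def using tendsto_norm[OF tendsto_diff[OF vw uw]] by simp
    obtain h r where r: "strict_mono r" "(\<lambda>k. (G (v (r k)) - G (u (r k))) /\<^sub>R t (r k)) \<longlonglongrightarrow> h" "(\<lambda>k. (v (r k) - u (r k)) /\<^sub>R t (r k)) \<longlonglongrightarrow> E h"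
      by (rule convergent_quotient[of u v t 1]) (use u v t in \<open>auto simp: t_def\<close>)
    define a where "a = E h"
    have tr: "(\<lambda>k. t (r k)) \<longlonglongrightarrow> 0" and ur: "(\<lambda>k. u (r k)) \<longlonglongrightarrow> w0"
      using LIMSEQ_subseq_LIMSEQ[OF \<open>t \<longlonglongrightarrow> 0\<close> r(1)] LIMSEQ_subseq_LIMSEQ[OF uw r(1)] by (simp_all add: o_def)
    have q: "(\<lambda>k. (G (u (r k) + t (r k) *\<^sub>R a) - G (u (r k))) /\<^sub>R t (r k)) \<longlonglongrightarrow> H a"
      by (rule star'[OF _ ur _ tr]) (use u t in auto)
    have "(\<lambda>k. u (r k) + t (r k) *\<^sub>R a) \<longlonglongrightarrow> w0" using tendsto_add[OF ur tendsto_scaleR[OF tr tendsto_const]] by simp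
    then have yV: "\<forall>\<^sub>F k in sequentially. u (r k) + t (r k) *\<^sub>R a \<in> V" using open_V w0 by (rule topological_tendstoD)
    have "(\<lambda>k. C * norm ((v (r k) - u (r k)) /\<^sub>R t (r k) - a)) \<longlonglongrightarrow> C * norm (a - a)"
      unfolding a_def by (intro tendsto_intros r(3))
    then have lim0: "(\<lambda>k. C * norm ((v (r k) - u (r k)) /\<^sub>R t (r k) - a)) \<longlonglongrightarrow> 0" by simp
    have "(\<lambda>k. (G (v (r k)) - G (u (r k) + t (r k) *\<^sub>R a)) /\<^sub>R t (r k)) \<longlonglongrightarrow> 0"
    proof (rule Lim_null_comparison[OF _ lim0])
      show "\<forall>\<^sub>F k in sequentially. norm ((G (v (r k)) - G (u (r k) + t (r k) *\<^sub>R a)) /\<^sub>R t (r k)) \<le> C * norm ((v (r k) - u (r k)) /\<^sub>R t (r k) - a)"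
        using yV
      proof eventually_elim
        case (elim k)
        have "norm (G (v (r k)) - G (u (r k) + t (r k) *\<^sub>R a)) \<le> C * norm (v (r k) - (u (r k) + t (r k) *\<^sub>R a))"
          using v[of "r k"] elim by (intro lipG) auto
        also have "v (r k) - (u (r k) + t (r k) *\<^sub>R a) = t (r k) *\<^sub>R ((v (r k) - u (r k)) /\<^sub>R t (r k) - a)"
          using t[of "r k"] by (simp add: scaleR_diff_right less_imp_neq[symmetric])
        finally show ?case unfolding norm_scaled_le_iff[OF t] using t[of "r k"] by (simp add: mult_ac)
      qed
    qed
    from tendsto_add[OF this q] have "(\<lambda>k. (G (v (r k)) - G (u (r k))) /\<^sub>R t (r k)) \<longlonglongrightarrow> H a"
      unfolding scaleR_add_right[symmetric] by simp
    then have "(\<lambda>k. (G (v (r k)) - G (u (r k))) /\<^sub>R t (r k) - H ((v (r k) - u (r k)) /\<^sub>R t (r k))) \<longlonglongrightarrow> H a - H a"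
      unfolding a_def by (intro tendsto_diff bounded_linear.tendsto[OF blH r(3)])
    then have "(\<lambda>k. norm ((G (v (r k)) - G (u (r k))) /\<^sub>R t (r k) - H ((v (r k) - u (r k)) /\<^sub>R t (r k)))) \<longlonglongrightarrow> 0"
      using tendsto_norm_zero by simp
    moreover have "norm ((G (v k) - G (u k)) /\<^sub>R t k - H ((v k - u k) /\<^sub>R t k)) \<ge> e" for k
    proof -
      have "(G (v k) - G (u k)) /\<^sub>R t k - H ((v k - u k) /\<^sub>R t k) = (G (v k) - G (u k) - H (v k - u k)) /\<^sub>R t k"
        by (subst linear_scale[OF \<open>linear H\<close>]) (simp add: scaleR_diff_right)
      then show ?thesis using gt[of k] t[of k] by (simp only: norm_scaled_ge_iff) (simp add: t_def)
    qed
    ultimately have "e \<le> 0" by (intro tendsto_lowerbound[of _ 0 sequentially]) auto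
    with e show False by simp
  qed
  then show ?thesis by blast
qed

text \<open>The Bouligand derivative of \<open>G\<close> at \<open>w0\<close>: limits of derivatives at nearby points of differentiability.\<close>

definition cluster_derivatives :: "('a \<Rightarrow>\<^sub>L 'b) set" where
  "cluster_derivatives = {D. \<exists>wk Dk. (\<forall>k. wk k \<in> V \<and> (G has_derivative blinfun_apply (Dk k)) (at (wk k))) \<and>
     wk \<longlonglongrightarrow> w0 \<and> Dk \<longlonglongrightarrow> D}"

lemma derivative_norm_le:
  assumes w: "w \<in> V" and D: "(G has_derivative blinfun_apply D) (at w)"
  shows "norm D \<le> C"
proof (rule norm_blinfun_bound[OF C_nonneg])
  fix a
  obtain h t where h: "h \<in> tangent_cone \<Omega> (G w)" "E h = a" "norm h \<le> C * norm a"
      "(\<lambda>k. (G (w + t k *\<^sub>R a) - G w) /\<^sub>R t k) \<longlonglongrightarrow> h" "\<forall>k. 0 < t k" "t \<longlonglongrightarrow> (0::real)"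
    using tangent_direction[OF w, of a] .
  obtain b where b: "h = blinfun_apply D b" using h(1) tangent_cone_derivative[OF w D] by blast
  then have "b = a" using derivative_right_inverse[OF w D, of b] h(2) by simp
  then show "norm (blinfun_apply D a) \<le> C * norm a" using h(3) b by simp
qed

lemma cluster_subsequence:
  assumes w: "\<And>k. wk k \<in> V" "\<And>k. (G has_derivative blinfun_apply (Dk k)) (at (wk k))" and lim: "wk \<longlonglongrightarrow> w0"
  obtains D r where "D \<in> cluster_derivatives" "strict_mono (r::nat \<Rightarrow> nat)" "(\<lambda>k. Dk (r k)) \<longlonglongrightarrow> D"
proof -
  have "bounded (range Dk)" using derivative_norm_le[OF w] by (auto simp: bounded_iff)
  from bounded_imp_convergent_subsequence[OF this]
  obtain D r where r: "strict_mono r" "(Dk \<circ> r) \<longlonglongrightarrow> D" by blast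
  have "D \<in> cluster_derivatives"
    unfolding cluster_derivatives_def
    using w LIMSEQ_subseq_LIMSEQ[OF lim r(1)] r(2)
    by (intro CollectI exI[of _ "wk \<circ> r"] exI[of _ "Dk \<circ> r"]) auto
  then show ?thesis using that r by (simp add: o_def)
qed

text \<open>The theorem of Rademacher speaks of maps on the whole space. Composing \<open>G\<close> with the projection onto a
closed ball produces such a map without changing \<open>G\<close> on the ball.\<close>

lemma lipschitz_extension_near:
  obtains d g where "d > 0" "ball w0 d \<subseteq> V" "C-lipschitz_on UNIV g" "\<forall>w\<in>ball w0 d. g w = G w"
    "\<forall>w\<in>ball w0 d. \<forall>D. (g has_derivative D) (at w) \<longleftrightarrow> (G has_derivative D) (at w)"
proof -
  obtain d where d: "d > 0" "cball w0 d \<subseteq> V" using open_V w0 open_contains_cball by blast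
  define g where "g w = G (closest_point (cball w0 d) w)" for w
  have ne: "cball w0 d \<noteq> {}" using d by auto
  have cp: "closest_point (cball w0 d) w \<in> V" for w
    using closest_point_in_set[OF closed_cball ne] d(2) by blast
  have "C-lipschitz_on UNIV g"
  proof (rule lipschitz_onI)
    fix x y
    have "dist (g x) (g y) \<le> C * dist (closest_point (cball w0 d) x) (closest_point (cball w0 d) y)"
      unfolding g_def by (rule lipschitz_onD[OF lip cp cp])
    also have "\<dots> \<le> C * dist x y"
      by (intro mult_left_mono closest_point_lipschitz convex_cball closed_cball ne C_nonneg)
    finally show "dist (g x) (g y) \<le> C * dist x y" .
  qed (rule C_nonneg)
  moreover have eq: "\<forall>w\<in>ball w0 d. g w = G w" by (auto simp: g_def closest_point_self)
  moreover have "\<forall>w\<in>ball w0 d. \<forall>D. (g has_derivative D) (at w) \<longleftrightarrow> (G has_derivative D) (at w)"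
  proof (intro ballI allI iffI)
    fix w D assume w: "w \<in> ball w0 d"
    show "(G has_derivative D) (at w)" if "(g has_derivative D) (at w)"
      by (rule has_derivative_transform_within_open[OF that open_ball w]) (use eq in simp)
    show "(g has_derivative D) (at w)" if "(G has_derivative D) (at w)"
      by (rule has_derivative_transform_within_open[OF that open_ball w]) (use eq in simp)
  qed
  moreover have "ball w0 d \<subseteq> V" using d(2) ball_subset_cball by blast
  ultimately show ?thesis using that[OF d(1)] by blast
qed

lemma cluster_nonempty: "cluster_derivatives \<noteq> {}"
proof -
  obtain d g where d: "d > 0" "ball w0 d \<subseteq> V" and g: "C-lipschitz_on UNIV g" "\<forall>w\<in>ball w0 d. g w = G w"
    and gD: "\<forall>w\<in>ball w0 d. \<forall>D. (g has_derivative D) (at w) \<longleftrightarrow> (G has_derivative D) (at w)"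
    using lipschitz_extension_near .
  have "\<exists>w D. w \<in> ball w0 (min d (inv_nat k)) \<and> (G has_derivative blinfun_apply D) (at w)" for k
  proof -
    have "w0 \<in> ball w0 (min d (inv_nat k))" using d(1) by simp
    then have "ball w0 (min d (inv_nat k)) \<noteq> {}" by blast
    then have "\<not> negligible (ball w0 (min d (inv_nat k)))" by (rule open_not_negligible[OF open_ball])
    then have "\<not> ball w0 (min d (inv_nat k)) \<subseteq> {w. \<not> g differentiable (at w)}"
      using Rademacher[OF g(1)] negligible_subset by blast
    then obtain w where w: "w \<in> ball w0 (min d (inv_nat k))" "g differentiable (at w)" by blast
    then obtain D where D: "(g has_derivative D) (at w)" by (auto simp: differentiable_def)
    have "w \<in> ball w0 d" using w(1) by simp
    with gD D have "(G has_derivative D) (at w)" by blast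
    then show ?thesis using w(1) bounded_linear_Blinfun_apply[OF has_derivative_bounded_linear[OF D]] by metis
  qed
  then obtain wk Dk where wk: "\<And>k. wk k \<in> ball w0 (min d (inv_nat k))"
    and Dk: "\<And>k. (G has_derivative blinfun_apply (Dk k)) (at (wk k))" by metis
  have "wk \<longlonglongrightarrow> w0"
    by (rule metric_tendsto_imp_tendsto[OF LIMSEQ_inverse_real_of_nat])
      (use wk in \<open>auto simp: dist_commute intro!: always_eventually less_imp_le\<close>)
  have wkV: "wk k \<in> V" for k using wk[of k] d(2) by auto
  obtain D r where "D \<in> cluster_derivatives" "strict_mono (r::nat \<Rightarrow> nat)" "(\<lambda>k. Dk (r k)) \<longlonglongrightarrow> D"
    using cluster_subsequence[of wk Dk, OF wkV Dk \<open>wk \<longlonglongrightarrow> w0\<close>] .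
  then show ?thesis by blast
qed

lemma cluster_right_inverse:
  assumes "D \<in> cluster_derivatives"
  shows "E (blinfun_apply D a) = a"
proof -
  obtain wk Dk where w: "\<And>k. wk k \<in> V" "\<And>k. (G has_derivative blinfun_apply (Dk k)) (at (wk k))" "Dk \<longlonglongrightarrow> D"
    using assms by (auto simp: cluster_derivatives_def)
  have "(\<lambda>k. E (blinfun_apply (Dk k) a)) \<longlonglongrightarrow> E (blinfun_apply D a)"
    by (intro bounded_linear.tendsto[OF bl_E] blinfun.tendsto w(3) tendsto_const)
  moreover have "(\<lambda>k. E (blinfun_apply (Dk k) a)) = (\<lambda>k. a)"
    using derivative_right_inverse[OF w(1,2)] by auto
  ultimately show ?thesis by (simp add: LIMSEQ_const_iff)
qed

text \<open>If only one limit of derivatives exists, then by compactness the derivatives near \<open>w0\<close> are uniformly close to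
it, wherever they exist. They exist almost everywhere, so \<open>G - D\<close> has a small Lipschitz constant near \<open>w0\<close>, which is
strict differentiability.\<close>

lemma strict_if_unique_cluster:
  assumes "cluster_derivatives = {D}"
  shows "strict_derivative V G (blinfun_apply D) w0"
  unfolding strict_derivative_def
proof (intro conjI allI impI)
  show "linear (blinfun_apply D)" by (simp add: linear_conv_bounded_linear blinfun.bounded_linear_right)
  fix e :: real assume e: "e > 0"
  obtain d g where d: "d > 0" "ball w0 d \<subseteq> V" and g: "C-lipschitz_on UNIV g" "\<forall>w\<in>ball w0 d. g w = G w"
    and gD: "\<forall>w\<in>ball w0 d. \<forall>D. (g has_derivative D) (at w) \<longleftrightarrow> (G has_derivative D) (at w)"
    using lipschitz_extension_near .
  have "\<exists>\<delta>>0. \<forall>w\<in>ball w0 \<delta>. \<forall>D'. (g has_derivative blinfun_apply D') (at w) \<longrightarrow> norm (D' - D) \<le> e"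
  proof (rule ccontr)
    assume neg: "\<not> ?thesis"
    have "\<exists>w D'. w \<in> ball w0 (min d (inv_nat k)) \<and> (g has_derivative blinfun_apply D') (at w) \<and> norm (D' - D) > e" for k
    proof -
      have "min d (inv_nat k) > 0" using d(1) by simp
      with neg show ?thesis by (meson not_le)
    qed
    then obtain wk Dk where wk: "\<And>k. wk k \<in> ball w0 (min d (inv_nat k))"
      and Dk: "\<And>k. (g has_derivative blinfun_apply (Dk k)) (at (wk k))" and far: "\<And>k. norm (Dk k - D) > e" by metis
    have "wk \<longlonglongrightarrow> w0"
      by (rule metric_tendsto_imp_tendsto[OF LIMSEQ_inverse_real_of_nat])
        (use wk in \<open>auto simp: dist_commute intro!: always_eventually less_imp_le\<close>)
    have wb: "wk k \<in> ball w0 d" for k using wk[of k] by auto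
    then have wkV: "wk k \<in> V" for k using d(2) by blast
    have DkG: "(G has_derivative blinfun_apply (Dk k)) (at (wk k))" for k using gD wb[of k] Dk[of k] by simp
    obtain D' r where r: "D' \<in> cluster_derivatives" "strict_mono (r::nat \<Rightarrow> nat)" "(\<lambda>k. Dk (r k)) \<longlonglongrightarrow> D'"
      using cluster_subsequence[of wk Dk, OF wkV DkG \<open>wk \<longlonglongrightarrow> w0\<close>] .
    then have "(\<lambda>k. norm (Dk (r k) - D)) \<longlonglongrightarrow> norm (D - D)"
      using assms by (intro tendsto_intros) simp
    then have "e \<le> norm (D - D)"
      by (rule tendsto_lowerbound) (auto intro!: always_eventually less_imp_le far)
    with e show False by simp
  qed
  then obtain \<delta> where \<delta>: "\<delta> > 0" "\<And>w D'. w \<in> ball w0 \<delta> \<Longrightarrow> (g has_derivative blinfun_apply D') (at w) \<Longrightarrow> norm (D' - D) \<le> e" by blast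
  define f where "f w = g w - blinfun_apply D w" for w
  have "(C + norm D)-lipschitz_on UNIV f"
  proof (rule lipschitz_onI)
    fix x y
    have "dist (f x) (f y) = norm ((g x - g y) - blinfun_apply D (x - y))"
      by (simp add: f_def dist_norm blinfun.diff_right algebra_simps)
    also have "\<dots> \<le> norm (g x - g y) + norm (blinfun_apply D (x - y))" by (rule norm_triangle_ineq4)
    also have "\<dots> \<le> C * norm (x - y) + norm D * norm (x - y)"
      using lipschitz_onD[OF g(1), of x y] norm_blinfun[of D "x - y"] by (auto simp: dist_norm intro: add_mono)
    finally show "dist (f x) (f y) \<le> (C + norm D) * dist x y" by (simp add: dist_norm algebra_simps)
  qed (use C_nonneg in auto)
  note Lf = lipschitz_if_derivative_bounded_ae[OF this open_ball convex_ball, of w0 \<delta> e]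
  have bound: "norm (D' h) \<le> e * norm h" if "x \<in> ball w0 \<delta>" "(f has_derivative D') (at x)" for x D' h
  proof -
    have "((\<lambda>x. f x + blinfun_apply D x) has_derivative (\<lambda>h. D' h + blinfun_apply D h)) (at x)"
      by (intro derivative_intros that(2) bounded_linear_imp_has_derivative blinfun.bounded_linear_right)
    then have gx: "(g has_derivative (\<lambda>h. D' h + blinfun_apply D h)) (at x)" by (simp add: f_def)
    define B where "B = Blinfun (\<lambda>h. D' h + blinfun_apply D h)"
    have B: "blinfun_apply B = (\<lambda>h. D' h + blinfun_apply D h)"
      unfolding B_def by (rule bounded_linear_Blinfun_apply[OF has_derivative_bounded_linear[OF gx]])
    have "norm (B - D) \<le> e" by (rule \<delta>(2)[OF that(1)]) (simp add: B gx)
    moreover have "D' h = blinfun_apply (B - D) h" by (simp add: blinfun.diff_left B)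
    ultimately show ?thesis
      using norm_blinfun[of "B - D" h] by (simp add: mult_right_mono order_trans)
  qed
  show "\<exists>d>0. \<forall>u\<in>V \<inter> ball w0 d. \<forall>v\<in>V \<inter> ball w0 d. norm (G v - G u - blinfun_apply D (v - u)) \<le> e * norm (v - u)"
  proof (intro exI[of _ "min d \<delta>"] conjI ballI)
    fix u v assume u: "u \<in> V \<inter> ball w0 (min d \<delta>)" and v: "v \<in> V \<inter> ball w0 (min d \<delta>)"
    have "norm (f v - f u) \<le> e * norm (v - u)"
    proof (rule Lf)
      show "norm (D' h) \<le> e * norm h" if "x \<in> ball w0 \<delta>" "(f has_derivative D') (at x)" for x D' h
        using that by (rule bound)
    qed (use u v in auto)
    moreover have "f v - f u = G v - G u - blinfun_apply D (v - u)"
      using g(2) u v by (simp add: f_def blinfun.diff_right)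
    ultimately show "norm (G v - G u - blinfun_apply D (v - u)) \<le> e * norm (v - u)" by simp
  qed (use d \<delta> in auto)
qed

text \<open>The error bound of the strict derivative passes to limits of difference quotients, hence to tangent vectors and
derivatives at nearby points.\<close>

lemma strict_derivative_near:
  assumes sd: "strict_derivative V G H w0" and "e > 0"
  obtains d where "d > 0" "\<forall>w\<in>V \<inter> ball w0 d. \<forall>a h t. (\<forall>k. 0 < t k) \<and> t \<longlonglongrightarrow> (0::real) \<and>
      (\<lambda>k. (G (w + t k *\<^sub>R a) - G w) /\<^sub>R t k) \<longlonglongrightarrow> h \<longrightarrow> norm (h - H a) \<le> e * norm a"
proof -
  have H: "linear H" using sd by (simp add: strict_derivative_def)
  obtain d where d: "d > 0" "\<And>u v. u \<in> V \<inter> ball w0 d \<Longrightarrow> v \<in> V \<inter> ball w0 d \<Longrightarrow> norm (G v - G u - H (v - u)) \<le> e * norm (v - u)"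
    using sd \<open>e > 0\<close> unfolding strict_derivative_def by blast
  show ?thesis
  proof (rule that[OF d(1)], intro ballI allI impI, elim conjE)
    fix w a h and t :: "nat \<Rightarrow> real"
    assume w: "w \<in> V \<inter> ball w0 d" and t: "\<forall>k. 0 < t k" "t \<longlonglongrightarrow> 0"
      and lim: "(\<lambda>k. (G (w + t k *\<^sub>R a) - G w) /\<^sub>R t k) \<longlonglongrightarrow> h"
    have "(\<lambda>k. w + t k *\<^sub>R a) \<longlonglongrightarrow> w" using tendsto_add[OF tendsto_const tendsto_scaleR[OF t(2) tendsto_const]] by simp
    then have ev: "\<forall>\<^sub>F k in sequentially. w + t k *\<^sub>R a \<in> V \<inter> ball w0 d"
      using w open_V by (intro topological_tendstoD) auto
    have "(\<lambda>k. (G (w + t k *\<^sub>R a) - G w) /\<^sub>R t k - H a) \<longlonglongrightarrow> h - H a"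
      by (intro tendsto_diff lim tendsto_const)
    then show "norm (h - H a) \<le> e * norm a"
    proof (rule Lim_norm_ubound[OF sequentially_bot])
      show "\<forall>\<^sub>F k in sequentially. norm ((G (w + t k *\<^sub>R a) - G w) /\<^sub>R t k - H a) \<le> e * norm a"
        using ev
      proof eventually_elim
        case (elim k)
        have tk: "t k > 0" using t(1) by simp
        have "(G (w + t k *\<^sub>R a) - G w) /\<^sub>R t k - H a = (G (w + t k *\<^sub>R a) - G w - H (w + t k *\<^sub>R a - w)) /\<^sub>R t k"
          using tk by (simp add: linear_scale[OF H] scaleR_diff_right)
        moreover have "norm (G (w + t k *\<^sub>R a) - G w - H (w + t k *\<^sub>R a - w)) \<le> e * norm a * t k"
          using d(2)[OF w elim] tk by (simp add: mult_ac)
        ultimately show ?case by (simp only: norm_scaled_le_iff[OF tk])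
      qed
    qed
  qed
qed

lemma cluster_eq_strict:
  assumes sd: "strict_derivative V G H w0"
  obtains D where "blinfun_apply D = H" "cluster_derivatives = {D}"
proof -
  have H: "bounded_linear H" using sd by (simp add: strict_derivative_def linear_conv_bounded_linear)
  define D where "D = Blinfun H"
  have D: "blinfun_apply D = H" unfolding D_def by (rule bounded_linear_Blinfun_apply[OF H])
  have D0: "(G has_derivative blinfun_apply D) (at w0)"
    unfolding D by (rule strict_derivative_imp_has_derivative[OF sd open_V w0])
  have "D' = D" if D': "D' \<in> cluster_derivatives" for D'
  proof (rule blinfun_eqI)
    fix a
    obtain wk Dk where w: "\<And>k. wk k \<in> V" "\<And>k. (G has_derivative blinfun_apply (Dk k)) (at (wk k))" "wk \<longlonglongrightarrow> w0" "Dk \<longlonglongrightarrow> D'"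
      using D' by (auto simp: cluster_derivatives_def)
    have close: "norm (blinfun_apply D' a - H a) \<le> e * norm a" if e: "e > 0" for e
    proof -
      obtain d where d: "d > 0" "\<forall>w\<in>V \<inter> ball w0 d. \<forall>a h t. (\<forall>k. 0 < t k) \<and> t \<longlonglongrightarrow> (0::real) \<and>
          (\<lambda>k. (G (w + t k *\<^sub>R a) - G w) /\<^sub>R t k) \<longlonglongrightarrow> h \<longrightarrow> norm (h - H a) \<le> e * norm a"
        using strict_derivative_near[OF sd e] .
      have "(\<lambda>k. blinfun_apply (Dk k) a - H a) \<longlonglongrightarrow> blinfun_apply D' a - H a"
        by (intro tendsto_diff blinfun.tendsto w(4) tendsto_const)
      then show ?thesis
      proof (rule Lim_norm_ubound[OF sequentially_bot])
        have "\<forall>\<^sub>F k in sequentially. wk k \<in> ball w0 d" using topological_tendstoD[OF w(3) open_ball] d(1) by simp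
        then show "\<forall>\<^sub>F k in sequentially. norm (blinfun_apply (Dk k) a - H a) \<le> e * norm a"
        proof eventually_elim
          case (elim k)
          obtain h t where h: "h \<in> tangent_cone \<Omega> (G (wk k))" "E h = a" "norm h \<le> C * norm a"
            "(\<lambda>j. (G (wk k + t j *\<^sub>R a) - G (wk k)) /\<^sub>R t j) \<longlonglongrightarrow> h" "\<forall>j. 0 < t j" "t \<longlonglongrightarrow> (0::real)"
            using tangent_direction[OF w(1), of k a] .
          obtain b where b: "h = blinfun_apply (Dk k) b" using h(1) tangent_cone_derivative[OF w(1,2)] by blast
          then have "b = a" using derivative_right_inverse[OF w(1,2), of k b] h(2) by simp
          moreover have "norm (h - H a) \<le> e * norm a" using d(2) w(1) elim h(4-6) by blast
          ultimately show ?case using b by simp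
        qed
      qed
    qed
    have "norm (blinfun_apply D' a - H a) \<le> 0"
    proof (rule field_le_epsilon)
      fix e :: real assume e: "e > 0"
      have p: "norm a + 1 > 0" by (simp add: add_nonneg_pos)
      have "norm (blinfun_apply D' a - H a) \<le> e / (norm a + 1) * norm a" using e p by (intro close) simp
      also have "\<dots> \<le> e / (norm a + 1) * (norm a + 1)" using e p by (intro mult_left_mono) auto
      also have "\<dots> = 0 + e" using p by simp
      finally show "norm (blinfun_apply D' a - H a) \<le> 0 + e" .
    qed
    then show "blinfun_apply D' a = blinfun_apply D a" by (simp add: D)
  qed
  moreover have "D \<in> cluster_derivatives"
    unfolding cluster_derivatives_def using D0 w0
    by (intro CollectI exI[of _ "\<lambda>_. w0"] exI[of _ "\<lambda>_. D"]) auto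
  ultimately have "cluster_derivatives = {D}" by blast
  with D show ?thesis by (rule that)
qed

end

section \<open>Normal cones and limits of tangent spaces\<close>

lemma adjoint_tendsto:
  fixes Dk :: "nat \<Rightarrow> 'a::euclidean_space \<Rightarrow> 'b::euclidean_space"
  assumes "\<And>k. linear (Dk k)" "linear D" "\<And>a. (\<lambda>k. Dk k a) \<longlonglongrightarrow> D a"
  shows "(\<lambda>k. adjoint (Dk k) v) \<longlonglongrightarrow> adjoint D v"
proof (rule tendsto_componentwise_iff[THEN iffD2], rule ballI)
  fix b :: 'a assume "b \<in> Basis"
  have "(\<lambda>k. Dk k b \<bullet> v) \<longlonglongrightarrow> D b \<bullet> v" by (intro tendsto_intros assms)
  then show "(\<lambda>k. adjoint (Dk k) v \<bullet> b) \<longlonglongrightarrow> adjoint D v \<bullet> b"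
    by (simp add: adjoint_clauses assms inner_commute)
qed

text \<open>Subtracting \<open>adjoint E (adjoint D v)\<close> turns any vector into one that is orthogonal to the range of \<open>D\<close>, by a correction that
depends continuously on \<open>D\<close>. This makes orthogonal complements of ranges converge together with the maps.\<close>

lemma perp_correction:
  fixes D :: "'a::euclidean_space \<Rightarrow> 'b::euclidean_space"
  assumes "linear D" "linear E" "\<And>a. E (D a) = a"
  shows "(v - adjoint E (adjoint D v)) \<bullet> D a = 0"
  by (simp add: inner_diff_left adjoint_clauses(2)[OF assms(1)] adjoint_clauses(2)[OF assms(2)] assms(3))

lemma polar_range:
  assumes D: "linear D"
  shows "polar (range D) = {v. \<forall>a. v \<bullet> D a = 0}"
proof -
  have "v \<bullet> D a = 0" if "v \<in> polar (range D)" for v a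
  proof -
    have "v \<bullet> D a \<le> 0" "v \<bullet> D (- a) \<le> 0" using that by (auto simp: polar_def)
    then show ?thesis by (simp add: linear_neg[OF D])
  qed
  then show ?thesis by (auto simp: polar_def)
qed

lemma orth_proj_range_tendsto:
  fixes Dk :: "nat \<Rightarrow> 'a::euclidean_space \<Rightarrow> 'b::euclidean_space"
  assumes Dk: "\<And>k. linear (Dk k)" and D: "linear D" and lim: "\<And>a. (\<lambda>k. Dk k a) \<longlonglongrightarrow> D a"
    and E: "linear E" and ED: "\<And>k a. E (Dk k a) = a"
  shows "(\<lambda>k. orth_proj (range (Dk k)) x) \<longlonglongrightarrow> orth_proj (range D) x"
proof -
  have sub: "subspace (range (Dk k))" "subspace (range D)" for k
    using Dk D by (auto intro: linear_subspace_image subspace_UNIV)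
  define p q where "p = orth_proj (range D) x" and "q = x - p"
  obtain a where a: "p = D a" using orth_proj_in(1)[OF sub(2), of x] by (auto simp: p_def)
  have q: "q \<bullet> D b = 0" for b using orth_proj_in(2)[OF sub(2), of x] by (auto simp: q_def p_def orthogonal_comp_iff)
  have "adjoint D q \<bullet> b = 0" for b by (simp add: adjoint_clauses[OF D] q)
  then have adj0: "adjoint D q = 0" by (metis inner_eq_zero_iff)
  have "(\<lambda>k. orth_proj (range (Dk k)) (p + q)) \<longlonglongrightarrow> p"
  proof (rule orth_proj_tendsto[OF sub(1)])
    show "Dk k a \<in> range (Dk k)" for k by simp
    show "(\<lambda>k. Dk k a) \<longlonglongrightarrow> p" using lim a by simp
    show "q - adjoint E (adjoint (Dk k) q) \<in> (range (Dk k))\<^sup>\<bottom>" for k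
      using perp_correction[OF Dk E ED] by (auto simp: orthogonal_comp_iff)
    have "(\<lambda>k. q - adjoint E (adjoint (Dk k) q)) \<longlonglongrightarrow> q - adjoint E (adjoint D q)"
      by (intro tendsto_diff tendsto_const bounded_linear.tendsto[OF _ adjoint_tendsto[OF Dk D lim]])
        (simp add: linear_conv_bounded_linear[symmetric] adjoint_linear E)
    then show "(\<lambda>k. q - adjoint E (adjoint (Dk k) q)) \<longlonglongrightarrow> q"
      using adj0 linear_0[OF adjoint_linear[OF E]] by simp
  qed
  then show ?thesis by (simp add: p_def q_def)
qed

text \<open>The SC derivative as a notion for sets. The dimension is a parameter because the parameter space, not the ambient
space, determines it.\<close>

definition SC_limits :: "nat \<Rightarrow> 'b::euclidean_space set \<Rightarrow> 'b \<Rightarrow> 'b set set" where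
  "SC_limits n \<Omega> z = {L. subspace L \<and> dim L = n \<and>
     (\<exists>zk. (\<forall>k. zk k \<in> \<Omega> \<and> subspace (tangent_cone \<Omega> (zk k)) \<and> dim (tangent_cone \<Omega> (zk k)) = n) \<and>
        zk \<longlonglongrightarrow> z \<and> (\<lambda>k. subspace_dist L (tangent_cone \<Omega> (zk k))) \<longlonglongrightarrow> 0)}"

context lipschitz_chart
begin

text \<open>Regular normals have nonpositive products with tangent vectors. Over each direction there is a tangent vector with a
norm bound that is uniform in the base point, so the property survives in the limit.\<close>

lemma limiting_normal_direction:
  assumes "v \<in> limiting_normal_cone \<Omega> (G w0)"
  shows "\<exists>h. E h = b \<and> v \<bullet> h \<le> 0"
proof -
  obtain p vk where p: "p \<longlonglongrightarrow> G w0" "\<forall>\<^sub>F k in sequentially. p k \<in> \<Omega>"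
    and vk: "\<And>k. vk k \<in> regular_normal_cone \<Omega> (p k)" "vk \<longlonglongrightarrow> v"
    using assms by (auto simp: limiting_normal_cone_def outer_limit_def filterlim_nhds_in)
  obtain N where N: "\<And>k. k \<ge> N \<Longrightarrow> E (p k) \<in> V \<and> G (E (p k)) = p k"
    using eventually_chart(1)[OF p(1) w0 p(2)] by (auto simp: eventually_sequentially)
  have "\<exists>h. h \<in> tangent_cone \<Omega> (p (k + N)) \<and> E h = b \<and> norm h \<le> C * norm b" for k
  proof -
    have V: "E (p (k + N)) \<in> V" and eq: "G (E (p (k + N))) = p (k + N)" using N[of "k + N"] by auto
    obtain h t where h: "h \<in> tangent_cone \<Omega> (G (E (p (k + N))))" "E h = b" "norm h \<le> C * norm b"
      "(\<lambda>j. (G (E (p (k + N)) + t j *\<^sub>R b) - G (E (p (k + N)))) /\<^sub>R t j) \<longlonglongrightarrow> h" "\<forall>j. 0 < t j" "t \<longlonglongrightarrow> (0::real)"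
      using tangent_direction[OF V, of b] .
    then show ?thesis using eq by auto
  qed
  then obtain h where h: "\<And>k. h k \<in> tangent_cone \<Omega> (p (k + N))" "\<And>k. E (h k) = b" "\<And>k. norm (h k) \<le> C * norm b"
    by metis
  have "bounded (range h)" using h(3) by (auto simp: bounded_iff)
  from bounded_imp_convergent_subsequence[OF this]
  obtain l r where r: "strict_mono r" "(h \<circ> r) \<longlonglongrightarrow> l" by blast
  have "(\<lambda>k. E (h (r k))) \<longlonglongrightarrow> E l" using bounded_linear.tendsto[OF bl_E r(2)] by (simp add: o_def)
  then have El: "E l = b" by (simp add: h(2) LIMSEQ_const_iff)
  have "(\<lambda>k. vk (r k + N)) \<longlonglongrightarrow> v"
    using LIMSEQ_subseq_LIMSEQ[OF LIMSEQ_ignore_initial_segment[OF vk(2), of N] r(1)] by (simp add: o_def)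
  then have "(\<lambda>k. vk (r k + N) \<bullet> h (r k)) \<longlonglongrightarrow> v \<bullet> l"
    using r(2) by (intro tendsto_inner) (simp_all add: o_def)
  moreover have "vk (r k + N) \<bullet> h (r k) \<le> 0" for k
    using vk(1)[of "r k + N"] h(1)[of "r k"] by (auto simp: regular_normal_cone_def polar_def)
  ultimately have "v \<bullet> l \<le> 0" by (intro LIMSEQ_le_const2) auto
  with El show ?thesis by blast
qed

lemma regular_subset_limiting: "regular_normal_cone \<Omega> (G w0) \<subseteq> limiting_normal_cone \<Omega> (G w0)"
proof
  fix v assume "v \<in> regular_normal_cone \<Omega> (G w0)"
  then show "v \<in> limiting_normal_cone \<Omega> (G w0)"
    unfolding limiting_normal_cone_def
    by (intro outer_limitI[of "\<lambda>_. G w0" _ "\<lambda>_. v"]) (use G_in[OF w0] in \<open>auto simp: filterlim_nhds_in\<close>)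
qed

lemma cluster_perp_subset_limiting:
  assumes D: "D \<in> cluster_derivatives" and v: "\<And>a. v \<bullet> blinfun_apply D a = 0"
  shows "v \<in> limiting_normal_cone \<Omega> (G w0)"
proof -
  obtain wk Dk where w: "\<And>k. wk k \<in> V" "\<And>k. (G has_derivative blinfun_apply (Dk k)) (at (wk k))" "wk \<longlonglongrightarrow> w0" "Dk \<longlonglongrightarrow> D"
    using D by (auto simp: cluster_derivatives_def)
  have lin: "linear (blinfun_apply B)" for B :: "'a \<Rightarrow>\<^sub>L 'b" by (simp add: linear_conv_bounded_linear blinfun.bounded_linear_right)
  have lim: "(\<lambda>k. blinfun_apply (Dk k) a) \<longlonglongrightarrow> blinfun_apply D a" for a
    by (intro blinfun.tendsto w(4) tendsto_const)
  define vk where "vk k = v - adjoint E (adjoint (blinfun_apply (Dk k)) v)" for k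
  have "adjoint (blinfun_apply D) v \<bullet> b = 0" for b by (simp add: adjoint_clauses[OF lin] v)
  then have adj0: "adjoint (blinfun_apply D) v = 0" by (metis inner_eq_zero_iff)
  have "vk \<longlonglongrightarrow> v - adjoint E (adjoint (blinfun_apply D) v)"
    unfolding vk_def
    by (intro tendsto_diff tendsto_const bounded_linear.tendsto[OF _ adjoint_tendsto[OF lin lin lim]])
      (simp add: linear_conv_bounded_linear[symmetric] adjoint_linear linear_E)
  then have vklim: "vk \<longlonglongrightarrow> v" using adj0 linear_0[OF adjoint_linear[OF linear_E]] by simp
  have "vk k \<in> regular_normal_cone \<Omega> (G (wk k))" for k
    unfolding regular_normal_cone_def tangent_cone_derivative[OF w(1,2)] polar_range[OF lin] vk_def
    using perp_correction[OF lin linear_E derivative_right_inverse[OF w(1,2)]] by blast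
  then show ?thesis
    unfolding limiting_normal_cone_def
    by (intro outer_limitI[OF _ _ vklim, of "\<lambda>k. G (wk k)"])
      (auto simp: filterlim_nhds_in G_in w(1) intro!: isCont_tendsto_compose[OF isCont_G[OF w0] w(3)])
qed

text \<open>The limiting normal cone contains the orthogonal complement of every cluster tangent space. Conversely,
split a limiting normal as \<open>v = v' + adjoint E a\<close> with \<open>v'\<close> in that complement. Additivity of the
cone puts \<open>adjoint E a\<close> into it, and testing this vector against a tangent vector over \<open>a\<close> gives \<open>a \<bullet> a \<le> 0\<close>.\<close>

lemma limiting_normal_eq_cluster_perp:
  assumes D: "D \<in> cluster_derivatives"
    and add: "\<And>u v. u \<in> limiting_normal_cone \<Omega> (G w0) \<Longrightarrow> v \<in> limiting_normal_cone \<Omega> (G w0) \<Longrightarrow> u + v \<in> limiting_normal_cone \<Omega> (G w0)"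
  shows "limiting_normal_cone \<Omega> (G w0) = {v. \<forall>a. v \<bullet> blinfun_apply D a = 0}"
proof (intro equalityI subsetI)
  have lin: "linear (blinfun_apply D)" by (simp add: linear_conv_bounded_linear blinfun.bounded_linear_right)
  fix v assume v: "v \<in> limiting_normal_cone \<Omega> (G w0)"
  define a where "a = adjoint (blinfun_apply D) v"
  define v' where "v' = v - adjoint E a"
  have perp: "v' \<bullet> blinfun_apply D b = 0" for b
    unfolding v'_def a_def by (rule perp_correction[OF lin linear_E cluster_right_inverse[OF D]])
  have "- v' \<in> limiting_normal_cone \<Omega> (G w0)"
    by (rule cluster_perp_subset_limiting[OF D]) (simp add: perp)
  from add[OF v this] have "adjoint E a \<in> limiting_normal_cone \<Omega> (G w0)" by (simp add: v'_def)
  from limiting_normal_direction[OF this, of a]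
  obtain h where h: "E h = a" "adjoint E a \<bullet> h \<le> 0" by blast
  have "a \<bullet> a \<le> 0" using h by (simp add: adjoint_clauses[OF linear_E])
  then have "a = 0" by (metis inner_eq_zero_iff inner_ge_zero order_antisym)
  then have "v = v'" using linear_0[OF adjoint_linear[OF linear_E]] by (simp add: v'_def)
  then show "v \<in> {v. \<forall>a. v \<bullet> blinfun_apply D a = 0}" using perp by simp
qed (use cluster_perp_subset_limiting[OF D] in blast)

lemma limiting_normal_strict:
  assumes sd: "strict_derivative V G H w0"
  shows "limiting_normal_cone \<Omega> (G w0) = polar (range H)" "regular_normal_cone \<Omega> (G w0) = polar (range H)"
proof -
  have D: "(G has_derivative H) (at w0)" by (rule strict_derivative_at_base[OF sd])
  show reg: "regular_normal_cone \<Omega> (G w0) = polar (range H)"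
    unfolding regular_normal_cone_def tangent_cone_derivative[OF w0 D] ..
  have "limiting_normal_cone \<Omega> (G w0) \<subseteq> polar (range H)"
  proof (clarsimp simp: polar_def)
    fix v a assume v: "v \<in> limiting_normal_cone \<Omega> (G w0)"
    obtain p vk where p: "p \<longlonglongrightarrow> G w0" "\<forall>\<^sub>F k in sequentially. p k \<in> \<Omega>"
      and vk: "\<And>k. vk k \<in> regular_normal_cone \<Omega> (p k)" "vk \<longlonglongrightarrow> v"
      using v by (auto simp: limiting_normal_cone_def outer_limit_def filterlim_nhds_in)
    note ev = eventually_chart[OF p(1) w0 p(2)]
    have bound: "v \<bullet> H a \<le> norm v * e * norm a" if e: "e > 0" for e
    proof -
      obtain d where d: "d > 0" "\<forall>w\<in>V \<inter> ball w0 d. \<forall>a h t. (\<forall>k. 0 < t k) \<and> t \<longlonglongrightarrow> (0::real) \<and>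
          (\<lambda>k. (G (w + t k *\<^sub>R a) - G w) /\<^sub>R t k) \<longlonglongrightarrow> h \<longrightarrow> norm (h - H a) \<le> e * norm a"
        using strict_derivative_near[OF sd e] .
      have lim1: "(\<lambda>k. vk k \<bullet> H a) \<longlonglongrightarrow> v \<bullet> H a" by (intro tendsto_intros vk)
      have lim2: "(\<lambda>k. norm (vk k) * e * norm a) \<longlonglongrightarrow> norm v * e * norm a" by (intro tendsto_intros vk)
      have "\<forall>\<^sub>F k in sequentially. E (p k) \<in> ball w0 d" using topological_tendstoD[OF ev(2) open_ball] d(1) by simp
      with ev(1) have "\<forall>\<^sub>F k in sequentially. vk k \<bullet> H a \<le> norm (vk k) * e * norm a"
      proof eventually_elim
        case (elim k)
        then have V: "E (p k) \<in> V" and eq: "G (E (p k)) = p k" by auto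
        obtain h t where h: "h \<in> tangent_cone \<Omega> (G (E (p k)))" "E h = a" "norm h \<le> C * norm a"
          "(\<lambda>j. (G (E (p k) + t j *\<^sub>R a) - G (E (p k))) /\<^sub>R t j) \<longlonglongrightarrow> h" "\<forall>j. 0 < t j" "t \<longlonglongrightarrow> (0::real)"
          using tangent_direction[OF V, of a] .
        have "norm (h - H a) \<le> e * norm a" using d(2) V elim h(4-6) by blast
        have "vk k \<bullet> h \<le> 0" using vk(1)[of k] h(1) eq by (auto simp: regular_normal_cone_def polar_def)
        then have "vk k \<bullet> H a \<le> vk k \<bullet> (H a - h)" by (simp add: inner_diff_right)
        also have "\<dots> \<le> norm (vk k) * norm (H a - h)" by (rule norm_cauchy_schwarz)
        also have "\<dots> \<le> norm (vk k) * (e * norm a)"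
          using \<open>norm (h - H a) \<le> e * norm a\<close> by (intro mult_left_mono) (auto simp: norm_minus_commute)
        finally show ?case by (simp add: mult.assoc)
      qed
      then show ?thesis by (rule tendsto_le[OF sequentially_bot lim2 lim1])
    qed
    show "v \<bullet> H a \<le> 0"
    proof (rule field_le_epsilon)
      fix e :: real assume e: "e > 0"
      have p: "norm v * norm a + 1 > 0" by (simp add: add_nonneg_pos)
      have "v \<bullet> H a \<le> norm v * (e / (norm v * norm a + 1)) * norm a" using e p by (intro bound) simp
      also have "\<dots> = e / (norm v * norm a + 1) * (norm v * norm a)" by simp
      also have "\<dots> \<le> e / (norm v * norm a + 1) * (norm v * norm a + 1)" using e p by (intro mult_left_mono) auto
      also have "\<dots> = 0 + e" using p by simp
      finally show "v \<bullet> H a \<le> 0 + e" .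
    qed
  qed
  with regular_subset_limiting reg show "limiting_normal_cone \<Omega> (G w0) = polar (range H)" by blast
qed

lemma range_derivative_subspace:
  assumes D: "linear D" "\<And>a. E (D a) = a"
  shows "subspace (range D)" "dim (range D) = DIM('a)"
proof -
  show "subspace (range D)" by (rule linear_subspace_image[OF D(1) subspace_UNIV])
  have "inj D" using D(2) by (rule inj_on_inverseI)
  then show "dim (range D) = DIM('a)" by (simp add: dim_image_eq[OF D(1)])
qed

text \<open>The points whose tangent cone is a subspace of the right dimension are the points of differentiability of \<open>G\<close>, and
convergence of the derivatives is equivalent to convergence of their ranges up to subsequences.\<close>

lemma SC_limits_eq: "SC_limits DIM('a) \<Omega> (G w0) = (\<lambda>D. range (blinfun_apply D)) ` cluster_derivatives"
proof (intro equalityI subsetI)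
  have lin: "linear (blinfun_apply B)" for B :: "'a \<Rightarrow>\<^sub>L 'b" by (simp add: linear_conv_bounded_linear blinfun.bounded_linear_right)
  {
    fix L assume "L \<in> (\<lambda>D. range (blinfun_apply D)) ` cluster_derivatives"
    then obtain D where D: "D \<in> cluster_derivatives" and L: "L = range (blinfun_apply D)" by blast
    obtain wk Dk where w: "\<And>k. wk k \<in> V" "\<And>k. (G has_derivative blinfun_apply (Dk k)) (at (wk k))" "wk \<longlonglongrightarrow> w0" "Dk \<longlonglongrightarrow> D"
      using D by (auto simp: cluster_derivatives_def)
    have lim: "(\<lambda>k. blinfun_apply (Dk k) a) \<longlonglongrightarrow> blinfun_apply D a" for a
      by (intro blinfun.tendsto w(4) tendsto_const)
    note inv = derivative_right_inverse[OF w(1,2)]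
    note sub = range_derivative_subspace[OF lin inv] and subL = range_derivative_subspace[OF lin cluster_right_inverse[OF D]]
    have "(\<lambda>k. subspace_dist L (range (blinfun_apply (Dk k)))) \<longlonglongrightarrow> 0"
      unfolding L subspace_dist_tendsto_iff[OF subL(1) sub(1)]
      using orth_proj_range_tendsto[OF lin lin lim linear_E inv] by blast
    then show "L \<in> SC_limits DIM('a) \<Omega> (G w0)"
      unfolding SC_limits_def using subL
      by (intro CollectI conjI exI[of _ "\<lambda>k. G (wk k)"])
        (auto simp: L G_in w(1) tangent_cone_derivative[OF w(1,2)] sub intro!: isCont_tendsto_compose[OF isCont_G[OF w0] w(3)])
  }
  fix L assume "L \<in> SC_limits DIM('a) \<Omega> (G w0)"
  then obtain zk where L: "subspace L" and zk: "\<And>k. zk k \<in> \<Omega>" "\<And>k. subspace (tangent_cone \<Omega> (zk k))" "\<And>k. dim (tangent_cone \<Omega> (zk k)) = DIM('a)"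
    and lim: "zk \<longlonglongrightarrow> G w0" "(\<lambda>k. subspace_dist L (tangent_cone \<Omega> (zk k))) \<longlonglongrightarrow> 0"
    unfolding SC_limits_def by blast
  have z\<Omega>: "\<forall>\<^sub>F k in sequentially. zk k \<in> \<Omega>" using zk(1) by simp
  note ev = eventually_chart[OF lim(1) w0 z\<Omega>]
  obtain N where N: "\<And>k. k \<ge> N \<Longrightarrow> E (zk k) \<in> V \<and> G (E (zk k)) = zk k"
    using ev(1) by (auto simp: eventually_sequentially)
  define wk where "wk k = E (zk (k + N))" for k
  have wV: "wk k \<in> V" and Gw: "G (wk k) = zk (k + N)" for k using N[of "k + N"] by (auto simp: wk_def)
  have wlim: "wk \<longlonglongrightarrow> w0" unfolding wk_def by (rule LIMSEQ_ignore_initial_segment[OF ev(2)])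
  have "\<exists>B. (G has_derivative blinfun_apply B) (at (wk k))" for k
  proof -
    obtain D where D: "(G has_derivative D) (at (wk k))"
      using derivative_if_tangent_subspace[OF wV, of k] zk(2,3) unfolding Gw by blast
    then show ?thesis using bounded_linear_Blinfun_apply[OF has_derivative_bounded_linear[OF D]] by (intro exI[of _ "Blinfun D"]) simp
  qed
  then obtain Dk where Dk: "\<And>k. (G has_derivative blinfun_apply (Dk k)) (at (wk k))" by metis
  obtain D r where D: "D \<in> cluster_derivatives" and r: "strict_mono (r::nat \<Rightarrow> nat)" "(\<lambda>k. Dk (r k)) \<longlonglongrightarrow> D"
    using cluster_subsequence[of wk Dk, OF wV Dk wlim] .
  have T: "tangent_cone \<Omega> (zk (k + N)) = range (blinfun_apply (Dk k))" for k
    using tangent_cone_derivative[OF wV Dk] by (simp add: Gw)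
  have "(\<lambda>k. subspace_dist L (tangent_cone \<Omega> (zk (r k + N)))) \<longlonglongrightarrow> 0"
    using LIMSEQ_subseq_LIMSEQ[OF LIMSEQ_ignore_initial_segment[OF lim(2), of N] r(1)] by (simp add: o_def)
  then have 1: "(\<lambda>k. orth_proj (tangent_cone \<Omega> (zk (r k + N))) x) \<longlonglongrightarrow> orth_proj L x" for x
    using subspace_dist_tendsto_iff[OF L, of "\<lambda>k. tangent_cone \<Omega> (zk (r k + N))", OF zk(2)] by blast
  have "(\<lambda>k. blinfun_apply (Dk (r k)) a) \<longlonglongrightarrow> blinfun_apply D a" for a
    by (intro blinfun.tendsto r(2) tendsto_const)
  then have 2: "(\<lambda>k. orth_proj (tangent_cone \<Omega> (zk (r k + N))) x) \<longlonglongrightarrow> orth_proj (range (blinfun_apply D)) x" for x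
    unfolding T by (intro orth_proj_range_tendsto[OF lin lin _ linear_E derivative_right_inverse[OF wV Dk]])
  have "L = range (blinfun_apply D)"
    by (rule subspace_eq_if_orth_proj_eq[OF L range_derivative_subspace(1)[OF lin cluster_right_inverse[OF D]]])
      (rule LIMSEQ_unique[OF 1 2])
  with D show "L \<in> (\<lambda>D. range (blinfun_apply D)) ` cluster_derivatives" by blast
qed

lemma strict_iff_unique_cluster: "(\<exists>H. strict_derivative V G H w0) \<longleftrightarrow> is_singleton cluster_derivatives"
  using cluster_eq_strict strict_if_unique_cluster unfolding is_singleton_def by metis

lemma inj_on_range_cluster: "inj_on (\<lambda>D. range (blinfun_apply D)) cluster_derivatives"
proof (rule inj_onI, rule blinfun_eqI)
  fix D D' a assume D: "D \<in> cluster_derivatives" "D' \<in> cluster_derivatives" "range (blinfun_apply D) = range (blinfun_apply D')"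
  then obtain b where b: "blinfun_apply D a = blinfun_apply D' b" by blast
  then have "a = b" using cluster_right_inverse[OF D(1), of a] cluster_right_inverse[OF D(2), of b] by simp
  with b show "blinfun_apply D a = blinfun_apply D' a" by simp
qed

lemma SC_singleton_iff_strict: "is_singleton (SC_limits DIM('a) \<Omega> (G w0)) \<longleftrightarrow> (\<exists>H. strict_derivative V G H w0)"
  unfolding SC_limits_eq strict_iff_unique_cluster is_singleton_altdef
  by (simp add: card_image[OF inj_on_range_cluster])

text \<open>Covers at once the case that the limiting normal cone is a subspace and the case that it is the convex cone of regular
normals: by the previous result it determines the cluster tangent space as its orthogonal complement, so there is
only one.\<close>

lemma limiting_add_imp_strict:
  assumes add: "\<And>u v. u \<in> limiting_normal_cone \<Omega> (G w0) \<Longrightarrow> v \<in> limiting_normal_cone \<Omega> (G w0) \<Longrightarrow> u + v \<in> limiting_normal_cone \<Omega> (G w0)"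
  shows "\<exists>H. strict_derivative V G H w0"
proof -
  have lin: "linear (blinfun_apply B)" for B :: "'a \<Rightarrow>\<^sub>L 'b" by (simp add: linear_conv_bounded_linear blinfun.bounded_linear_right)
  have "range (blinfun_apply D) = (limiting_normal_cone \<Omega> (G w0))\<^sup>\<bottom>" if D: "D \<in> cluster_derivatives" for D
  proof -
    have "limiting_normal_cone \<Omega> (G w0) = {v. \<forall>a. v \<bullet> blinfun_apply D a = 0}"
      by (rule limiting_normal_eq_cluster_perp[OF D]) (rule add)
    then have "limiting_normal_cone \<Omega> (G w0) = (range (blinfun_apply D))\<^sup>\<bottom>"
      by (auto simp: orthogonal_comp_iff)
    then show ?thesis
      using orthogonal_comp_self[OF range_derivative_subspace(1)[OF lin cluster_right_inverse[OF D]]] by simp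
  qed
  then have "D = D'" if "D \<in> cluster_derivatives" "D' \<in> cluster_derivatives" for D D'
    using inj_onD[OF inj_on_range_cluster] that by simp
  then have "is_singleton cluster_derivatives"
    using cluster_nonempty by (metis is_singletonI')
  then show ?thesis by (simp add: strict_iff_unique_cluster)
qed

lemma subspace_polar_range: "linear H \<Longrightarrow> subspace (polar (range H))"
  by (simp add: polar_range subspace_def inner_add_left)

lemma limiting_subspace_iff_strict:
  "subspace (limiting_normal_cone \<Omega> (G w0)) \<longleftrightarrow> (\<exists>H. strict_derivative V G H w0)"
proof
  assume "subspace (limiting_normal_cone \<Omega> (G w0))"
  then show "\<exists>H. strict_derivative V G H w0" by (intro limiting_add_imp_strict subspace_add)
next
  assume "\<exists>H. strict_derivative V G H w0"
  then obtain H where H: "strict_derivative V G H w0" by blast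
  then have "linear H" by (simp add: strict_derivative_def)
  then show "subspace (limiting_normal_cone \<Omega> (G w0))"
    unfolding limiting_normal_strict[OF H] by (rule subspace_polar_range)
qed

lemma regular_eq_limiting_iff_strict:
  "regular_normal_cone \<Omega> (G w0) = limiting_normal_cone \<Omega> (G w0) \<longleftrightarrow> (\<exists>H. strict_derivative V G H w0)"
proof
  assume eq: "regular_normal_cone \<Omega> (G w0) = limiting_normal_cone \<Omega> (G w0)"
  show "\<exists>H. strict_derivative V G H w0"
  proof (rule limiting_add_imp_strict)
    fix u v assume "u \<in> limiting_normal_cone \<Omega> (G w0)" "v \<in> limiting_normal_cone \<Omega> (G w0)"
    then show "u + v \<in> limiting_normal_cone \<Omega> (G w0)"
      unfolding eq[symmetric] regular_normal_cone_def polar_def by (auto simp: inner_add_left intro: add_nonpos_nonpos)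
  qed
qed (use limiting_normal_strict in auto)

lemma strict_identities:
  assumes H: "strict_derivative V G H w0"
  shows "tangent_cone \<Omega> (G w0) = range H" "limiting_normal_cone \<Omega> (G w0) = polar (range H)"
    "SC_limits DIM('a) \<Omega> (G w0) = {range H}"
proof -
  show "tangent_cone \<Omega> (G w0) = range H"
    by (rule tangent_cone_derivative[OF w0 strict_derivative_at_base[OF H]])
  obtain D where "blinfun_apply D = H" "cluster_derivatives = {D}" using cluster_eq_strict[OF H] .
  then show "SC_limits DIM('a) \<Omega> (G w0) = {range H}" by (simp add: SC_limits_eq)
qed (rule limiting_normal_strict(1)[OF H])

end

text \<open>The identity serves as coordinate change: with \<open>\<Phi> = id\<close> and \<open>K\<close> the orthogonal complement of the kernel of \<open>E\<close>, which is the range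
of the right inverse \<open>R\<close>, the set is the graph of \<open>v \<mapsto> G (E v) - v\<close> over \<open>K\<close>.\<close>

lemma strict_imp_graphically_strictly_differentiable:
  fixes F :: "'c::euclidean_space \<Rightarrow> 'd::euclidean_space set" and G :: "'a::euclidean_space \<Rightarrow> 'c \<times> 'd"
  assumes "lipschitz_chart (gph F) W V G E w0 C" and z: "G w0 = (x, y)"
    and R: "linear R" "\<And>w. E (R w) = w" "\<And>k w. E k = 0 \<Longrightarrow> k \<bullet> R w = 0"
    and sd: "strict_derivative V G H w0"
  shows "graphically_strictly_differentiable F x y"
proof -
  interpret lipschitz_chart "gph F" W V G E w0 C by fact
  define K where "K = range R"
  define U where "U = K \<inter> E -` V"
  define f where "f v = G (E v) - v" for v
  have RE: "R (E v) = v" if "v \<in> K" for v using that R(2) by (auto simp: K_def)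
  have H: "linear H" using sd by (simp add: strict_derivative_def)
  obtain B where B: "B > 0" "\<And>v. norm (E v) \<le> B * norm v"
    using bounded_linear.pos_bounded[OF bl_E] by (auto simp: mult.commute)
  have "subspace K" unfolding K_def by (rule linear_subspace_image[OF R(1) subspace_UNIV])
  moreover have "openin (top_of_set K) U"
    unfolding U_def by (intro continuous_openin_preimage_gen linear_continuous_on bl_E open_V)
  moreover have "f ` U \<subseteq> K\<^sup>\<bottom>"
  proof (rule image_subsetI)
    fix v assume v: "v \<in> U"
    have "E (f v) = 0" using v by (simp add: f_def U_def EG linear_diff[OF linear_E])
    then show "f v \<in> K\<^sup>\<bottom>" using R(3) by (auto simp: orthogonal_comp_iff K_def)
  qed
  moreover have "\<exists>C. C-lipschitz_on U f"
  proof (intro exI lipschitz_onI)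
    fix u v assume u: "u \<in> U" and v: "v \<in> U"
    have "dist (f u) (f v) \<le> norm (G (E u) - G (E v)) + norm (u - v)"
      unfolding dist_norm f_def using norm_triangle_ineq4[of "G (E u) - G (E v)" "u - v"] by (simp add: algebra_simps)
    also have "norm (G (E u) - G (E v)) \<le> C * norm (E u - E v)" using u v by (intro lipG) (auto simp: U_def)
    also have "E u - E v = E (u - v)" by (simp add: linear_diff[OF linear_E])
    also have "C * norm (E (u - v)) \<le> C * (B * norm (u - v))" by (intro mult_left_mono B C_nonneg)
    finally show "dist (f u) (f v) \<le> (C * B + 1) * dist u v" by (simp add: dist_norm algebra_simps)
  qed (use C_nonneg B in simp)
  moreover have "id ` (gph F \<inter> W) = {v + f v | v. v \<in> U}"
  proof -
    have "G w \<in> {v + f v | v. v \<in> U}" if "w \<in> V" for w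
      using that R(2) by (intro CollectI exI[of _ "R w"]) (simp add: U_def K_def f_def)
    moreover have "v + f v \<in> G ` V" if "v \<in> U" for v using that by (simp add: U_def f_def)
    ultimately show ?thesis unfolding chart by auto
  qed
  moreover have "R w0 \<in> U" "R w0 + f (R w0) = id (x, y)" using w0 R(2) z by (auto simp: U_def K_def f_def)
  moreover have "strictly_differentiable_in U f (R w0)"
    unfolding strictly_differentiable_in_iff
  proof (intro exI)
    show "strict_derivative U f (\<lambda>v. H (E v) - v) (R w0)"
      unfolding strict_derivative_def
    proof (intro conjI allI impI)
      show "linear (\<lambda>v. H (E v) - v)"
        by (rule linear_compose_sub[OF linear_compose[OF linear_E H, unfolded o_def] linear_ident])
      fix e :: real assume "e > 0"
      then have "e / B > 0" using B by simp
      then obtain d where d: "d > 0" "\<And>u v. u \<in> V \<inter> ball w0 d \<Longrightarrow> v \<in> V \<inter> ball w0 d \<Longrightarrow> norm (G v - G u - H (v - u)) \<le> e / B * norm (v - u)"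
        using sd unfolding strict_derivative_def by blast
      show "\<exists>d>0. \<forall>u\<in>U \<inter> ball (R w0) d. \<forall>v\<in>U \<inter> ball (R w0) d. norm (f v - f u - (H (E (v - u)) - (v - u))) \<le> e * norm (v - u)"
      proof (intro exI[of _ "d / B"] conjI ballI)
        fix u v assume u: "u \<in> U \<inter> ball (R w0) (d / B)" and v: "v \<in> U \<inter> ball (R w0) (d / B)"
        have near: "E x \<in> V \<inter> ball w0 d" if "x \<in> U \<inter> ball (R w0) (d / B)" for x
        proof -
          have "dist w0 (E x) = norm (E (R w0 - x))" by (simp add: linear_diff[OF linear_E] R(2) dist_norm)
          also have "\<dots> \<le> B * norm (R w0 - x)" by (rule B)
          also have "\<dots> < d" using that B by (simp add: dist_norm pos_less_divide_eq mult.commute)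
          finally show ?thesis using that by (simp add: U_def)
        qed
        have "f v - f u - (H (E (v - u)) - (v - u)) = G (E v) - G (E u) - H (E v - E u)"
          by (simp add: f_def linear_diff[OF linear_E])
        then have "norm (f v - f u - (H (E (v - u)) - (v - u))) = norm (G (E v) - G (E u) - H (E v - E u))"
          by (rule arg_cong)
        also have "\<dots> \<le> e / B * norm (E v - E u)" by (rule d(2)[OF near[OF u] near[OF v]])
        also have "E v - E u = E (v - u)" by (simp add: linear_diff[OF linear_E])
        also have "e / B * norm (E (v - u)) \<le> e / B * (B * norm (v - u))" using \<open>e / B > 0\<close> B by (intro mult_left_mono) auto
        finally show "norm (f v - f u - (H (E (v - u)) - (v - u))) \<le> e * norm (v - u)" using B by simp
      qed (use d B in simp)
    qed
  qed
  moreover have "continuously_differentiable_on_open W id \<and> continuously_differentiable_on_open (id ` W) (inv_into W id)"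
  proof
    have D: "(id has_derivative blinfun_apply (id_blinfun :: ('c \<times> 'd) \<Rightarrow>\<^sub>L ('c \<times> 'd))) (at z)" for z
      unfolding id_def blinfun_apply_id_blinfun by (rule has_derivative_ident)
    show "continuously_differentiable_on_open W id"
      unfolding continuously_differentiable_on_open_def
      by (rule conjI[OF open_W], rule exI[of _ "\<lambda>_. id_blinfun"]) (use D in simp)
    have "(inv_into W id has_derivative blinfun_apply (id_blinfun :: ('c \<times> 'd) \<Rightarrow>\<^sub>L ('c \<times> 'd))) (at z)" if z: "z \<in> W" for z
    proof (rule has_derivative_transform_within_open[OF D open_W z])
      fix u assume "u \<in> W"
      then show "id u = inv_into W id u" using inv_into_f_f[of id W u] by simp
    qed
    then show "continuously_differentiable_on_open (id ` W) (inv_into W id)"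
      unfolding continuously_differentiable_on_open_def image_id id_apply
      by (intro conjI open_W exI[of _ "\<lambda>_. id_blinfun"] ballI continuous_on_const)
  qed
  moreover have "(x, y) \<in> W" using G_in(2)[OF w0] z by simp
  ultimately show ?thesis
    unfolding graphically_strictly_differentiable_def using open_W
    by - (rule exI[of _ "dim K"], rule exI[of _ K], rule exI[of _ W], rule exI[of _ id],
        rule exI[of _ U], rule exI[of _ f], rule exI[of _ "R w0"], simp)
qed

section \<open>Second derivatives and lower semicontinuity\<close>

text \<open>The second difference of \<open>\<psi>\<close> in the directions \<open>a\<close>, \<open>b\<close> equals \<open>t\<^sup>2 * (A a \<bullet> b)\<close> up to a small error: apply the mean value
theorem in direction \<open>b\<close> and then the strict derivative \<open>A\<close> of the gradient in direction \<open>a\<close>.\<close>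

lemma mixed_difference_estimate:
  fixes \<psi> :: "'a::euclidean_space \<Rightarrow> real"
  assumes \<psi>: "\<And>w. w \<in> B \<Longrightarrow> (\<psi> has_derivative (\<lambda>h. P w \<bullet> h)) (at w)" and linA: "linear A" and t: "t > 0"
    and inB: "\<And>x. 0 \<le> x \<Longrightarrow> x \<le> t \<Longrightarrow> w0 + t *\<^sub>R a + x *\<^sub>R b \<in> B \<and> w0 + x *\<^sub>R b \<in> B"
    and strict: "\<And>u v. u \<in> B \<Longrightarrow> v \<in> B \<Longrightarrow> norm (P v - P u - A (v - u)) \<le> e * norm (v - u)"
  shows "\<bar>(\<psi> (w0 + t *\<^sub>R a + t *\<^sub>R b) - \<psi> (w0 + t *\<^sub>R b)) - (\<psi> (w0 + t *\<^sub>R a) - \<psi> w0) - t\<^sup>2 * (A a \<bullet> b)\<bar>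
    \<le> t\<^sup>2 * (e * norm a * norm b)"
proof -
  define q where "q x = \<psi> (w0 + t *\<^sub>R a + x *\<^sub>R b) - \<psi> (w0 + x *\<^sub>R b)" for x
  have line: "((\<lambda>x. \<psi> (c + x *\<^sub>R b)) has_real_derivative P (c + x *\<^sub>R b) \<bullet> b) (at x)" if "c + x *\<^sub>R b \<in> B" for c x
  proof -
    have "((\<lambda>x. \<psi> (c + x *\<^sub>R b)) has_derivative (\<lambda>s. P (c + x *\<^sub>R b) \<bullet> (s *\<^sub>R b))) (at x)"
      by (rule has_derivative_compose[of "\<lambda>x. c + x *\<^sub>R b" "\<lambda>s. s *\<^sub>R b" x UNIV \<psi>, OF _ \<psi>[OF that]])
        (auto intro!: derivative_eq_intros)
    moreover have "(\<lambda>s. P (c + x *\<^sub>R b) \<bullet> (s *\<^sub>R b)) = (*) (P (c + x *\<^sub>R b) \<bullet> b)" by (auto simp: mult.commute)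
    ultimately show ?thesis by (simp add: has_field_derivative_def)
  qed
  have "(q has_real_derivative (P (w0 + t *\<^sub>R a + x *\<^sub>R b) \<bullet> b - P (w0 + x *\<^sub>R b) \<bullet> b)) (at x)" if x: "0 \<le> x" "x \<le> t" for x
    unfolding q_def by (rule DERIV_diff[OF line line]) (use inB[OF x] in auto)
  from MVT2[OF t this]
  obtain z where z: "0 < z" "z < t" "q t - q 0 = (t - 0) * (P (w0 + t *\<^sub>R a + z *\<^sub>R b) \<bullet> b - P (w0 + z *\<^sub>R b) \<bullet> b)" by blast
  define u v where "u = w0 + z *\<^sub>R b" and "v = w0 + t *\<^sub>R a + z *\<^sub>R b"
  have "v - u = t *\<^sub>R a" by (simp add: u_def v_def)
  moreover have "u \<in> B" "v \<in> B" using inB[of z] z by (auto simp: u_def v_def)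
  ultimately have nb: "norm (P v - P u - t *\<^sub>R A a) \<le> e * (t * norm a)"
    using strict[of u v] t by (simp add: linear_scale[OF linA])
  have "q t - q 0 - t\<^sup>2 * (A a \<bullet> b) = t * ((P v - P u - t *\<^sub>R A a) \<bullet> b)"
    unfolding z(3) u_def v_def by (simp add: inner_diff_left power2_eq_square right_diff_distrib mult.assoc)
  then have "\<bar>q t - q 0 - t\<^sup>2 * (A a \<bullet> b)\<bar> = t * \<bar>(P v - P u - t *\<^sub>R A a) \<bullet> b\<bar>" using t by (simp add: abs_mult)
  also have "\<dots> \<le> t * (norm (P v - P u - t *\<^sub>R A a) * norm b)"
    using t by (intro mult_left_mono Cauchy_Schwarz_ineq2) auto
  also have "\<dots> \<le> t * (e * (t * norm a) * norm b)"
    using t nb by (intro mult_left_mono mult_right_mono) auto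
  also have "\<dots> = t\<^sup>2 * (e * norm a * norm b)" by (simp add: power2_eq_square mult_ac)
  finally show ?thesis by (simp add: q_def)
qed

text \<open>The second difference does not depend on the order of the two directions.\<close>

lemma symmetric_strict_derivative_of_gradient:
  fixes \<psi> :: "'a::euclidean_space \<Rightarrow> real"
  assumes V: "open V" "w0 \<in> V" and \<psi>: "\<And>w. w \<in> V \<Longrightarrow> (\<psi> has_derivative (\<lambda>h. P w \<bullet> h)) (at w)"
    and A: "strict_derivative V P A w0"
  shows "A a \<bullet> b = a \<bullet> A b"
proof -
  have linA: "linear A" using A by (simp add: strict_derivative_def)
  have close: "\<bar>A a \<bullet> b - A b \<bullet> a\<bar> \<le> 2 * e * norm a * norm b" if e: "e > 0" for e
  proof -
    obtain d1 where d1: "d1 > 0" "\<And>u v. u \<in> V \<inter> ball w0 d1 \<Longrightarrow> v \<in> V \<inter> ball w0 d1 \<Longrightarrow> norm (P v - P u - A (v - u)) \<le> e * norm (v - u)"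
      using A e unfolding strict_derivative_def by blast
    define B where "B = V \<inter> ball w0 d1"
    have "open B" "w0 \<in> B" using V d1(1) by (auto simp: B_def)
    then obtain d where d: "d > 0" "ball w0 d \<subseteq> B" using open_contains_ball by blast
    define s where "s = norm a + norm b + 1"
    define t where "t = d / (2 * s)"
    have s: "s > 0" by (simp add: s_def add_nonneg_pos)
    have t: "t > 0" using d s by (simp add: t_def)
    have "t * s = d / 2" using s by (simp add: t_def)
    then have small: "t * norm a + t * norm b < d" using d t by (simp add: s_def algebra_simps)
    have inB: "w0 + x *\<^sub>R a + y *\<^sub>R b \<in> B" if "0 \<le> x" "x \<le> t" "0 \<le> y" "y \<le> t" for x y
    proof -
      have "norm (x *\<^sub>R a + y *\<^sub>R b) \<le> norm (x *\<^sub>R a) + norm (y *\<^sub>R b)" by (rule norm_triangle_ineq)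
      also have "\<dots> = x * norm a + y * norm b" using that by simp
      also have "\<dots> \<le> t * norm a + t * norm b" using that by (intro add_mono mult_right_mono) auto
      also have "\<dots> < d" by (rule small)
      finally have "dist (w0 + (x *\<^sub>R a + y *\<^sub>R b)) w0 < d" by (simp add: dist_norm)
      then have "w0 + (x *\<^sub>R a + y *\<^sub>R b) \<in> ball w0 d" by (simp add: dist_commute)
      then show ?thesis using d(2) by (auto simp: add.assoc)
    qed
    have \<psi>B: "(\<psi> has_derivative (\<lambda>h. P w \<bullet> h)) (at w)" if "w \<in> B" for w
      using that \<psi> by (simp add: B_def)
    note d1B = d1(2)[folded B_def]
    define \<Delta> where "\<Delta> = \<psi> (w0 + t *\<^sub>R a + t *\<^sub>R b) - \<psi> (w0 + t *\<^sub>R a) - \<psi> (w0 + t *\<^sub>R b) + \<psi> w0"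
    have 1: "\<bar>\<Delta> - t\<^sup>2 * (A a \<bullet> b)\<bar> \<le> t\<^sup>2 * (e * norm a * norm b)"
    proof -
      have "w0 + t *\<^sub>R a + x *\<^sub>R b \<in> B \<and> w0 + x *\<^sub>R b \<in> B" if "0 \<le> x" "x \<le> t" for x
        using inB[of t x] inB[of 0 x] that t by simp
      from mixed_difference_estimate[OF \<psi>B linA t this d1B]
      show ?thesis by (simp add: \<Delta>_def)
    qed
    have 2: "\<bar>\<Delta> - t\<^sup>2 * (A b \<bullet> a)\<bar> \<le> t\<^sup>2 * (e * norm b * norm a)"
    proof -
      have "w0 + t *\<^sub>R b + x *\<^sub>R a \<in> B \<and> w0 + x *\<^sub>R a \<in> B" if "0 \<le> x" "x \<le> t" for x
        using inB[of x t] inB[of x 0] that t by (simp add: add_ac)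
      from mixed_difference_estimate[OF \<psi>B linA t this d1B]
      have "\<bar>(\<psi> (w0 + t *\<^sub>R b + t *\<^sub>R a) - \<psi> (w0 + t *\<^sub>R a)) - (\<psi> (w0 + t *\<^sub>R b) - \<psi> w0) - t\<^sup>2 * (A b \<bullet> a)\<bar>
        \<le> t\<^sup>2 * (e * norm b * norm a)" .
      moreover have "w0 + t *\<^sub>R b + t *\<^sub>R a = w0 + t *\<^sub>R a + t *\<^sub>R b" by simp
      ultimately show ?thesis by (simp add: \<Delta>_def)
    qed
    have "t\<^sup>2 * \<bar>A a \<bullet> b - A b \<bullet> a\<bar> = \<bar>t\<^sup>2 * (A a \<bullet> b) - t\<^sup>2 * (A b \<bullet> a)\<bar>"
      using t by (simp add: right_diff_distrib[symmetric] abs_mult)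
    also have "\<dots> \<le> t\<^sup>2 * (e * norm a * norm b) + t\<^sup>2 * (e * norm b * norm a)" using 1 2 by linarith
    also have "\<dots> = t\<^sup>2 * (2 * e * norm a * norm b)" by (simp add: algebra_simps)
    finally show ?thesis using t by simp
  qed
  have "\<bar>A a \<bullet> b - A b \<bullet> a\<bar> \<le> 0"
  proof (rule field_le_epsilon)
    fix e :: real assume e: "e > 0"
    have p: "norm a * norm b + 1 > 0" by (simp add: add_nonneg_pos)
    have "\<bar>A a \<bullet> b - A b \<bullet> a\<bar> \<le> 2 * (e / (2 * (norm a * norm b + 1))) * norm a * norm b" using e p by (intro close) simp
    also have "\<dots> = e / (norm a * norm b + 1) * (norm a * norm b)" using p by (simp add: field_simps)
    also have "\<dots> \<le> e / (norm a * norm b + 1) * (norm a * norm b + 1)" using e p by (intro mult_left_mono) auto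
    also have "\<dots> = 0 + e" using p by simp
    finally show "\<bar>A a \<bullet> b - A b \<bullet> a\<bar> \<le> 0 + e" .
  qed
  then show ?thesis by (simp add: inner_commute)
qed

lemma lsc_eventually:
  assumes "lsc \<phi>" "c < \<phi> x"
  shows "\<forall>\<^sub>F y in nhds x. c < \<phi> y"
proof -
  have "c < Liminf (at x) \<phi>" using assms by (auto simp: lsc_def intro: less_le_trans)
  then have "\<forall>\<^sub>F y in at x. c < \<phi> y" by (rule less_LiminfD)
  then show ?thesis using assms(2) by (simp add: eventually_nhds_conv_at)
qed

lemma lsc_attains_inf:
  fixes g :: "'a::metric_space \<Rightarrow> ereal"
  assumes lsc: "\<And>x c. c < g x \<Longrightarrow> \<forall>\<^sub>F y in nhds x. c < g y" and K: "compact K" "K \<noteq> {}"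
  shows "\<exists>x\<in>K. \<forall>y\<in>K. g x \<le> g y"
proof -
  have "g ` K \<noteq> {}" using K by simp
  from Inf_as_limit[OF this]
  obtain u where u: "\<And>n. u n \<in> g ` K" "u \<longlonglongrightarrow> Inf (g ` K)" by blast
  then have "\<forall>n. \<exists>x\<in>K. u n = g x" by blast
  then obtain x where x: "\<And>n. x n \<in> K" "\<And>n. u n = g (x n)" by metis
  obtain l r where l: "l \<in> K" "strict_mono r" "(x \<circ> r) \<longlonglongrightarrow> l"
    using K(1) x(1) unfolding compact_def by blast
  have "g l \<le> Inf (g ` K)"
  proof (rule ccontr)
    assume "\<not> g l \<le> Inf (g ` K)"
    then obtain c where c: "Inf (g ` K) < c" "c < g l" using dense by (metis not_le)
    have "\<forall>\<^sub>F k in sequentially. c < g (x (r k))"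
      using eventually_compose_filterlim[OF lsc[OF c(2)] l(3)] by (simp add: o_def)
    moreover have "\<forall>\<^sub>F k in sequentially. g (x (r k)) < c"
      using order_tendstoD(2)[OF LIMSEQ_subseq_LIMSEQ[OF u(2) l(2)] c(1)] x(2) by (simp add: o_def)
    ultimately have "\<forall>\<^sub>F k in sequentially. False" by eventually_elim simp
    then show False by simp
  qed
  then show ?thesis using l(1) by (meson INF_lower order_trans)
qed

text \<open>A quadratic error is \<open>o(norm (y - x))\<close>.\<close>

lemma proximal_imp_regular_subdifferential:
  fixes \<phi> :: "'a::euclidean_space \<Rightarrow> ereal"
  assumes fin: "\<bar>\<phi> x\<bar> \<noteq> \<infinity>" and "open U" "x \<in> U" "c \<ge> 0"
    and prox: "\<And>y. y \<in> U \<Longrightarrow> \<phi> x + ereal (x' \<bullet> (y - x) - c * (norm (y - x))\<^sup>2) \<le> \<phi> y"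
  shows "x' \<in> regular_subdifferential \<phi> x"
proof -
  obtain a where a: "\<phi> x = ereal a" using fin by (cases "\<phi> x") auto
  have "0 \<le> Liminf (at x) (\<lambda>y. (\<phi> y - \<phi> x - ereal (x' \<bullet> (y - x))) / ereal (norm (y - x)))"
    unfolding le_Liminf_iff
  proof (intro allI impI)
    fix b :: ereal assume b: "b < 0"
    then obtain e where e: "b < ereal e" "ereal e < 0" using ereal_dense2 by blast
    have e0: "e < 0" using e(2) by simp
    define \<delta> where "\<delta> = - e / (c + 1)"
    have \<delta>: "\<delta> > 0" unfolding \<delta>_def using e0 \<open>c \<ge> 0\<close> by (intro divide_pos_pos) auto
    have "\<forall>\<^sub>F y in at x. y \<in> U" using assms(2,3) by (intro eventually_at_in_open') auto
    moreover have "\<forall>\<^sub>F y in at x. y \<noteq> x \<and> dist y x < \<delta>" using \<delta> by (auto simp: eventually_at)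
    ultimately show "\<forall>\<^sub>F y in at x. b < (\<phi> y - \<phi> x - ereal (x' \<bullet> (y - x))) / ereal (norm (y - x))"
    proof eventually_elim
      case (elim y)
      define n where "n = norm (y - x)"
      have n: "n > 0" "n < \<delta>" using elim by (auto simp: n_def dist_norm)
      show ?case
      proof (cases "\<phi> y")
        case (real p)
        have "a + (x' \<bullet> (y - x) - c * n\<^sup>2) \<le> p" using prox[OF elim(1)] by (simp add: a real n_def)
        then have "- c * n\<^sup>2 \<le> p - a - x' \<bullet> (y - x)" by simp
        then have "- c * n \<le> (p - a - x' \<bullet> (y - x)) / n" using n by (simp add: pos_le_divide_eq power2_eq_square)
        moreover have "c * n < - e"
        proof -
          have "c * n \<le> c * \<delta>" using n \<open>c \<ge> 0\<close> by (intro mult_left_mono) auto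
          also have "\<dots> < (c + 1) * \<delta>" using \<delta> by simp
          also have "\<dots> = - e" using \<open>c \<ge> 0\<close> by (simp add: \<delta>_def)
          finally show ?thesis .
        qed
        ultimately have "e < (p - a - x' \<bullet> (y - x)) / n" by simp
        then have "ereal e < (\<phi> y - \<phi> x - ereal (x' \<bullet> (y - x))) / ereal (norm (y - x))"
          using n by (simp add: a real n_def)
        then show ?thesis using e(1) by (rule less_trans[rotated])
      next
        case PInf
        then have "(\<phi> y - \<phi> x - ereal (x' \<bullet> (y - x))) / ereal (norm (y - x)) = \<infinity>"
          using n by (simp add: a n_def)
        then show ?thesis using b by auto
      next
        case MInf
        then show ?thesis using prox[OF elim(1)] by (simp add: a)
      qed
    qed
  qed
  then show ?thesis using a by (simp add: regular_subdifferential_def)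
qed

lemma regular_subset_limiting_subdifferential:
  "regular_subdifferential \<phi> x \<subseteq> limiting_subdifferential \<phi> x"
proof
  fix x' assume x': "x' \<in> regular_subdifferential \<phi> x"
  then have "\<phi> x < \<infinity>" by (simp add: regular_subdifferential_def)
  with x' show "x' \<in> limiting_subdifferential \<phi> x"
    unfolding limiting_subdifferential_def
    by (intro CollectI conjI exI[of _ "\<lambda>_. x"] exI[of _ "\<lambda>_. x'"]) auto
qed

section \<open>Attentive objects as objects of the localized graph\<close>

text \<open>The set \<open>\<Omega>\<close> defined below is the graph of the attentive localization, and all
attentive objects turn out to be the ordinary objects of the set \<open>\<Omega>\<close>.\<close>

locale prox_regular_function =
  fixes \<phi> :: "'a::euclidean_space \<Rightarrow> ereal" and xbar xbar' :: 'a and r \<epsilon> :: real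
  assumes proper: "\<And>x. \<phi> x \<noteq> -\<infinity>" and lsc: "lsc \<phi>" and prox: "prox_regular \<phi> xbar xbar' r \<epsilon>"
begin

definition "\<Omega> = gph (attentive_localization \<phi> xbar xbar' \<epsilon>)"

lemma r: "r \<ge> 0" and eps: "\<epsilon> > 0" and fin_xbar: "\<bar>\<phi> xbar\<bar> \<noteq> \<infinity>" and xbar': "xbar' \<in> limiting_subdifferential \<phi> xbar"
  using prox by (auto simp: prox_regular_def)

lemma mem_\<Omega>: "(x, x') \<in> \<Omega> \<longleftrightarrow> x' \<in> limiting_subdifferential \<phi> x \<and> x \<in> ball xbar \<epsilon> \<and> x' \<in> ball xbar' \<epsilon> \<and> \<phi> x < \<phi> xbar + ereal \<epsilon>"
  by (auto simp: \<Omega>_def gph_def attentive_localization_def)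

lemma \<Omega>_subset: "\<Omega> \<subseteq> gph (limiting_subdifferential \<phi>)"
  by (auto simp: \<Omega>_def gph_def attentive_localization_def)

lemma fin_\<Omega>: "(x, x') \<in> \<Omega> \<Longrightarrow> \<bar>\<phi> x\<bar> \<noteq> \<infinity>"
  using proper[of x] by (auto simp: mem_\<Omega> limiting_subdifferential_def)

definition rphi :: "'a \<Rightarrow> real" where "rphi x = real_of_ereal (\<phi> x)"

lemma phi_\<Omega>: "(x, x') \<in> \<Omega> \<Longrightarrow> \<phi> x = ereal (rphi x)"
  using fin_\<Omega> by (simp add: rphi_def ereal_real)

lemma phi_xbar: "\<phi> xbar = ereal (rphi xbar)"
  using fin_xbar by (simp add: rphi_def ereal_real)

lemma zbar_in: "(xbar, xbar') \<in> \<Omega>"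
  using eps xbar' by (simp add: mem_\<Omega> phi_xbar)

lemma prox_ereal:
  assumes "(x, x') \<in> \<Omega>" "y \<in> ball xbar \<epsilon>"
  shows "\<phi> x + ereal (x' \<bullet> (y - x)) - ereal (r / 2 * (norm (y - x))\<^sup>2) \<le> \<phi> y"
  using prox assms unfolding prox_regular_def mem_\<Omega> gph_def by blast

lemma prox_real:
  assumes "(x, x') \<in> \<Omega>" "(y, y') \<in> \<Omega>"
  shows "rphi x + x' \<bullet> (y - x) - r / 2 * (norm (y - x))\<^sup>2 \<le> rphi y"
  using prox_ereal[OF assms(1), of y] assms(2) by (simp add: phi_\<Omega>[OF assms(1)] phi_\<Omega>[OF assms(2)]) (simp add: mem_\<Omega>)

lemma attentive_convD:
  assumes "attentive_conv \<phi> zk z" "z \<in> \<Omega>"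
  shows "zk \<longlonglongrightarrow> z" "\<forall>\<^sub>F k in sequentially. zk k \<in> \<Omega>"
proof -
  show lim: "zk \<longlonglongrightarrow> z" using assms(1) by (simp add: attentive_conv_def)
  obtain x x' where z: "z = (x, x')" by (cases z)
  have zx: "x \<in> ball xbar \<epsilon>" "x' \<in> ball xbar' \<epsilon>" "\<phi> x < \<phi> xbar + ereal \<epsilon>" using assms(2) by (simp_all add: z mem_\<Omega>)
  have "\<forall>\<^sub>F k in sequentially. fst (zk k) \<in> ball xbar \<epsilon>"
    using topological_tendstoD[OF tendsto_fst[OF lim] open_ball] zx by (simp add: z)
  moreover have "\<forall>\<^sub>F k in sequentially. snd (zk k) \<in> ball xbar' \<epsilon>"
    using topological_tendstoD[OF tendsto_snd[OF lim] open_ball] zx by (simp add: z)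
  moreover have "\<forall>\<^sub>F k in sequentially. \<phi> (fst (zk k)) < \<phi> xbar + ereal \<epsilon>"
    using assms(1) zx by (intro order_tendstoD) (auto simp: attentive_conv_def z)
  ultimately show "\<forall>\<^sub>F k in sequentially. zk k \<in> \<Omega>"
  proof eventually_elim
    case (elim k)
    moreover have "zk k \<in> gph (limiting_subdifferential \<phi>)" using assms(1) by (simp add: attentive_conv_def)
    ultimately show ?case by (cases "zk k") (simp add: mem_\<Omega> gph_def)
  qed
qed

text \<open>On \<open>\<Omega>\<close> convergence implies convergence of the function values: lower semicontinuity bounds them from below, and the
prox-regularity inequality with the limit point as test point bounds them from above.\<close>

lemma attentive_convI:
  assumes zk: "\<And>k. zk k \<in> \<Omega>" and lim: "zk \<longlonglongrightarrow> z" and z: "z \<in> \<Omega>"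
  shows "attentive_conv \<phi> zk z"
proof -
  obtain x x' where zx: "z = (x, x')" by (cases z)
  define xk xk' where "xk k = fst (zk k)" and "xk' k = snd (zk k)" for k
  have m: "(xk k, xk' k) \<in> \<Omega>" for k using zk by (simp add: xk_def xk'_def)
  have lx: "xk \<longlonglongrightarrow> x" and lx': "xk' \<longlonglongrightarrow> x'"
    using tendsto_fst[OF lim] tendsto_snd[OF lim] by (simp_all add: zx xk_def[abs_def] xk'_def[abs_def])
  have "(\<lambda>k. \<phi> (xk k)) \<longlonglongrightarrow> \<phi> x"
  proof (rule order_tendstoI)
    fix c assume "c < \<phi> x"
    from eventually_compose_filterlim[OF lsc_eventually[OF lsc this] lx]
    show "\<forall>\<^sub>F k in sequentially. c < \<phi> (xk k)" .
  next
    fix c assume c: "\<phi> x < c"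
    have "(\<lambda>k. rphi x - xk' k \<bullet> (x - xk k) + r / 2 * (norm (x - xk k))\<^sup>2) \<longlonglongrightarrow> rphi x - x' \<bullet> (x - x) + r / 2 * (norm (x - x))\<^sup>2"
      by (intro tendsto_intros lx lx')
    then have "(\<lambda>k. ereal (rphi x - xk' k \<bullet> (x - xk k) + r / 2 * (norm (x - xk k))\<^sup>2)) \<longlonglongrightarrow> \<phi> x"
      using phi_\<Omega> z by (simp add: zx)
    from order_tendstoD(2)[OF this c]
    show "\<forall>\<^sub>F k in sequentially. \<phi> (xk k) < c"
    proof eventually_elim
      case (elim k)
      have "rphi (xk k) \<le> rphi x - xk' k \<bullet> (x - xk k) + r / 2 * (norm (x - xk k))\<^sup>2"
        using prox_real[OF m[of k], of x x'] z by (simp add: zx)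
      then have "\<phi> (xk k) \<le> ereal (rphi x - xk' k \<bullet> (x - xk k) + r / 2 * (norm (x - xk k))\<^sup>2)"
        by (simp add: phi_\<Omega>[OF m])
      then show ?case using elim by (rule le_less_trans)
    qed
  qed
  then show ?thesis
    using zk \<Omega>_subset lim by (auto simp: attentive_conv_def zx xk_def[abs_def])
qed

lemma attentive_tangent_eq:
  assumes z: "z \<in> \<Omega>"
  shows "attentive_tangent_cone \<phi> z = tangent_cone \<Omega> z"
proof (intro equalityI subsetI)
  fix w assume "w \<in> attentive_tangent_cone \<phi> z"
  then obtain t zk where t: "\<And>k. t k > 0" "t \<longlonglongrightarrow> 0" and zk: "attentive_conv \<phi> zk z"
    and lim: "(\<lambda>k. (zk k - z) /\<^sub>R t k) \<longlonglongrightarrow> w" by (auto simp: attentive_tangent_cone_def)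
  show "w \<in> tangent_cone \<Omega> z"
    unfolding tangent_cone_def
  proof (rule outer_limitI[OF _ _ lim])
    show "filterlim t (at_right 0) sequentially" using t by (simp add: filterlim_at_right_0_iff)
    show "\<forall>\<^sub>F k in sequentially. (zk k - z) /\<^sub>R t k \<in> diff_quot_set \<Omega> z (t k)"
      using attentive_convD(2)[OF zk z]
    proof eventually_elim
      case (elim k)
      then show ?case using t(1)[of k] by (simp add: diff_quot_set_iff)
    qed
  qed
next
  fix w assume "w \<in> tangent_cone \<Omega> z"
  then obtain t v where t: "t \<longlonglongrightarrow> 0" "\<forall>\<^sub>F k in sequentially. t k > 0"
    and v: "\<And>k. v k \<in> diff_quot_set \<Omega> z (t k)" "v \<longlonglongrightarrow> w"
    by (auto simp: tangent_cone_def outer_limit_def filterlim_at_right_0_iff)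
  obtain N where N: "\<And>k. k \<ge> N \<Longrightarrow> t k > 0" using t(2) by (auto simp: eventually_sequentially)
  define s u where "s k = t (k + N)" and "u k = v (k + N)" for k
  have s: "s k > 0" for k using N by (simp add: s_def)
  have slim: "s \<longlonglongrightarrow> 0" and ulim: "u \<longlonglongrightarrow> w"
    unfolding s_def u_def using t(1) v(2) by (auto intro: LIMSEQ_ignore_initial_segment)
  have in\<Omega>: "z + s k *\<^sub>R u k \<in> \<Omega>" for k
    using v(1)[of "k + N"] s[of k] by (simp add: s_def u_def diff_quot_set_iff)
  have lim: "(\<lambda>k. z + s k *\<^sub>R u k) \<longlonglongrightarrow> z"
    using tendsto_add[OF tendsto_const tendsto_scaleR[OF slim ulim]] by simp
  have "(z + s k *\<^sub>R u k - z) /\<^sub>R s k = u k" for k using s[of k] by simp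
  with ulim show "w \<in> attentive_tangent_cone \<phi> z"
    unfolding attentive_tangent_cone_def using s slim attentive_convI[OF in\<Omega> lim z]
    by (intro CollectI exI[of _ s] exI[of _ "\<lambda>k. z + s k *\<^sub>R u k"]) simp
qed

lemma attentive_regular_eq: "z \<in> \<Omega> \<Longrightarrow> attentive_regular_normal_cone \<phi> z = regular_normal_cone \<Omega> z"
  by (simp add: attentive_regular_normal_cone_def regular_normal_cone_def attentive_tangent_eq)

lemma attentive_normal_eq:
  assumes z: "z \<in> \<Omega>"
  shows "attentive_normal_cone \<phi> z = limiting_normal_cone \<Omega> z"
proof (intro equalityI subsetI)
  fix v assume "v \<in> attentive_normal_cone \<phi> z"
  then obtain zk vk where zk: "attentive_conv \<phi> zk z" and vk: "\<And>k. vk k \<in> attentive_regular_normal_cone \<phi> (zk k)" "vk \<longlonglongrightarrow> v"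
    by (auto simp: attentive_normal_cone_def)
  note c = attentive_convD[OF zk z]
  show "v \<in> limiting_normal_cone \<Omega> z"
    unfolding limiting_normal_cone_def
  proof (rule outer_limitI[OF _ _ vk(2)])
    show "filterlim zk (nhds_in \<Omega> z) sequentially" using c by (simp add: filterlim_nhds_in)
    show "\<forall>\<^sub>F k in sequentially. vk k \<in> regular_normal_cone \<Omega> (zk k)"
      using c(2)
    proof eventually_elim
      case (elim k)
      then show ?case using vk(1)[of k] by (simp add: attentive_regular_eq)
    qed
  qed
next
  fix v assume "v \<in> limiting_normal_cone \<Omega> z"
  then obtain p vk where p: "p \<longlonglongrightarrow> z" "\<forall>\<^sub>F k in sequentially. p k \<in> \<Omega>"
    and vk: "\<And>k. vk k \<in> regular_normal_cone \<Omega> (p k)" "vk \<longlonglongrightarrow> v"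
    by (auto simp: limiting_normal_cone_def outer_limit_def filterlim_nhds_in)
  obtain N where N: "\<And>k. k \<ge> N \<Longrightarrow> p k \<in> \<Omega>" using p(2) by (auto simp: eventually_sequentially)
  have N': "p (k + N) \<in> \<Omega>" for k using N by simp
  have "attentive_conv \<phi> (\<lambda>k. p (k + N)) z"
    by (rule attentive_convI[OF N' LIMSEQ_ignore_initial_segment[OF p(1)] z])
  then show "v \<in> attentive_normal_cone \<phi> z"
    unfolding attentive_normal_cone_def
    using vk(1) LIMSEQ_ignore_initial_segment[OF vk(2), of N]
    by (intro CollectI exI[of _ "\<lambda>k. p (k + N)"] exI[of _ "\<lambda>k. vk (k + N)"]) (simp add: attentive_regular_eq[OF N'])
qed

lemma SC_derivative_eq:
  assumes z: "z \<in> \<Omega>"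
  shows "SC_derivative \<phi> z = SC_limits DIM('a) \<Omega> z"
proof (intro equalityI subsetI)
  fix L assume "L \<in> SC_derivative \<phi> z"
  then obtain zk where L: "subspace L" "dim L = DIM('a)" and zk: "\<And>k. attentive_tangent_cone \<phi> (zk k) \<in> subspaces_nn"
    and conv: "attentive_conv \<phi> zk z" and d: "(\<lambda>k. subspace_dist L (attentive_tangent_cone \<phi> (zk k))) \<longlonglongrightarrow> 0"
    by (auto simp: SC_derivative_def attentive_smooth_points_def subspaces_nn_def)
  note c = attentive_convD[OF conv z]
  obtain N where N: "\<And>k. k \<ge> N \<Longrightarrow> zk k \<in> \<Omega>" using c(2) by (auto simp: eventually_sequentially)
  have N': "zk (k + N) \<in> \<Omega>" for k using N by simp
  have T: "attentive_tangent_cone \<phi> (zk (k + N)) = tangent_cone \<Omega> (zk (k + N))" for k by (rule attentive_tangent_eq[OF N'])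
  have "(\<lambda>k. subspace_dist L (tangent_cone \<Omega> (zk (k + N)))) \<longlonglongrightarrow> 0"
    using LIMSEQ_ignore_initial_segment[OF d, of N] by (simp add: T)
  then show "L \<in> SC_limits DIM('a) \<Omega> z"
    unfolding SC_limits_def using L N' LIMSEQ_ignore_initial_segment[OF c(1), of N] zk[of "_ + N"]
    by (intro CollectI conjI exI[of _ "\<lambda>k. zk (k + N)"]) (auto simp: T subspaces_nn_def)
next
  fix L assume "L \<in> SC_limits DIM('a) \<Omega> z"
  then obtain zk where L: "subspace L" "dim L = DIM('a)" and zk: "\<And>k. zk k \<in> \<Omega>"
    "\<And>k. subspace (tangent_cone \<Omega> (zk k))" "\<And>k. dim (tangent_cone \<Omega> (zk k)) = DIM('a)"
    and lim: "zk \<longlonglongrightarrow> z" and d: "(\<lambda>k. subspace_dist L (tangent_cone \<Omega> (zk k))) \<longlonglongrightarrow> 0"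
    unfolding SC_limits_def by blast
  have T: "attentive_tangent_cone \<phi> (zk k) = tangent_cone \<Omega> (zk k)" for k by (rule attentive_tangent_eq[OF zk(1)])
  show "L \<in> SC_derivative \<phi> z"
    unfolding SC_derivative_def attentive_smooth_points_def subspaces_nn_def
    using L zk d attentive_convI[OF zk(1) lim z] \<Omega>_subset
    by (intro CollectI conjI exI[of _ zk]) (auto simp: T)
qed

end

lemma in_adjoint_subspace_iff: "(u, u') \<in> adjoint_subspace L \<longleftrightarrow> (\<forall>(a, b)\<in>L. u' \<bullet> a - u \<bullet> b = 0)"
  by (auto simp: adjoint_subspace_def orthogonal_comp_iff inner_diff_left)

section \<open>The proximal map parametrizes the localized graph\<close>

context prox_regular_function
begin

text \<open>The step size of the proximal map. Any positive value with \<open>lam * r < 1\<close> would give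
the map \<open>E\<close> below a Lipschitz inverse on \<open>\<Omega>\<close>; the bound \<open>1 / 2\<close> keeps the constants simple.\<close>

definition lam :: real where "lam = 1 / (2 * (r + 1))"

lemma lam: "lam > 0" "lam * r \<le> 1 / 2" "1 / (2 * lam) = r + 1"
  using r by (auto simp: lam_def field_simps)

text \<open>On \<open>\<Omega>\<close> this is the resolvent relation: \<open>E (x, x') = w\<close> means \<open>x' = (w - x) / lam\<close>, the optimality condition for
minimizing \<open>\<phi> y + (norm (y - w))\<^sup>2 / (2 * lam)\<close>.\<close>

definition E :: "'a \<times> 'a \<Rightarrow> 'a" where "E z = fst z + lam *\<^sub>R snd z"

definition w0 :: 'a where "w0 = E (xbar, xbar')"

definition C :: real where "C = 2 + 3 / lam"

lemma linear_E: "linear E"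
  unfolding E_def by (rule linearI) (auto simp: algebra_simps)

lemma hypomonotone:
  assumes "(x1, x1') \<in> \<Omega>" "(x2, x2') \<in> \<Omega>"
  shows "(x1' - x2') \<bullet> (x1 - x2) \<ge> - r * (norm (x1 - x2))\<^sup>2"
  using prox_real[OF assms] prox_real[OF assms(2,1)]
  by (simp add: inner_diff_left inner_diff_right norm_minus_commute)

text \<open>Prox-regularity makes the localization monotone up to \<open>r\<close>, and a small step \<open>lam\<close> compensates the defect. Hence \<open>\<Omega>\<close> is
parametrized by \<open>E\<close> with a Lipschitz inverse.\<close>

lemma E_expansive:
  assumes z: "z1 \<in> \<Omega>" "z2 \<in> \<Omega>"
  shows "norm (z1 - z2) \<le> C * norm (E z1 - E z2)"
proof -
  obtain x1 x1' x2 x2' where zz: "z1 = (x1, x1')" "z2 = (x2, x2')" by (metis prod.exhaust)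
  define d d' w where "d = x1 - x2" and "d' = x1' - x2'" and "w = E z1 - E z2"
  have w: "w = d + lam *\<^sub>R d'" by (simp add: w_def E_def zz d_def d'_def algebra_simps)
  have mono: "d' \<bullet> d \<ge> - r * (norm d)\<^sup>2" using hypomonotone z by (simp add: zz d_def d'_def)
  have "lam * (- r * (norm d)\<^sup>2) \<le> lam * (d' \<bullet> d)" using mono lam(1) by (intro mult_left_mono) auto
  moreover have "lam * r * (norm d)\<^sup>2 \<le> 1 / 2 * (norm d)\<^sup>2" using lam(2) by (intro mult_right_mono) auto
  moreover have "w \<bullet> d = (norm d)\<^sup>2 + lam * (d' \<bullet> d)" by (simp add: w inner_add_left dot_square_norm)
  ultimately have "(norm d)\<^sup>2 / 2 \<le> w \<bullet> d" by (simp add: mult.assoc)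
  also have "\<dots> \<le> norm w * norm d" by (rule norm_cauchy_schwarz)
  finally have nd: "norm d \<le> 2 * norm w" by (cases "norm d = 0") (auto simp: power2_eq_square)
  have "lam * norm d' = norm (w - d)" using lam(1) by (simp add: w)
  also have "\<dots> \<le> norm w + norm d" by (rule norm_triangle_ineq4)
  finally have "lam * norm d' \<le> 3 * norm w" using nd by simp
  then have nd': "norm d' \<le> 3 / lam * norm w" using lam(1) by (simp add: pos_le_divide_eq mult.commute)
  have "norm (z1 - z2) \<le> norm d + norm d'"
    unfolding zz norm_Pair diff_Pair d_def d'_def by (rule sqrt_sum_squares_le_sum) auto
  with nd nd' show ?thesis by (simp add: C_def w_def algebra_simps)
qed

lemma inj_E: "inj_on E \<Omega>"
proof (rule inj_onI)
  fix z1 z2 assume "z1 \<in> \<Omega>" "z2 \<in> \<Omega>" "E z1 = E z2"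
  with E_expansive[of z1 z2] show "z1 = z2" by simp
qed

lemma prox_minimizer:
  assumes \<rho>: "0 < \<rho>" "\<rho> < \<epsilon>"
  obtains x where "x \<in> cball xbar \<rho>" "\<And>y. y \<in> cball xbar \<rho> \<Longrightarrow>
    \<phi> x + ereal ((norm (x - w))\<^sup>2 / (2 * lam)) \<le> \<phi> y + ereal ((norm (y - w))\<^sup>2 / (2 * lam))"
proof -
  define g where "g y = \<phi> y + ereal ((norm (y - w))\<^sup>2 / (2 * lam))" for y
  have "\<exists>x\<in>cball xbar \<rho>. \<forall>y\<in>cball xbar \<rho>. g x \<le> g y"
  proof (rule lsc_attains_inf)
    fix x c assume c: "c < g x"
    show "\<forall>\<^sub>F y in nhds x. c < g y"
    proof (cases c)
      case (real c')
      define q where "q y = (norm (y - w))\<^sup>2 / (2 * lam)" for y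
      have "ereal (c' - q x) < \<phi> x"
        using c by (cases "\<phi> x") (auto simp: g_def q_def real)
      then obtain b where b: "ereal (c' - q x) < ereal b" "ereal b < \<phi> x" using ereal_dense2 by blast
      have "\<forall>\<^sub>F y in nhds x. ereal b < \<phi> y" by (rule lsc_eventually[OF lsc b(2)])
      moreover have "\<forall>\<^sub>F y in nhds x. c' - b < q y"
      proof -
        have "isCont q x" unfolding q_def by (intro continuous_intros) (use lam in auto)
        then have "(q \<longlongrightarrow> q x) (nhds x)" by (simp add: isCont_def tendsto_at_iff_tendsto_nhds)
        then show ?thesis using b(1) by (intro order_tendstoD) auto
      qed
      ultimately show ?thesis
      proof eventually_elim
        case (elim y)
        then show ?case by (cases "\<phi> y") (auto simp: g_def q_def[symmetric] real)
      qed
    next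
      case MInf
      have "c < g y" for y using proper[of y] by (cases "\<phi> y") (auto simp: g_def MInf)
      then show ?thesis by simp
    qed (use c in auto)
  qed (use \<rho> in auto)
  then show ?thesis using that unfolding g_def by blast
qed

text \<open>The parametrization covers a whole neighbourhood of \<open>w0\<close>. For \<open>w = w0 + e\<close> minimize \<open>\<phi> y + (norm (y - w))\<^sup>2 / (2 * lam)\<close> over a ball around \<open>xbar\<close>.
Comparing the minimizer \<open>x\<close> with \<open>xbar\<close> and using the prox-regularity inequality at \<open>xbar\<close> gives \<open>norm (x - xbar) \<le> 4 * norm e\<close>.
So \<open>x\<close> is an interior point, \<open>(w - x) / lam\<close> is a proximal subgradient there, and the pair satisfies all conditions of the localization when \<open>e\<close>
is small.\<close>

lemma prox_point_exists:
  "\<exists>\<delta>>0. \<forall>w\<in>ball w0 \<delta>. \<exists>z\<in>\<Omega>. E z = w"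
proof -
  define \<rho> where "\<rho> = \<epsilon> / 2"
  have \<rho>: "0 < \<rho>" "\<rho> < \<epsilon>" using eps by (auto simp: \<rho>_def)
  define M where "M = lam * norm xbar' + 1"
  have M: "M > 0" using lam(1) by (simp add: M_def add_nonneg_pos)
  \<comment> \<open>The four bounds ensure, in this order, \<open>norm e < 1\<close>, that \<open>x\<close> is interior, that \<open>x'\<close> is close to \<open>xbar'\<close>, and that \<open>\<phi> x < \<phi> xbar + \<epsilon>\<close>.\<close>
  define \<delta> where "\<delta> = min (min 1 (\<rho> / 4)) (min (\<epsilon> * lam / 5) (\<epsilon> * lam / (4 * M)))"
  have \<delta>: "\<delta> > 0" using \<rho> eps lam(1) M by (simp add: \<delta>_def)
  have "\<exists>z\<in>\<Omega>. E z = w" if w: "w \<in> ball w0 \<delta>" for w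
  proof -
    define e where "e = w - w0"
    have ne: "norm e < \<delta>" using w by (simp add: e_def dist_norm norm_minus_commute)
    then have e1: "norm e < 1" "4 * norm e < \<rho>" "5 * norm e < \<epsilon> * lam" and e2: "norm e < \<epsilon> * lam / (4 * M)"
      by (auto simp: \<delta>_def)
    obtain x where x: "x \<in> cball xbar \<rho>" and min: "\<And>y. y \<in> cball xbar \<rho> \<Longrightarrow>
      \<phi> x + ereal ((norm (x - w))\<^sup>2 / (2 * lam)) \<le> \<phi> y + ereal ((norm (y - w))\<^sup>2 / (2 * lam))"
      using prox_minimizer[OF \<rho>] by blast
    define d where "d = x - xbar"
    have wd: "w = xbar + lam *\<^sub>R xbar' + e" by (simp add: e_def w0_def E_def)
    have minb: "\<phi> x + ereal ((norm (x - w))\<^sup>2 / (2 * lam)) \<le> ereal (rphi xbar + (norm (xbar - w))\<^sup>2 / (2 * lam))"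
      using min[of xbar] \<rho> by (simp add: phi_xbar)
    obtain p where p: "\<phi> x = ereal p" using minb proper[of x] by (cases "\<phi> x") auto
    have xb: "x \<in> ball xbar \<epsilon>" using x \<rho> by auto
    have low: "rphi xbar + xbar' \<bullet> d - r / 2 * (norm d)\<^sup>2 \<le> p"
      using prox_ereal[OF zbar_in xb] by (simp add: p phi_xbar d_def)
    have up: "p + (norm (x - w))\<^sup>2 / (2 * lam) \<le> rphi xbar + (norm (xbar - w))\<^sup>2 / (2 * lam)"
      using minb by (simp add: p)
    have sq: "(norm (x - w))\<^sup>2 - (norm (xbar - w))\<^sup>2 = (norm d)\<^sup>2 - 2 * lam * (xbar' \<bullet> d) - 2 * (d \<bullet> e)"
      unfolding power2_norm_eq_inner wd d_def
      by (simp add: inner_diff_left inner_diff_right inner_add_left inner_add_right inner_commute algebra_simps)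
    have up': "p \<le> rphi xbar - ((norm d)\<^sup>2 - 2 * lam * (xbar' \<bullet> d) - 2 * (d \<bullet> e)) / (2 * lam)"
      using up unfolding sq[symmetric] by (simp add: diff_divide_distrib)
    have split: "((norm d)\<^sup>2 - 2 * lam * (xbar' \<bullet> d) - 2 * (d \<bullet> e)) / (2 * lam) = (r + 1) * (norm d)\<^sup>2 - xbar' \<bullet> d - 2 * (r + 1) * (d \<bullet> e)"
      unfolding lam(3)[symmetric] using lam(1) by (simp add: field_simps)
    \<comment> \<open>The terms with \<open>xbar'\<close> cancel because \<open>w0 = xbar + lam *\<^sub>R xbar'\<close>.\<close>
    have key: "(r + 1) * (norm d)\<^sup>2 - r / 2 * (norm d)\<^sup>2 \<le> 2 * (r + 1) * (d \<bullet> e)"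
      using low up' unfolding split by linarith
    have nd: "norm d \<le> 4 * norm e"
    proof (cases "norm d = 0")
      case False
      have "(r + 1) / 2 * (norm d)\<^sup>2 \<le> (r + 1) * (norm d)\<^sup>2 - r / 2 * (norm d)\<^sup>2"
        by (simp add: algebra_simps) 
      also have "\<dots> \<le> 2 * (r + 1) * (norm d * norm e)"
        using key norm_cauchy_schwarz[of d e] r by (meson mult_left_mono order_trans add_nonneg_nonneg zero_le_numeral mult_nonneg_nonneg zero_le_one)
      finally have "(r + 1) * (norm d * norm d) \<le> (r + 1) * (norm d * (4 * norm e))" by (simp add: power2_eq_square algebra_simps)
      then show ?thesis using r False by simp
    qed simp
    have dr: "norm d < \<rho>" using nd e1 by linarith
    define x' where "x' = (w - x) /\<^sub>R lam"
    have Ex: "E (x, x') = w" using lam(1) by (simp add: E_def x'_def)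
    have "x' \<in> regular_subdifferential \<phi> x"
    proof (rule proximal_imp_regular_subdifferential[where U="ball xbar \<rho>" and c="1 / (2 * lam)"])
      show "\<bar>\<phi> x\<bar> \<noteq> \<infinity>" by (simp add: p)
      show "x \<in> ball xbar \<rho>" using dr by (simp add: d_def dist_norm norm_minus_commute)
      fix y assume y: "y \<in> ball xbar \<rho>"
      have "(norm (y - w))\<^sup>2 - (norm (x - w))\<^sup>2 = (norm (y - x))\<^sup>2 - 2 * ((w - x) \<bullet> (y - x))"
        unfolding power2_norm_eq_inner by (simp add: inner_diff_left inner_diff_right inner_commute)
      also have "(w - x) \<bullet> (y - x) = lam * (x' \<bullet> (y - x))" using lam(1) by (simp add: x'_def)
      finally have "(norm (x - w))\<^sup>2 / (2 * lam) - (norm (y - w))\<^sup>2 / (2 * lam) = x' \<bullet> (y - x) - 1 / (2 * lam) * (norm (y - x))\<^sup>2"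
        using lam(1) by (simp add: field_simps)
      then show "\<phi> x + ereal (x' \<bullet> (y - x) - 1 / (2 * lam) * (norm (y - x))\<^sup>2) \<le> \<phi> y"
        using min[of y] y proper[of y] by (cases "\<phi> y") (auto simp: p)
    qed (use lam(1) in auto)
    then have x'L: "x' \<in> limiting_subdifferential \<phi> x" using regular_subset_limiting_subdifferential by blast
    have "lam *\<^sub>R (x' - xbar') = e - d" using lam(1) by (simp add: x'_def wd d_def algebra_simps)
    then have "lam * norm (x' - xbar') = norm (e - d)" using lam(1) by (metis abs_of_pos norm_scaleR)
    also have "\<dots> \<le> norm e + norm d" by (rule norm_triangle_ineq4)
    also have "\<dots> < \<epsilon> * lam" using nd e1(3) by linarith
    finally have x'b: "norm (x' - xbar') < \<epsilon>" using lam(1) by (simp add: mult.commute)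
    have "p < rphi xbar + \<epsilon>"
    proof -
      have "p \<le> rphi xbar + (2 * lam * (xbar' \<bullet> d) + 2 * (d \<bullet> e)) / (2 * lam)"
      proof -
        have "0 \<le> (norm d)\<^sup>2 / (2 * lam)" using lam(1) by simp
        then show ?thesis using up' by (simp add: diff_divide_distrib add_divide_distrib)
      qed
      also have "(2 * lam * (xbar' \<bullet> d) + 2 * (d \<bullet> e)) / (2 * lam) = (lam * (xbar' \<bullet> d) + d \<bullet> e) / lam"
        using lam(1) by (simp add: field_simps)
      also have "\<dots> \<le> (M * (4 * norm e)) / lam"
      proof (rule divide_right_mono)
        have "lam * (xbar' \<bullet> d) \<le> lam * (norm xbar' * norm d)"
          using lam(1) norm_cauchy_schwarz[of xbar' d] by simp
        moreover have "d \<bullet> e \<le> norm d * 1"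
          using norm_cauchy_schwarz[of d e] e1(1) by (meson less_imp_le mult_left_mono norm_ge_zero order_trans)
        ultimately have "lam * (xbar' \<bullet> d) + d \<bullet> e \<le> M * norm d" by (simp add: M_def algebra_simps)
        also have "\<dots> \<le> M * (4 * norm e)" using nd M by simp
        finally show "lam * (xbar' \<bullet> d) + d \<bullet> e \<le> M * (4 * norm e)" .
      qed (use lam in auto)
      also have "\<dots> < \<epsilon>" using e2 M lam(1) by (simp add: pos_less_divide_eq pos_divide_less_eq mult_ac)
      finally show ?thesis by simp
    qed
    then have "(x, x') \<in> \<Omega>"
      using x'L xb x'b by (simp add: mem_\<Omega> p phi_xbar dist_norm norm_minus_commute)
    with Ex show ?thesis by blast
  qed
  with \<delta> show ?thesis by blast
qed

definition G :: "'a \<Rightarrow> 'a \<times> 'a" where "G = inv_into \<Omega> E"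

lemma GE: "z \<in> \<Omega> \<Longrightarrow> G (E z) = z"
  unfolding G_def by (rule inv_into_f_f[OF inj_E])

lemma G_w0: "G w0 = (xbar, xbar')"
  unfolding w0_def by (rule GE[OF zbar_in])

definition \<delta>0 :: real where "\<delta>0 = (SOME \<delta>. \<delta> > 0 \<and> (\<forall>w\<in>ball w0 \<delta>. \<exists>z\<in>\<Omega>. E z = w))"

lemma \<delta>0: "\<delta>0 > 0" "w \<in> ball w0 \<delta>0 \<Longrightarrow> \<exists>z\<in>\<Omega>. E z = w"
  using someI_ex[of "\<lambda>\<delta>. \<delta> > 0 \<and> (\<forall>w\<in>ball w0 \<delta>. \<exists>z\<in>\<Omega>. E z = w)"] prox_point_exists
  unfolding \<delta>0_def by blast+

lemma G_in_\<Omega>: "w \<in> ball w0 \<delta>0 \<Longrightarrow> G w \<in> \<Omega> \<and> E (G w) = w"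
  using \<delta>0(2) GE by metis

lemma chart: "lipschitz_chart \<Omega> (E -` ball w0 \<delta>0) (ball w0 \<delta>0) G E w0 C"
proof (rule lipschitz_chart.intro)
  have bl: "bounded_linear E" using linear_E by (simp add: linear_conv_bounded_linear)
  show "open (E -` ball w0 \<delta>0)"
    by (rule open_vimage) (auto intro: linear_continuous_on bl)
  show "w0 \<in> ball w0 \<delta>0" using \<delta>0 by simp
  show "C-lipschitz_on (ball w0 \<delta>0) G"
  proof (rule lipschitz_onI)
    fix u v assume "u \<in> ball w0 \<delta>0" "v \<in> ball w0 \<delta>0"
    then show "dist (G u) (G v) \<le> C * dist u v"
      using E_expansive[of "G u" "G v"] G_in_\<Omega> by (simp add: dist_norm)
  qed (use lam(1) in \<open>simp add: C_def\<close>)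
  show "\<Omega> \<inter> E -` ball w0 \<delta>0 = G ` ball w0 \<delta>0"
  proof (intro equalityI subsetI)
    fix z assume "z \<in> \<Omega> \<inter> E -` ball w0 \<delta>0"
    then show "z \<in> G ` ball w0 \<delta>0" using GE[of z] by (intro image_eqI[of z G "E z"]) auto
  qed (use G_in_\<Omega> in auto)
qed (use G_in_\<Omega> linear_E in auto)

text \<open>Lets the same parametrization serve any set that agrees with \<open>\<Omega>\<close> near the reference point.\<close>

lemma chart_localize:
  assumes O: "open O'" "(xbar, xbar') \<in> O'" and eq: "\<Omega>' \<inter> O' = \<Omega> \<inter> O'"
  obtains W V where "lipschitz_chart \<Omega>' W V G E w0 C" "lipschitz_chart \<Omega> W V G E w0 C" "V \<subseteq> ball w0 \<delta>0"
proof -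
  interpret c: lipschitz_chart \<Omega> "E -` ball w0 \<delta>0" "ball w0 \<delta>0" G E w0 C by (rule chart)
  define W where "W = E -` ball w0 \<delta>0 \<inter> O'"
  define V where "V = ball w0 \<delta>0 \<inter> G -` O'"
  have cont: "continuous_on (ball w0 \<delta>0) G" using c.lip by (rule lipschitz_on_continuous_on)
  have V: "open V" unfolding V_def by (rule continuous_open_preimage[OF cont open_ball O(1)])
  have w0V: "w0 \<in> V" using \<delta>0(1) O(2) by (simp add: V_def G_w0)
  have W: "open W" unfolding W_def using c.open_W O(1) by (rule open_Int)
  have "\<Omega> \<inter> W = G ` V"
  proof (intro equalityI subsetI)
    fix z assume z: "z \<in> \<Omega> \<inter> W"
    then have "z \<in> G ` ball w0 \<delta>0" using c.chart by (auto simp: W_def)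
    then show "z \<in> G ` V" using z by (auto simp: V_def W_def)
  next
    fix z assume "z \<in> G ` V"
    then have "z \<in> G ` ball w0 \<delta>0" "z \<in> O'" by (auto simp: V_def)
    then show "z \<in> \<Omega> \<inter> W" using c.chart unfolding W_def by blast
  qed
  moreover have "\<Omega>' \<inter> W = \<Omega> \<inter> W" using eq by (auto simp: W_def)
  moreover have "E (G w) = w" if "w \<in> V" for w using c.EG that by (simp add: V_def)
  moreover have "C-lipschitz_on V G" by (rule lipschitz_on_subset[OF c.lip]) (auto simp: V_def)
  ultimately have "lipschitz_chart \<Omega>' W V G E w0 C" "lipschitz_chart \<Omega> W V G E w0 C"
    using V W w0V linear_E by (auto simp: lipschitz_chart_def)
  then show ?thesis using that by (auto simp: V_def)
qed

text \<open>The first component \<open>P\<close> of \<open>G\<close> is the proximal map, and it is the gradient of the conjugate-like function \<open>\<psi>\<close>: optimality of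
\<open>P w2\<close>, compared with \<open>P w1\<close>, says that \<open>P w1\<close> is a subgradient of \<open>\<psi>\<close> at \<open>w1\<close>, and \<open>P\<close> is continuous. Hence the derivative
\<open>A\<close> of \<open>P\<close> is symmetric. The tangent space consists of the pairs \<open>(u, u')\<close> with \<open>A (u + lam *\<^sub>R u') = u\<close>, and symmetry of
\<open>A\<close> is precisely what makes this condition coincide with membership in the adjoint subspace.\<close>

lemma strict_derivative_self_adjoint:
  assumes V: "open V" "w0 \<in> V" "V \<subseteq> ball w0 \<delta>0" and H: "strict_derivative V G H w0"
  shows "adjoint_subspace (range H) = range H"
proof -
  interpret c: lipschitz_chart \<Omega> "E -` ball w0 \<delta>0" "ball w0 \<delta>0" G E w0 C by (rule chart)
  have linH: "linear H" using H by (simp add: strict_derivative_def)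
  have EH: "E (H a) = a" for a
    using c.derivative_right_inverse[OF c.w0 strict_derivative_imp_has_derivative[OF H V(1,2)]] .
  define A where "A a = fst (H a)" for a
  have B: "lam *\<^sub>R snd (H a) = a - A a" for a using EH[of a] by (simp add: E_def A_def eq_diff_eq add.commute)
  define P where "P w = fst (G w)" for w
  define \<psi> where "\<psi> w = w \<bullet> P w - lam * rphi (P w) - (norm (P w))\<^sup>2 / 2" for w
  have sub: "\<psi> w2 \<ge> \<psi> w1 + P w1 \<bullet> (w2 - w1)" if "w1 \<in> ball w0 \<delta>0" "w2 \<in> ball w0 \<delta>0" for w1 w2
  proof -
    obtain x1 x1' x2 x2' where g: "G w1 = (x1, x1')" "G w2 = (x2, x2')" by (metis prod.exhaust)
    have in\<Omega>: "(x1, x1') \<in> \<Omega>" "(x2, x2') \<in> \<Omega>" and w2: "w2 = x2 + lam *\<^sub>R x2'"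
      using G_in_\<Omega>[OF that(1)] G_in_\<Omega>[OF that(2)] by (auto simp: g E_def)
    have "lam * (rphi x2 + x2' \<bullet> (x1 - x2) - r / 2 * (norm (x1 - x2))\<^sup>2) \<le> lam * rphi x1"
      using prox_real[OF in\<Omega>(2,1)] lam(1) by (intro mult_left_mono) auto
    moreover have "lam * (r / 2 * (norm (x1 - x2))\<^sup>2) \<le> (norm (x1 - x2))\<^sup>2 / 2"
    proof -
      have "lam * r * (norm (x1 - x2))\<^sup>2 \<le> 1 * (norm (x1 - x2))\<^sup>2" using lam(2) by (intro mult_right_mono) auto
      then show ?thesis by simp
    qed
    ultimately have "lam * rphi x2 + (w2 - x2) \<bullet> (x1 - x2) - (norm (x1 - x2))\<^sup>2 / 2 \<le> lam * rphi x1"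
      by (simp add: w2 algebra_simps)
    moreover have "(w2 - x2) \<bullet> (x1 - x2) - (norm (x1 - x2))\<^sup>2 / 2 = w2 \<bullet> (x1 - x2) + (norm x2)\<^sup>2 / 2 - (norm x1)\<^sup>2 / 2"
      unfolding power2_norm_eq_inner by (simp add: inner_diff_left inner_diff_right inner_commute field_simps)
    ultimately have "lam * rphi x2 + (w2 \<bullet> (x1 - x2) + (norm x2)\<^sup>2 / 2 - (norm x1)\<^sup>2 / 2) \<le> lam * rphi x1" by linarith
    then show ?thesis by (simp add: \<psi>_def P_def g inner_diff_right inner_commute)
  qed
  have nf: "norm (fst p) \<le> norm p" for p :: "'a \<times> 'a" using norm_fst_le[of "fst p" "snd p"] by simp
  have P_lip: "norm (P u - P v) \<le> C * norm (u - v)" if "u \<in> ball w0 \<delta>0" "v \<in> ball w0 \<delta>0" for u v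
    using nf[of "G u - G v"] c.lipG[OF that] by (simp add: P_def)
  have grad: "(\<psi> has_derivative (\<lambda>h. P w \<bullet> h)) (at w)" if w: "w \<in> V" for w
    unfolding has_derivative_at_alt
  proof (intro conjI allI impI)
    show "bounded_linear ((\<bullet>) (P w))" by (rule bounded_linear_inner_right)
    fix e :: real assume e: "e > 0"
    have wb: "w \<in> ball w0 \<delta>0" using w V(3) by blast
    then obtain d where d: "d > 0" "ball w d \<subseteq> ball w0 \<delta>0" using open_ball open_contains_ball by blast
    have Cp: "C > 0" using lam(1) by (simp add: C_def add_pos_pos)
    show "\<exists>d>0. \<forall>y. norm (y - w) < d \<longrightarrow> norm (\<psi> y - \<psi> w - P w \<bullet> (y - w)) \<le> e * norm (y - w)"
    proof (intro exI[of _ "min d (e / C)"] conjI allI impI)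
      fix y assume y: "norm (y - w) < min d (e / C)"
      then have yb: "y \<in> ball w0 \<delta>0" using d(2) by (auto simp: dist_norm norm_minus_commute subset_iff)
      have 1: "0 \<le> \<psi> y - \<psi> w - P w \<bullet> (y - w)" using sub[OF wb yb] by simp
      have "\<psi> y - \<psi> w - P w \<bullet> (y - w) \<le> (P y - P w) \<bullet> (y - w)"
        using sub[OF yb wb] by (simp add: inner_diff_left inner_diff_right)
      also have "\<dots> \<le> norm (P y - P w) * norm (y - w)" by (rule norm_cauchy_schwarz)
      also have "\<dots> \<le> (C * norm (y - w)) * norm (y - w)" by (intro mult_right_mono P_lip yb wb) auto
      also have "\<dots> \<le> e * norm (y - w)"
        using y Cp by (intro mult_right_mono) (auto simp: pos_less_divide_eq mult.commute)
      finally show "norm (\<psi> y - \<psi> w - P w \<bullet> (y - w)) \<le> e * norm (y - w)" using 1 by simp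
    qed (use d e Cp in auto)
  qed
  have "strict_derivative V P A w0"
    unfolding strict_derivative_def
  proof (intro conjI allI impI)
    show "linear A" unfolding A_def by (rule linear_compose[OF linH linear_fst, unfolded o_def])
    fix e :: real assume "e > 0"
    then obtain d where d: "d > 0" "\<forall>u\<in>V \<inter> ball w0 d. \<forall>v\<in>V \<inter> ball w0 d. norm (G v - G u - H (v - u)) \<le> e * norm (v - u)"
      using H unfolding strict_derivative_def by blast
    show "\<exists>d>0. \<forall>u\<in>V \<inter> ball w0 d. \<forall>v\<in>V \<inter> ball w0 d. norm (P v - P u - A (v - u)) \<le> e * norm (v - u)"
    proof (intro exI[of _ d] conjI d(1) ballI)
      fix u v assume "u \<in> V \<inter> ball w0 d" "v \<in> V \<inter> ball w0 d"
      then have "norm (G v - G u - H (v - u)) \<le> e * norm (v - u)" using d(2) by blast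
      then show "norm (P v - P u - A (v - u)) \<le> e * norm (v - u)"
        using nf[of "G v - G u - H (v - u)"] by (simp add: P_def A_def)
    qed
  qed
  note sym = symmetric_strict_derivative_of_gradient[OF V(1,2) grad this]
  have mem: "(u, u') \<in> adjoint_subspace (range H) \<longleftrightarrow> A (u + lam *\<^sub>R u') = u" for u u'
  proof -
    have "(u, u') \<in> adjoint_subspace (range H) \<longleftrightarrow> (\<forall>a. u' \<bullet> A a - u \<bullet> snd (H a) = 0)"
      by (auto simp: in_adjoint_subspace_iff A_def split_beta)
    also have "\<dots> \<longleftrightarrow> (\<forall>a. (A (u + lam *\<^sub>R u') - u) \<bullet> a = 0)"
    proof (intro iff_allI)
      fix a
      have "lam * (u' \<bullet> A a - u \<bullet> snd (H a)) = lam * (u' \<bullet> A a) - u \<bullet> (lam *\<^sub>R snd (H a))" by (simp add: algebra_simps)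
      also have "\<dots> = (u + lam *\<^sub>R u') \<bullet> A a - u \<bullet> a" by (simp add: B inner_diff_right inner_add_left)
      also have "\<dots> = (A (u + lam *\<^sub>R u') - u) \<bullet> a" using sym[of "u + lam *\<^sub>R u'" a] by (simp add: inner_diff_left)
      finally show "(u' \<bullet> A a - u \<bullet> snd (H a) = 0) = ((A (u + lam *\<^sub>R u') - u) \<bullet> a = 0)"
        using lam(1) by (metis less_irrefl mult_eq_0_iff)
    qed
    also have "\<dots> \<longleftrightarrow> A (u + lam *\<^sub>R u') = u"
      by (metis eq_iff_diff_eq_0 inner_eq_zero_iff inner_zero_left)
    finally show ?thesis .
  qed
  have mem': "(u, u') \<in> range H \<longleftrightarrow> A (u + lam *\<^sub>R u') = u" for u u'
  proof
    assume "(u, u') \<in> range H"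
    then obtain c where c: "H c = (u, u')" by (metis imageE)
    then have "c = u + lam *\<^sub>R u'" using EH[of c] by (simp add: E_def)
    then show "A (u + lam *\<^sub>R u') = u" using c by (simp add: A_def)
  next
    assume Au: "A (u + lam *\<^sub>R u') = u"
    have "lam *\<^sub>R snd (H (u + lam *\<^sub>R u')) = lam *\<^sub>R u'" using B[of "u + lam *\<^sub>R u'"] Au by simp
    then have "snd (H (u + lam *\<^sub>R u')) = u'" using lam(1) by simp
    then have "H (u + lam *\<^sub>R u') = (u, u')" using Au by (metis A_def prod.collapse)
    then show "(u, u') \<in> range H" by (metis rangeI)
  qed
  show ?thesis by (rule set_eqI) (simp only: split_paired_all mem mem')
qed

lemma gph_coderivative:
  assumes "attentive_normal_cone \<phi> z = polar (range H)" "linear H"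
  shows "gph (attentive_coderivative \<phi> z) = adjoint_subspace (range H)"
  using assms by (auto simp: gph_def attentive_coderivative_def polar_range adjoint_subspace_def orthogonal_comp_iff)

text \<open>The graph of the coderivative is the normal cone turned by the isometry \<open>(x', - y') \<mapsto> (y', x')\<close>.\<close>

lemma subspace_coderivative_iff:
  "subspace (gph (attentive_coderivative \<phi> z)) \<longleftrightarrow> subspace (attentive_normal_cone \<phi> z)"
proof -
  define J where "J p = (snd p, - fst p)" for p :: "'a \<times> 'a"
  define J' where "J' p = (- snd p, fst p)" for p :: "'a \<times> 'a"
  have lin: "linear J" "linear J'" by (auto intro!: linearI simp: J_def J'_def)
  have g: "gph (attentive_coderivative \<phi> z) = J' ` attentive_normal_cone \<phi> z"
    by (force simp: gph_def attentive_coderivative_def J'_def image_iff)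
  have n: "attentive_normal_cone \<phi> z = J ` gph (attentive_coderivative \<phi> z)"
    unfolding g image_image by (simp add: J_def J'_def)
  show ?thesis using linear_subspace_image[OF lin(1)] linear_subspace_image[OF lin(2)] g n by metis
qed

text \<open>Two charts with the same parametrization are assumed: one for the graph of \<open>F\<close>, to which the statements about \<open>F\<close> refer, and one for
\<open>\<Omega>\<close>, to which the attentive objects refer.\<close>

lemma equivalences:
  assumes c1: "lipschitz_chart (gph F) W V G E w0 C" and c2: "lipschitz_chart \<Omega> W V G E w0 C" and V: "V \<subseteq> ball w0 \<delta>0"
  defines "sd \<equiv> \<exists>H. strict_derivative V G H w0"
  shows "strictly_proto_differentiable F xbar xbar' \<longleftrightarrow> sd"
    "graphically_strictly_differentiable F xbar xbar' \<longleftrightarrow> sd"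
    "subspace (gph (attentive_coderivative \<phi> (xbar, xbar'))) \<longleftrightarrow> sd"
    "graphically_regular F xbar xbar' \<longleftrightarrow> sd"
    "attentive_regular_normal_cone \<phi> (xbar, xbar') = attentive_normal_cone \<phi> (xbar, xbar') \<longleftrightarrow> sd"
    "is_singleton (SC_derivative \<phi> (xbar, xbar')) \<longleftrightarrow> sd"
    "sd \<Longrightarrow> SC_derivative \<phi> (xbar, xbar') = SC_adjoint_derivative \<phi> (xbar, xbar') \<and>
       SC_adjoint_derivative \<phi> (xbar, xbar') = {gph (attentive_derivative \<phi> (xbar, xbar'))} \<and>
       {gph (attentive_derivative \<phi> (xbar, xbar'))} = {gph (attentive_coderivative \<phi> (xbar, xbar'))}"
proof -
  interpret c1: lipschitz_chart "gph F" W V G E w0 C by (rule c1)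
  interpret c2: lipschitz_chart \<Omega> W V G E w0 C by (rule c2)
  have z: "(xbar, xbar') = G w0" by (simp add: G_w0)
  \<comment> \<open>The right inverse of \<open>E\<close> whose range is the orthogonal complement of the kernel of \<open>E\<close>.\<close>
  define R where "R w = ((1 / (1 + lam\<^sup>2)) *\<^sub>R w, (lam / (1 + lam\<^sup>2)) *\<^sub>R w)" for w :: 'a
  have R: "linear R" unfolding R_def by (rule linearI) (auto simp: algebra_simps)
  have ER: "E (R w) = w" for w
  proof -
    have p: "1 + lam\<^sup>2 > 0" by (simp add: add_pos_nonneg)
    have "E (R w) = (1 / (1 + lam\<^sup>2) + lam * (lam / (1 + lam\<^sup>2))) *\<^sub>R w" by (simp add: E_def R_def scaleR_add_left)
    also have "1 / (1 + lam\<^sup>2) + lam * (lam / (1 + lam\<^sup>2)) = 1" using p by (simp add: field_simps power2_eq_square)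
    finally show ?thesis by simp
  qed
  have Rperp: "k \<bullet> R w = 0" if "E k = 0" for k w
  proof -
    have "k \<bullet> R w = (1 / (1 + lam\<^sup>2)) * (E k \<bullet> w)"
      by (cases k) (simp add: R_def E_def inner_add_left add_divide_distrib)
    then show ?thesis using that by simp
  qed
  have spd: "sd" if "strictly_proto_differentiable F xbar xbar'"
    using that c1.strict_if_strictly_proto unfolding strictly_proto_differentiable_def z sd_def by simp
  have gsd: "graphically_strictly_differentiable F xbar xbar'" if "sd"
    using that strict_imp_graphically_strictly_differentiable[OF c1 G_w0 R ER Rperp] unfolding sd_def by blast
  show "strictly_proto_differentiable F xbar xbar' \<longleftrightarrow> sd" "graphically_strictly_differentiable F xbar xbar' \<longleftrightarrow> sd"
    using spd gsd graphically_strictly_differentiable_imp_strictly_proto_differentiable[of F xbar xbar'] by blast+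
  have n: "attentive_normal_cone \<phi> (xbar, xbar') = limiting_normal_cone \<Omega> (G w0)"
    "attentive_regular_normal_cone \<phi> (xbar, xbar') = regular_normal_cone \<Omega> (G w0)"
    "SC_derivative \<phi> (xbar, xbar') = SC_limits DIM('a) \<Omega> (G w0)"
    "attentive_tangent_cone \<phi> (xbar, xbar') = tangent_cone \<Omega> (G w0)"
    using attentive_normal_eq[OF zbar_in] attentive_regular_eq[OF zbar_in] SC_derivative_eq[OF zbar_in] attentive_tangent_eq[OF zbar_in]
    by (simp_all add: z)
  show "subspace (gph (attentive_coderivative \<phi> (xbar, xbar'))) \<longleftrightarrow> sd"
    unfolding subspace_coderivative_iff n sd_def by (rule c2.limiting_subspace_iff_strict)
  show "graphically_regular F xbar xbar' \<longleftrightarrow> sd"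
    unfolding graphically_regular_def z sd_def by (rule c1.regular_eq_limiting_iff_strict)
  show "attentive_regular_normal_cone \<phi> (xbar, xbar') = attentive_normal_cone \<phi> (xbar, xbar') \<longleftrightarrow> sd"
    unfolding n sd_def by (rule c2.regular_eq_limiting_iff_strict)
  show "is_singleton (SC_derivative \<phi> (xbar, xbar')) \<longleftrightarrow> sd"
    unfolding n sd_def by (rule c2.SC_singleton_iff_strict)
  assume sd
  then obtain H where H: "strict_derivative V G H w0" unfolding sd_def by blast
  then have linH: "linear H" by (simp add: strict_derivative_def)
  note ids = c2.strict_identities[OF H]
  have adj: "adjoint_subspace (range H) = range H"
    by (rule strict_derivative_self_adjoint[OF c2.open_V c2.w0 V H])
  have "gph (attentive_derivative \<phi> (xbar, xbar')) = range H"
    using n(4) ids(1) by (auto simp: gph_def attentive_derivative_def)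
  moreover have "gph (attentive_coderivative \<phi> (xbar, xbar')) = range H"
    using gph_coderivative[OF _ linH] n(1) ids(2) adj by simp
  ultimately show "SC_derivative \<phi> (xbar, xbar') = SC_adjoint_derivative \<phi> (xbar, xbar') \<and>
       SC_adjoint_derivative \<phi> (xbar, xbar') = {gph (attentive_derivative \<phi> (xbar, xbar'))} \<and>
       {gph (attentive_derivative \<phi> (xbar, xbar'))} = {gph (attentive_coderivative \<phi> (xbar, xbar'))}"
    unfolding SC_adjoint_derivative_def n(3) ids(3) by (simp add: adj)
qed

text \<open>A sequence of points of the graph that converges to the reference point outside \<open>\<Omega>\<close> would converge attentively by
subdifferential continuity, and then it would have to enter \<open>\<Omega>\<close>.\<close>

lemma localization_agrees:
  assumes "subdifferentially_continuous \<phi> xbar xbar'"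
  obtains O' where "open O'" "(xbar, xbar') \<in> O'" "gph (limiting_subdifferential \<phi>) \<inter> O' = \<Omega> \<inter> O'"
proof -
  have "\<exists>k. gph (limiting_subdifferential \<phi>) \<inter> ball (xbar, xbar') (inv_nat k) \<subseteq> \<Omega>"
  proof (rule ccontr)
    assume "\<not> ?thesis"
    then have "\<forall>k. \<exists>z. z \<in> gph (limiting_subdifferential \<phi>) \<and> z \<in> ball (xbar, xbar') (inv_nat k) \<and> z \<notin> \<Omega>" by blast
    then obtain zk where zk: "\<And>k. zk k \<in> gph (limiting_subdifferential \<phi>)" "\<And>k. zk k \<in> ball (xbar, xbar') (inv_nat k)" "\<And>k. zk k \<notin> \<Omega>"
      by metis
    have lim: "zk \<longlonglongrightarrow> (xbar, xbar')"
      by (rule metric_tendsto_imp_tendsto[OF LIMSEQ_inverse_real_of_nat])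
        (use zk(2) in \<open>auto simp: dist_commute intro!: always_eventually less_imp_le\<close>)
    have "(\<lambda>k. \<phi> (fst (zk k))) \<longlonglongrightarrow> \<phi> xbar"
      using assms zk(1) tendsto_fst[OF lim] tendsto_snd[OF lim] unfolding subdifferentially_continuous_def
      by (elim allE[of _ "\<lambda>k. fst (zk k)"] allE[of _ "\<lambda>k. snd (zk k)"]) simp
    then have "attentive_conv \<phi> zk (xbar, xbar')" using zk(1) lim by (simp add: attentive_conv_def)
    from attentive_convD(2)[OF this zbar_in] show False using zk(3) by simp
  qed
  then obtain k where k: "gph (limiting_subdifferential \<phi>) \<inter> ball (xbar, xbar') (inv_nat k) \<subseteq> \<Omega>" by blast
  show ?thesis
    by (rule that[of "ball (xbar, xbar') (inv_nat k)"]) (use k \<Omega>_subset in auto)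
qed

end

lemma all_equivalentI:
  assumes "\<And>P. P \<in> set Ps \<Longrightarrow> P \<longleftrightarrow> Q"
  shows "all_equivalent Ps"
  using assms unfolding all_equivalent_def by blast

theorem corollary4p2:
  fixes \<phi> :: "real ^ 'n \<Rightarrow> ereal" and xbar xbar' :: "real ^ 'n" and \<epsilon> :: real
  assumes proper_values: "\<And>x. \<phi> x \<noteq> -\<infinity>"
    and lsc: "lsc \<phi>"
    and prox_regular: "\<exists>r. prox_regular \<phi> xbar xbar' r \<epsilon>"
  shows
    "let z = (xbar, xbar');
         T = attentive_localization \<phi> xbar xbar' \<epsilon>;
         statements = (\<lambda>F.
           [strictly_proto_differentiable F xbar xbar',
            graphically_strictly_differentiable F xbar xbar',
            subspace (gph (attentive_coderivative \<phi> z)),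
            graphically_regular F xbar xbar',
            attentive_regular_normal_cone \<phi> z = attentive_normal_cone \<phi> z,
            is_singleton (SC_derivative \<phi> z)]);
         identities =
           (SC_derivative \<phi> z = SC_adjoint_derivative \<phi> z \<and>
            SC_adjoint_derivative \<phi> z = {gph (attentive_derivative \<phi> z)} \<and>
            {gph (attentive_derivative \<phi> z)} = {gph (attentive_coderivative \<phi> z)})
     in all_equivalent (statements T) \<and>
        (\<forall>P \<in> set (statements T). P \<longrightarrow> identities) \<and>
        (subdifferentially_continuous \<phi> xbar xbar' \<longrightarrow>
           all_equivalent (statements (limiting_subdifferential \<phi>)) \<and>
           (\<forall>P \<in> set (statements (limiting_subdifferential \<phi>)). P \<longrightarrow> identities))"
proof -
  obtain r where "prox_regular \<phi> xbar xbar' r \<epsilon>" using prox_regular by blast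
  then interpret prox_regular_function \<phi> xbar xbar' r \<epsilon>
    by unfold_locales (use proper_values lsc in auto)
  define statements where "statements F =
           [strictly_proto_differentiable F xbar xbar',
            graphically_strictly_differentiable F xbar xbar',
            subspace (gph (attentive_coderivative \<phi> (xbar, xbar'))),
            graphically_regular F xbar xbar',
            attentive_regular_normal_cone \<phi> (xbar, xbar') = attentive_normal_cone \<phi> (xbar, xbar'),
            is_singleton (SC_derivative \<phi> (xbar, xbar'))]" for F
  define identities where "identities \<longleftrightarrow>
           (SC_derivative \<phi> (xbar, xbar') = SC_adjoint_derivative \<phi> (xbar, xbar') \<and>
            SC_adjoint_derivative \<phi> (xbar, xbar') = {gph (attentive_derivative \<phi> (xbar, xbar'))} \<and>
            {gph (attentive_derivative \<phi> (xbar, xbar'))} = {gph (attentive_coderivative \<phi> (xbar, xbar'))})"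
  have main: "all_equivalent (statements F) \<and> (\<forall>P \<in> set (statements F). P \<longrightarrow> identities)"
    if "lipschitz_chart (gph F) W V G E w0 C" "lipschitz_chart \<Omega> W V G E w0 C" "V \<subseteq> ball w0 \<delta>0" for F W V
  proof -
    note eqs = equivalences[OF that]
    have eq: "P \<longleftrightarrow> (\<exists>H. strict_derivative V G H w0)" if "P \<in> set (statements F)" for P
      using that unfolding statements_def list.set by (elim insertE emptyE) (simp_all only: eqs(1-6))
    then show ?thesis using all_equivalentI[OF eq] eqs(7) unfolding identities_def by blast
  qed
  have "all_equivalent (statements (attentive_localization \<phi> xbar xbar' \<epsilon>)) \<and>
      (\<forall>P \<in> set (statements (attentive_localization \<phi> xbar xbar' \<epsilon>)). P \<longrightarrow> identities)"
    by (rule main[OF _ chart order_refl]) (use chart in \<open>simp add: \<Omega>_def\<close>)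
  moreover have "all_equivalent (statements (limiting_subdifferential \<phi>)) \<and>
      (\<forall>P \<in> set (statements (limiting_subdifferential \<phi>)). P \<longrightarrow> identities)"
    if sc: "subdifferentially_continuous \<phi> xbar xbar'"
  proof -
    obtain O' where O': "open O'" "(xbar, xbar') \<in> O'" "gph (limiting_subdifferential \<phi>) \<inter> O' = \<Omega> \<inter> O'"
      using localization_agrees[OF sc] .
    obtain W V where "lipschitz_chart (gph (limiting_subdifferential \<phi>)) W V G E w0 C" "lipschitz_chart \<Omega> W V G E w0 C" "V \<subseteq> ball w0 \<delta>0"
      using chart_localize[OF O'] .
    then show ?thesis by (rule main)
  qed
  ultimately show ?thesis
    unfolding Let_def statements_def[symmetric] identities_def[symmetric] by blast
qed

end
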